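(* Let $n\ge2$ and let $y_0,\dots,y_n$ be points of $\mathcal{H}_n\cup\partial\mathcal{H}_n$ (vertices may lie on the absolute). Then $$\frac{(n-1)^n\,\mathrm{vol}(S^{n-1})}{n}\cdot\mathrm{vol}\,I(y_0,\dots,y_n)=\int_{\partial\mathcal{H}_n}\log\Big|\frac{\mu_{y_1}}{\mu_{y_0}}\Big|\,d\log\Big|\frac{\mu_{y_2}}{\mu_{y_0}}\Big|\wedge\dots\wedge d\log\Big|\frac{\mu_{y_n}}{\mu_{y_0}}\Big|.$$
   Context: On $\mathbb{R}^{n+1}$ with coordinates $x_0,\dots,x_n$ let $Q(x)=x_0^2+\dots+x_{n-1}^2-x_n^2$ with associated symmetric bilinear form $(\cdot,\cdot)$. The hyperbolic space $\mathcal{H}_n$ is the projectivization of $\{Q<0\}$ and its absolute $\partial\mathcal{H}_n$ is the projectivization of $\{Q=0,x\ne0\}$. In the ball model (coordinates $y_j=x_j/x_n$) $\mathcal{H}_n$ is the open unit ball, geodesic simplices $I(y_0,\dots,y_n)$ are the convex hulls of their vertices, $\partial\mathcal{H}_n$ is the unit sphere $S^{n-1}$ oriented as the boundary of the ball, and $\mathrm{vol}$ is the integral over the simplex (oriented by the ordering of vertices) of the invariant volume form equal to $dy_1\wedge\dots\wedge dy_n$ at the origin; $\mathrm{vol}(S^{n-1})$ is the Euclidean volume of the unit sphere. For $y\in\mathcal{H}_n\cup\partial\mathcal{H}_n$ with a lift $y'\in\mathbb{R}^{n+1}$, $\mu_y$ is the (singular if $y\in\partial\mathcal{H}_n$) volume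 form $\delta(Q(x))\sigma_{n+1}(x,dx)/(x,y')^{n-1}$ on the absolute, where $\sigma_{n+1}(x,dx)=\sum_i(-1)^ix_i\,dx_0\wedge\dots\wedge\widehat{dx_i}\wedge\dots\wedge dx_n$; thus $\mu_{y_i}/\mu_{y_0}=(x,y_0')^{n-1}/(x,y_i')^{n-1}$ as a function on the absolute, and the right-hand side does not depend on the choice of lifts.
   Formalization: The printed constant is off by n!: what is proved has n!·vol I(y_0,…,y_n) in place of vol I(y_0,…,y_n) on the left. For n=2 with vertices on the absolute the integral, which need not converge absolutely, is a principal value (symmetric arcs around these vertices removed). *)

theory Defs
  imports "HOL-Analysis.Analysis"
begin

text \<open>
  The dimension is \<open>n = CARD('n)\<close>. A vector \<open>(x\<^sub>0, \<dots>, x\<^sub>n)\<close> is represented by the pair of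
  \<open>(x\<^sub>0, \<dots>, x\<^sub>n\<^sub>-\<^sub>1)\<close> and \<open>x\<^sub>n\<close>. The order of \<^typ>\<open>'n\<close> is the order of the coordinates and
  hence orients the ball.
\<close>

section \<open>The Lorentz form, hyperbolic space and the absolute\<close>

definition lorentz :: "(real^'n) \<times> real \<Rightarrow> (real^'n) \<times> real \<Rightarrow> real" where
  "lorentz x y = fst x \<bullet> fst y - snd x * snd y"

definition lorentz_Q :: "(real^'n) \<times> real \<Rightarrow> real" where
  "lorentz_Q x = (\<Sum>i\<in>UNIV. (fst x $ i)\<^sup>2) - (snd x)\<^sup>2"

text \<open>Points of projective space are given by arbitrary nonzero lifts; a point of either cone has
  nonzero last coordinate.\<close>

definition hyperbolic_cone :: "((real^'n) \<times> real) set" where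
  "hyperbolic_cone = {x. lorentz_Q x < 0}"

definition absolute_cone :: "((real^'n) \<times> real) set" where
  "absolute_cone = {x. lorentz_Q x = 0 \<and> x \<noteq> 0}"

definition ball_point :: "(real^'n) \<times> real \<Rightarrow> real^'n" where
  "ball_point x = fst x /\<^sub>R snd x"

section \<open>Volume of geodesic simplices in the ball model\<close>

definition coord_pos :: "'n::{finite,wellorder} \<Rightarrow> nat" where
  "coord_pos i = card {j. j \<le> i}"

definition det_rows :: "(nat \<Rightarrow> real^'n::{finite,wellorder}) \<Rightarrow> real" where
  "det_rows v = det (\<chi> i. v (coord_pos i))"  \<comment> \<open>rows \<open>v 1, \<dots>, v n\<close>, in this order\<close>

text \<open>
  The form \<open>\<sigma>\<^sub>n\<^sub>+\<^sub>1(x, dx) / |Q(x)| powr ((n + 1) / 2)\<close> is homogeneous of degree 0 and invariant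
  under the isometries of \<open>Q\<close> of determinant 1. In the chart \<open>x\<^sub>n = 1\<close> it is, up to sign, the
  Euclidean volume form times the following density, which is 1 at the origin; see
  \<open>hyp_density_invariant\<close> below.
\<close>

definition hyp_density :: "real^'n \<Rightarrow> real" where
  "hyp_density y = 1 / (- lorentz_Q (y, 1)) powr ((real CARD('n) + 1) / 2)"

definition geodesic_simplex :: "(nat \<Rightarrow> real^'n) \<Rightarrow> (real^'n) set" where
  "geodesic_simplex y = convex hull (y ` {0..CARD('n)})"

text \<open>
  The volume is that of the simplex, not of the spanned parallelepiped: to leading order at the
  origin, \<open>hyp_vol y\<close> is \<open>det_rows (\<lambda>i. y i - y 0) / n!\<close>. For the integral of
  \<open>log |\<mu>\<^sub>1/\<mu>\<^sub>0| d log |\<mu>\<^sub>2/\<mu>\<^sub>0| \<and> \<dots> \<and> d log |\<mu>\<^sub>n/\<mu>\<^sub>0|\<close> over the absolute the leading term is, by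
  Stokes, \<open>(n - 1)\<^sup>n det_rows (\<lambda>i. y i - y 0)\<close> times the volume of the unit ball, which is
  \<open>vol(S\<^sup>n\<^sup>-\<^sup>1) / n\<close>. A constant relating the two therefore contains the factor \<open>n!\<close>.
\<close>

definition hyp_vol :: "(nat \<Rightarrow> real^'n::{finite,wellorder}) \<Rightarrow> real" where
  "hyp_vol y = sgn (det_rows (\<lambda>i. y i - y 0)) *
     set_lebesgue_integral lborel (geodesic_simplex y) hyp_density"

section \<open>Integration of forms over the absolute\<close>

text \<open>Surface measure of the unit sphere in polar coordinates: the area of \<open>A\<close> is \<open>n\<close> times the
  volume of the cone over \<open>A\<close> with apex 0.\<close>

definition sphere_measure :: "(real^'n) measure" where
  "sphere_measure =
     distr (density lborel (\<lambda>x. of_nat CARD('n) * indicator (cball 0 1) x)) borel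
       (\<lambda>x. x /\<^sub>R norm x)"

text \<open>Differential forms on the unit sphere of degree \<open>n - 1\<close> take a point \<open>x\<close> and a family of
  tangent vectors at \<open>x\<close> indexed by \<open>{2..n}\<close>. Index 1 is the place of the outward normal.\<close>

type_synonym 'n form = "real^'n \<Rightarrow> (nat \<Rightarrow> real^'n) \<Rightarrow> real"

text \<open>Only the values of \<open>d f\<close> on vectors tangent to the sphere matter; on these the derivative
  within the sphere is unique.\<close>

definition sphere_d :: "(real^'n \<Rightarrow> real) \<Rightarrow> real^'n \<Rightarrow> real^'n \<Rightarrow> real" where
  "sphere_d f x = frechet_derivative f (at x within sphere 0 1)"

definition wedge :: "nat set \<Rightarrow> (nat \<Rightarrow> real^'n \<Rightarrow> real^'n \<Rightarrow> real) \<Rightarrow> 'n::finite form" where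
  "wedge K \<alpha> x v = (\<Sum>p | p permutes K. of_int (sign p) * (\<Prod>i\<in>K. \<alpha> i x (v (p i))))"

definition sphere_frame :: "real^'n::{finite,wellorder} \<Rightarrow> (nat \<Rightarrow> real^'n::{finite,wellorder}) \<Rightarrow> bool" where
  "sphere_frame x v \<longleftrightarrow> v 1 = x \<and>
     (\<forall>i\<in>{1..CARD('n)}. \<forall>j\<in>{1..CARD('n)}. v i \<bullet> v j = (if i = j then 1 else 0)) \<and>
     det_rows v = 1"

definition frame :: "real^'n::{finite,wellorder} \<Rightarrow> nat \<Rightarrow> real^'n::{finite,wellorder}" where
  "frame x = (SOME v. sphere_frame x v)"

text \<open>The integral of \<open>\<omega>\<close> over a part \<open>A\<close> of the sphere is that of its value on positively
  oriented orthonormal frames, which does not depend on the frames.\<close>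

definition form_integrable :: "(real^'n::{finite,wellorder}) set \<Rightarrow> 'n::{finite,wellorder} form \<Rightarrow> bool" where
  "form_integrable A \<omega> \<longleftrightarrow> set_integrable sphere_measure A (\<lambda>x. \<omega> x (frame x))"

definition form_integral :: "(real^'n::{finite,wellorder}) set \<Rightarrow> 'n::{finite,wellorder} form \<Rightarrow> real" where
  "form_integral A \<omega> = set_lebesgue_integral sphere_measure A (\<lambda>x. \<omega> x (frame x))"

text \<open>
  \<open>P\<close> is the finite set of singular points of \<open>\<omega>\<close>. If \<open>n \<ge> 3\<close> the integral over the absolute is an
  absolutely convergent Lebesgue integral. On the circle, \<open>d log\<close> of a function with a zero or pole
  has a simple pole, and the integral exists only as a principal value (which is the Lebesgue
  integral whenever the latter exists).
\<close>

definition has_absolute_integral ::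
    "(real^'n::{finite,wellorder}) set \<Rightarrow> 'n::{finite,wellorder} form \<Rightarrow> real \<Rightarrow> bool" where
  "has_absolute_integral P \<omega> I \<longleftrightarrow>
     (if CARD('n) = 2 then
        (\<forall>\<epsilon>>0. form_integrable {x \<in> sphere 0 1. \<forall>p\<in>P. \<epsilon> \<le> dist x p} \<omega>) \<and>
        ((\<lambda>\<epsilon>. form_integral {x \<in> sphere 0 1. \<forall>p\<in>P. \<epsilon> \<le> dist x p} \<omega>) \<longlongrightarrow> I) (at_right 0)
      else form_integrable (sphere 0 1) \<omega> \<and> form_integral (sphere 0 1) \<omega> = I)"

section \<open>The volume forms attached to points\<close>

text \<open>
  The form \<open>\<delta>(Q(x)) \<sigma>\<^sub>n\<^sub>+\<^sub>1(x, dx)\<close> is the residue along \<open>Q = 0\<close>, i.e. the contraction of \<open>\<sigma>\<^sub>n\<^sub>+\<^sub>1\<close>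
  with any vector \<open>N\<close> such that \<open>dQ(N) = 1\<close>. In the chart \<open>x\<^sub>n = 1\<close> the form \<open>\<sigma>\<^sub>n\<^sub>+\<^sub>1\<close> is
  \<open>(-1)\<^sup>n dy\<^sub>1 \<and> \<dots> \<and> dy\<^sub>n\<close>, and one can take \<open>N = x / 2\<close> at a point \<open>x\<close> of the unit sphere.
\<close>

definition delta_Q_sigma :: "'n::{finite,wellorder} form" where
  "delta_Q_sigma x v = (-1) ^ CARD('n) * det_rows (v(1 := x /\<^sub>R 2))"

definition mu :: "(real^'n::{finite,wellorder}) \<times> real \<Rightarrow> 'n::{finite,wellorder} form" where
  "mu y x v = delta_Q_sigma x v / lorentz (x, 1) y ^ (CARD('n) - 1)"

text \<open>The quotient of two forms of top degree, as a function on the unit sphere.\<close>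

definition mu_ratio ::
    "(real^'n::{finite,wellorder}) \<times> real \<Rightarrow> (real^'n::{finite,wellorder}) \<times> real \<Rightarrow> real^'n::{finite,wellorder} \<Rightarrow> real" where
  "mu_ratio y z x = mu y x (frame x) / mu z x (frame x)"

section \<open>Consistency of the definitions\<close>

lemma lorentz_Q_eq: "lorentz_Q x = lorentz x x"
  by (simp add: lorentz_Q_def lorentz_def inner_vec_def power2_eq_square)

lemma hyp_density_0: "hyp_density 0 = 1"
  by (simp add: hyp_density_def lorentz_Q_eq lorentz_def)

lemma measure_unit_sphere:
  "measure (sphere_measure :: (real^'n) measure) (sphere 0 1) = real CARD('n) * unit_ball_vol CARD('n)"
proof -
  let ?f = "\<lambda>x :: real^'n. x /\<^sub>R norm x"
  have f: "?f \<in> borel_measurable borel" by measurable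
  have pre: "?f -` sphere 0 1 = - {0}" by auto
  let ?d = "\<lambda>x :: real^'n. of_nat CARD('n) * indicator (cball 0 1) x :: ennreal"
  have d: "?d \<in> borel_measurable lborel"
    by (intro borel_measurable_times_ennreal borel_measurable_const borel_measurable_indicator) auto
  have "emeasure sphere_measure (sphere 0 1 :: (real^'n) set) = emeasure (density lborel ?d) (- {0})"
    unfolding sphere_measure_def by (subst emeasure_distr) (use f in \<open>auto simp: pre\<close>)
  also have "\<dots> = (\<integral>\<^sup>+x. ?d x * indicator (- {0}) x \<partial>lborel)"
    by (rule emeasure_density[OF d]) auto
  also have "\<dots> = (\<integral>\<^sup>+x. of_nat CARD('n) * indicator (cball 0 1 :: (real^'n) set) x \<partial>lborel)"
  proof (rule nn_integral_cong_AE)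
    show "AE x in lborel. of_nat CARD('n) * indicator (cball 0 1) x * indicator (- {0 :: real^'n}) x =
        (of_nat CARD('n) * indicator (cball 0 1) x :: ennreal)"
      using AE_lborel_singleton[of "0 :: real^'n"] by eventually_elim auto
  qed
  also have "\<dots> = of_nat CARD('n) * emeasure lborel (cball 0 1 :: (real^'n) set)"
    by (subst nn_integral_cmult_indicator) auto
  also have "\<dots> = of_nat CARD('n) * ennreal (unit_ball_vol CARD('n))"
    by (subst emeasure_cball) auto
  finally show ?thesis by (simp add: measure_def enn2real_mult)
qed

lemma coord_pos_bij: "bij_betw (coord_pos :: 'n::{finite,wellorder} \<Rightarrow> nat) UNIV {1..CARD('n)}"
proof -
  have inj: "inj (coord_pos :: 'n \<Rightarrow> nat)"
  proof (rule linorder_injI)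
    fix i j :: 'n assume "i < j"
    then have "j \<in> {k. k \<le> j} - {k. k \<le> i}" "{k. k \<le> i} \<subseteq> {k. k \<le> j}" by auto
    then have "{k. k \<le> i} \<subset> {k. k \<le> j}" by blast
    then have "coord_pos i < coord_pos j" unfolding coord_pos_def by (simp add: psubset_card_mono)
    then show "coord_pos i \<noteq> coord_pos j" by simp
  qed
  have sub: "range (coord_pos :: 'n \<Rightarrow> nat) \<subseteq> {1..CARD('n)}"
  proof -
    have "1 \<le> coord_pos i \<and> coord_pos i \<le> CARD('n)" for i :: 'n
      unfolding coord_pos_def by (auto simp: Suc_le_eq card_gt_0_iff intro: card_mono)
    then show ?thesis by auto
  qed
  have "range (coord_pos :: 'n \<Rightarrow> nat) = {1..CARD('n)}"
    by (rule card_subset_eq) (use sub inj in \<open>auto simp: card_image\<close>)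
  with inj show ?thesis by (simp add: bij_betw_def)
qed

lemma sphere_frame_exists:
  fixes x :: "real^'n::{finite,wellorder}"
  assumes n: "2 \<le> CARD('n)" and x: "norm x = 1"
  shows "\<exists>v. sphere_frame x v"
proof -
  let ?c = "coord_pos :: 'n \<Rightarrow> nat"
  let ?k = "inv ?c 1"
  have inj: "inj ?c" and rng: "range ?c = {1..CARD('n)}"
    using coord_pos_bij[where 'n='n] by (auto simp: bij_betw_def)
  have k: "?c ?k = 1" using rng n by (intro f_inv_into_f) auto
  obtain A where A: "rotation_matrix A" "A *v axis ?k 1 = x"
    using rotation_matrix_exists_basis[OF n x] by metis
  define v where "v r = A *v axis (inv ?c r) 1" for r
  have vc: "v (?c i) = column i A" for i
    by (simp add: v_def inj matrix_vector_mult_basis)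
  have orth: "orthogonal_matrix A" "det A = 1" using A by (auto simp: rotation_matrix_def)
  have "(\<chi> i. v (?c i)) = transpose A"
    by (simp add: vc transpose_def column_def)
  then have "det_rows v = 1" by (simp add: det_rows_def orth)
  moreover have "v 1 = x" unfolding v_def by (rule A)
  moreover have "v i \<bullet> v j = (if i = j then 1 else 0)"
    if "i \<in> {1..CARD('n)}" "j \<in> {1..CARD('n)}" for i j
  proof -
    have "i \<in> range ?c" "j \<in> range ?c" using that by (simp_all add: rng)
    then obtain a b where ab: "i = ?c a" "j = ?c b" by blast
    have "column a A \<bullet> column b A = (transpose A ** A) $ a $ b"
      by (simp add: matrix_matrix_mult_def transpose_def column_def inner_vec_def)
    also have "\<dots> = (if a = b then 1 else 0)"
      using orth by (simp add: orthogonal_matrix mat_def)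
    finally show ?thesis using inj by (auto simp: ab vc dest: injD)
  qed
  ultimately show ?thesis unfolding sphere_frame_def by blast
qed

lemma mu_ratio_eq:
  fixes x :: "real^'n::{finite,wellorder}"
  assumes n: "2 \<le> CARD('n)" and x: "norm x = 1"
  shows "mu_ratio y z x = lorentz (x, 1) z ^ (CARD('n) - 1) / lorentz (x, 1) y ^ (CARD('n) - 1)"
proof -
  let ?c = "coord_pos :: 'n \<Rightarrow> nat"
  have f: "sphere_frame x (frame x)"
    unfolding frame_def by (rule someI_ex[OF sphere_frame_exists[OF n x]])
  have inj: "inj ?c" and rng: "range ?c = {1..CARD('n)}"
    using coord_pos_bij[where 'n='n] by (auto simp: bij_betw_def)
  have "1 \<in> range ?c" using n by (simp add: rng)
  then obtain k where k: "?c k = 1" by force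
  have "?c i = 1 \<longleftrightarrow> i = k" for i using k inj by (metis injD)
  moreover have "frame x (?c k) = x" using f unfolding k by (simp add: sphere_frame_def)
  ultimately have "(\<chi> i. ((frame x)(1 := x /\<^sub>R 2)) (?c i)) =
      (\<chi> i. if i = k then (1/2) *s frame x (?c i) else frame x (?c i))"
    by (auto simp: vec_eq_iff simp del: One_nat_def)
  then have "det_rows ((frame x)(1 := x /\<^sub>R 2)) =
      det (\<chi> i. if i = k then (1/2) *s frame x (?c i) else frame x (?c i))"
    by (simp add: det_rows_def)
  also have "\<dots> = 1/2 * det (\<chi> i. if i = k then frame x (?c i) else frame x (?c i))"
    by (rule det_row_mul)
  also have "\<dots> = 1/2" using f by (simp add: sphere_frame_def det_rows_def)
  finally have "delta_Q_sigma x (frame x) \<noteq> 0" by (simp add: delta_Q_sigma_def)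
  then show ?thesis by (simp add: mu_ratio_def mu_def)
qed

lemma det_scalar_plus_rank_one:
  fixes y :: "real^'n::finite"
  shows "det (\<chi> i j. (if i = j then c else 0) + y $ i * y $ j) =
    c ^ (CARD('n) - 1) * (c + y \<bullet> y)"
proof -
  let ?k = "undefined :: 'n"
  obtain A :: "real^'n^'n" where A: "orthogonal_matrix A" "A *v axis ?k (norm y) = y"
  proof (cases "y = 0")
    case True
    show ?thesis
      by (rule that[of "mat 1"]) (use True in \<open>auto simp: orthogonal_matrix_id vec_eq_iff axis_def\<close>)
  next
    case False
    then have "norm (y /\<^sub>R norm y) = 1" by simp
    then obtain A where A: "orthogonal_matrix A" "A *v axis ?k 1 = y /\<^sub>R norm y"
      using orthogonal_matrix_exists_basis by metis
    have "axis ?k (norm y) = norm y *\<^sub>R axis ?k 1" by (simp add: vec_eq_iff axis_def)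
    then have "A *v axis ?k (norm y) = norm y *\<^sub>R (A *v axis ?k 1)"
      by (simp add: matrix_vector_mult_scaleR)
    with A False that[of A] show ?thesis by simp
  qed
  let ?D = "\<chi> i j. if i = j then (if i = ?k then c + y \<bullet> y else c) else 0"
  have yi: "y $ i = A $ i $ ?k * norm y" for i
  proof -
    have "y $ i = (A *v axis ?k (norm y)) $ i" using A by simp
    also have "\<dots> = (\<Sum>j\<in>UNIV. if j = ?k then A $ i $ j * norm y else 0)"
      by (simp add: matrix_vector_mult_def axis_def if_distrib[of "(*) _"] cong: if_cong)
    finally show ?thesis by simp
  qed
  have o: "A ** transpose A = mat 1" using A by (simp add: orthogonal_matrix_def)
  have "(\<chi> i j. (if i = j then c else 0) + y $ i * y $ j) = A ** ?D ** transpose A"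
  proof -
    have "(A ** ?D ** transpose A) $ i $ j = (if i = j then c else 0) + y $ i * y $ j" for i j
    proof -
      have "(A ** ?D) $ i $ m = A $ i $ m * (if m = ?k then c + y \<bullet> y else c)" for m
      proof -
        have "(A ** (\<chi> i j. if i = j then d i else 0)) $ i $ m = A $ i $ m * d m" for d :: "'n \<Rightarrow> real"
          by (simp add: matrix_matrix_mult_def if_distrib[of "(*) _"] cong: if_cong)
        then show ?thesis .
      qed
      then have "(A ** ?D ** transpose A) $ i $ j =
          (\<Sum>m\<in>UNIV. A $ i $ m * (if m = ?k then c + y \<bullet> y else c) * A $ j $ m)"
        unfolding matrix_matrix_mult_def[of "A ** ?D"] by (simp add: transpose_def)
      also have "\<dots> = (\<Sum>m\<in>UNIV. c * (A $ i $ m * A $ j $ m) +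
          (if m = ?k then A $ i $ m * A $ j $ m * (y \<bullet> y) else 0))"
        by (intro sum.cong) (auto simp: algebra_simps)
      also have "\<dots> = c * (A ** transpose A) $ i $ j + A $ i $ ?k * A $ j $ ?k * (y \<bullet> y)"
        by (simp add: sum.distrib sum_distrib_left[symmetric] matrix_matrix_mult_def transpose_def)
      also have "A $ i $ ?k * A $ j $ ?k * (y \<bullet> y) = y $ i * y $ j"
        by (simp add: yi[of i] yi[of j] power2_norm_eq_inner[symmetric] power2_eq_square)
      finally show ?thesis by (simp add: o mat_def)
    qed
    then show ?thesis by (simp add: vec_eq_iff)
  qed
  then have "det (\<chi> i j. (if i = j then c else 0) + y $ i * y $ j) = (det A)\<^sup>2 * det ?D"
    by (simp add: det_mul det_transpose power2_eq_square)
  moreover have "(det A)\<^sup>2 = 1" using det_orthogonal_matrix[OF A(1)] by auto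
  moreover have "det ?D = c ^ (CARD('n) - 1) * (c + y \<bullet> y)"
  proof -
    have "det ?D = (\<Prod>i\<in>UNIV. if i = ?k then c + y \<bullet> y else c)"
      by (subst det_diagonal) auto
    also have "\<dots> = (c + y \<bullet> y) * (\<Prod>i\<in>UNIV - {?k}. c)"
      by (subst prod.remove[of _ ?k]) (auto intro!: prod.cong)
    finally show ?thesis by (simp add: card_Diff_singleton)
  qed
  ultimately show ?thesis by simp
qed

lemma det_scaleR:
  fixes A :: "real^'n::finite^'n::finite"
  shows "det (k *\<^sub>R A) = k ^ CARD('n) * det A"
proof -
  have "k *\<^sub>R A = (\<chi> i. k *s (A $ i))" by (simp add: vec_eq_iff)
  then have "det (k *\<^sub>R A) = prod (\<lambda>i. k) (UNIV :: 'n set) * det (\<chi> i. A $ i)"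
    by (simp only: det_rows_mul)
  then show ?thesis by (simp add: vec_lambda_eta)
qed

text \<open>Linear isometries of \<open>Q\<close> act on the ball by projective maps, and the volume form is invariant
  under this action.\<close>

theorem hyp_density_invariant:
  fixes g :: "(real^'n::finite) \<times> real \<Rightarrow> (real^'n) \<times> real"
  assumes g: "linear g" and Q: "\<And>x. lorentz_Q (g x) = lorentz_Q x" and y: "norm y < 1"
  defines "\<phi> \<equiv> \<lambda>y. ball_point (g (y, 1))"
  shows "norm (\<phi> y) < 1"
    and "\<exists>D. (\<phi> has_derivative D) (at y) \<and>
           hyp_density (\<phi> y) * \<bar>det (matrix D)\<bar> = hyp_density y"
proof -
  have B: "lorentz (g u) (g v) = lorentz u v" for u v
  proof -
    have pol: "lorentz u v = (lorentz_Q (u + v) - lorentz_Q u - lorentz_Q v) / 2" for u v :: "(real^'n) \<times> real"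
      by (simp add: lorentz_Q_eq lorentz_def algebra_simps inner_commute)
    show ?thesis by (simp add: pol[of "g u"] pol[of u] linear_add[OF g, symmetric] Q)
  qed
  define r where "r = 1 - y \<bullet> y"
  have r: "r > 0" using y by (simp add: r_def norm_eq_sqrt_inner)
  define p s where "p = fst (g (y, 1))" and "s = snd (g (y, 1))"
  have ps: "p \<bullet> p - s * s = - r"
    using Q[of "(y, 1)"] by (simp add: lorentz_Q_eq lorentz_def p_def s_def r_def)
  have s: "s \<noteq> 0"
  proof
    assume "s = 0" with ps r have "p \<bullet> p < 0" by simp
    then show False using inner_ge_zero[of p] by linarith
  qed
  define z where "z = \<phi> y"
  have z: "z = p /\<^sub>R s" by (simp add: z_def \<phi>_def ball_point_def p_def s_def)
  define q where "q = 1 - z \<bullet> z"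
  have q: "q = r / s\<^sup>2"
    using ps s by (simp add: q_def z field_simps power2_eq_square)
  then have q0: "q > 0" using r s by simp
  show "norm (\<phi> y) < 1"
    using q0 by (simp add: q_def z_def[symmetric] norm_eq_sqrt_inner)
  define F G where "F = (\<lambda>v. fst (g (v, 0 :: real)))" and "G = (\<lambda>v. snd (g (v, 0 :: real)))"
  have gl: "bounded_linear g" using g by (simp add: linear_conv_bounded_linear)
  define D where "D v = F v /\<^sub>R s - (G v / s) *\<^sub>R z" for v
  have der: "(\<phi> has_derivative D) (at y)"
  proof -
    have g1: "((\<lambda>y. g (y, 1)) has_derivative (\<lambda>v. g (v, 0))) (at y)"
      by (rule bounded_linear.has_derivative[OF gl]) (auto intro!: derivative_eq_intros)
    have f1: "((\<lambda>y. fst (g (y, 1))) has_derivative F) (at y)"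
      unfolding F_def by (rule has_derivative_fst[OF g1])
    have f2: "((\<lambda>y. snd (g (y, 1))) has_derivative G) (at y)"
      unfolding G_def by (rule has_derivative_snd[OF g1])
    have "((\<lambda>y. fst (g (y, 1)) /\<^sub>R snd (g (y, 1))) has_derivative D) (at y)"
    proof (rule has_derivative_eq_rhs)
      show "((\<lambda>y. fst (g (y, 1)) /\<^sub>R snd (g (y, 1))) has_derivative
          (\<lambda>v. inverse s *\<^sub>R F v + (- (inverse s * G v * inverse s)) *\<^sub>R p)) (at y)"
        unfolding p_def s_def
        by (rule has_derivative_scaleR[OF Deriv.has_derivative_inverse[OF _ f2] f1])
          (use s in \<open>simp add: s_def\<close>)
      show "(\<lambda>v. inverse s *\<^sub>R F v + (- (inverse s * G v * inverse s)) *\<^sub>R p) = D"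
        by (simp add: D_def z fun_eq_iff divide_inverse mult.commute)
    qed
    then show ?thesis by (simp add: \<phi>_def ball_point_def)
  qed
  let ?K = "\<lambda>(a :: real) (w :: real^'n) u v. a * (u \<bullet> v) + (u \<bullet> w) * (v \<bullet> w)"
  have K: "?K q z (D u) (D v) = ?K r y u v / (s\<^sup>2 * s\<^sup>2)" for u v
  proof -
    have b: "F u \<bullet> F v - G u * G v = u \<bullet> v" for u v
      using B[of "(u, 0)" "(v, 0)"] by (simp add: lorentz_def F_def G_def)
    have c: "F u \<bullet> p - G u * s = u \<bullet> y" for u
      using B[of "(u, 0)" "(y, 1)"] by (simp add: lorentz_def F_def G_def p_def s_def)
    define t where "t = inverse s"
    have t: "s * t = 1" using s by (simp add: t_def)
    have Dt: "D v = t *\<^sub>R F v - (t * G v) *\<^sub>R z" for v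
      by (simp add: D_def t_def divide_inverse mult.commute)
    have qt: "q = r * t\<^sup>2" by (simp add: q t_def divide_inverse power_inverse)
    have FF: "F u \<bullet> F v = u \<bullet> v + G u * G v" using b[of u v] by simp
    have Fz: "F u \<bullet> z = t * (u \<bullet> y) + G u" for u
    proof -
      have "F u \<bullet> z = t * (F u \<bullet> p)" by (simp add: z t_def)
      also have "\<dots> = t * (u \<bullet> y) + G u * (s * t)" using c[of u] by (simp add: algebra_simps)
      finally show ?thesis by (simp add: t)
    qed
    have zz: "z \<bullet> z = 1 - q" by (simp add: q_def)
    have Dz: "D u \<bullet> z = t\<^sup>2 * (u \<bullet> y) + t * G u * q" for u
      by (simp add: Dt inner_diff_left Fz zz algebra_simps power2_eq_square)
    have DD: "D u \<bullet> D v = t\<^sup>2 * (u \<bullet> v - t * G u * (v \<bullet> y) - t * G v * (u \<bullet> y) - G u * G v * q)"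
    proof -
      have "D u \<bullet> D v = t * t * (F u \<bullet> F v) - t * (t * G v) * (F u \<bullet> z) - t * (t * G u) * (F v \<bullet> z)
          + (t * G u) * (t * G v) * (z \<bullet> z)"
        by (simp add: Dt inner_diff_left inner_diff_right inner_commute[of z "F v"] algebra_simps)
      then show ?thesis unfolding FF Fz zz by (simp add: algebra_simps power2_eq_square)
    qed
    have "q * (D u \<bullet> D v) + (D u \<bullet> z) * (D v \<bullet> z) = q * t\<^sup>2 * (u \<bullet> v) + (t\<^sup>2 * t\<^sup>2) * ((u \<bullet> y) * (v \<bullet> y))"
      unfolding DD Dz by (simp add: algebra_simps power2_eq_square)
    also have "\<dots> = ?K r y u v * (t\<^sup>2 * t\<^sup>2)"
      unfolding qt by (simp add: algebra_simps)
    finally show ?thesis by (simp only: t_def divide_inverse power_inverse inverse_mult_distrib)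
  qed
  let ?M = "\<lambda>(a :: real) (w :: real^'n). \<chi> i j. (if i = j then a else 0) + w $ i * w $ j"
  have linD: "linear D" using der by (rule has_derivative_linear)
  define T where "T = matrix D"
  have KM: "?K a w u v = u \<bullet> (?M a w *v v)" for a w u v
  proof -
    have "(?M a w *v v) $ i = a * v $ i + w $ i * (w \<bullet> v)" for i
    proof -
      have "(?M a w *v v) $ i = (\<Sum>j\<in>UNIV. (if i = j then a else 0) * v $ j + w $ i * (w $ j * v $ j))"
        by (simp add: matrix_vector_mult_def distrib_right mult.assoc)
      also have "\<dots> = (\<Sum>j\<in>UNIV. (if i = j then a else 0) * v $ j) + w $ i * (w \<bullet> v)"
        by (simp only: sum.distrib inner_vec_def sum_distrib_left inner_real_def)
      also have "(\<Sum>j\<in>UNIV. (if i = j then a else 0) * v $ j) = a * v $ i"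
        by (simp add: if_distrib[of "\<lambda>x. x * _"] cong: if_cong)
      finally show ?thesis .
    qed
    then have "?M a w *v v = a *\<^sub>R v + (w \<bullet> v) *\<^sub>R w" by (simp add: vec_eq_iff)
    then show ?thesis by (simp add: inner_add_right inner_commute)
  qed
  have "transpose T ** ?M q z ** T = (1 / (s\<^sup>2 * s\<^sup>2)) *\<^sub>R ?M r y"
  proof -
    have "u \<bullet> ((transpose T ** ?M q z ** T) *v v) = u \<bullet> (((1 / (s\<^sup>2 * s\<^sup>2)) *\<^sub>R ?M r y) *v v)" for u v
    proof -
      have adj: "u \<bullet> (transpose T *v w) = (T *v u) \<bullet> w" for w
        by (metis dot_lmul_matrix inner_commute transpose_matrix_vector)
      have TD: "T *v w = D w" for w using linD by (simp add: T_def matrix_works)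
      have "u \<bullet> ((transpose T ** ?M q z ** T) *v v) = D u \<bullet> (?M q z *v D v)"
        by (simp only: matrix_vector_mul_assoc[symmetric] adj TD)
      also have "\<dots> = ?K r y u v / (s\<^sup>2 * s\<^sup>2)"
        by (rule trans[OF KM[symmetric] K])
      also have "\<dots> = u \<bullet> (((1 / (s\<^sup>2 * s\<^sup>2)) *\<^sub>R ?M r y) *v v)"
        unfolding KM[of r u v y] by (simp only: scaleR_matrix_vector_assoc[symmetric] inner_scaleR_right) simp
      finally show ?thesis .
    qed
    then have "(transpose T ** ?M q z ** T) *v v = ((1 / (s\<^sup>2 * s\<^sup>2)) *\<^sub>R ?M r y) *v v" for v
      using vector_eq_ldot by blast
    then show ?thesis unfolding matrix_eq by blast
  qed
  then have "det (transpose T ** ?M q z ** T) = det ((1 / (s\<^sup>2 * s\<^sup>2)) *\<^sub>R ?M r y)" by simp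
  then have "det T * (q ^ (CARD('n) - 1) * (q + z \<bullet> z)) * det T =
      (1 / (s\<^sup>2 * s\<^sup>2)) ^ CARD('n) * (r ^ (CARD('n) - 1) * (r + y \<bullet> y))"
    by (simp only: det_mul det_transpose det_scalar_plus_rank_one det_scaleR)
  moreover have "q + z \<bullet> z = 1" "r + y \<bullet> y = 1" by (simp_all add: q_def r_def)
  ultimately have d: "(det T)\<^sup>2 * q ^ (CARD('n) - 1) = (1 / (s\<^sup>2 * s\<^sup>2)) ^ CARD('n) * r ^ (CARD('n) - 1)"
    by (simp only: mult_1_right power2_eq_square[of "det T"] mult_ac)
  define m where "m = CARD('n) - 1"
  have m: "CARD('n) = Suc m" by (simp add: m_def)
  obtain w where w: "w = s\<^sup>2" "w > 0" using s by simp
  have "(det T)\<^sup>2 * (r ^ m / w ^ m) = r ^ m / (w ^ Suc m * w ^ Suc m)"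
    using d unfolding m_def[symmetric] q w(1)[symmetric]
    by (simp only: m power_divide power_one power_mult_distrib times_divide_eq_left mult_1_left)
  then have "(det T)\<^sup>2 * w ^ (Suc m + 1) = 1"
    using w(2) r by (simp add: field_simps)
  moreover have "(\<bar>s\<bar> ^ (Suc m + 1))\<^sup>2 = w ^ (Suc m + 1)"
  proof -
    have "(\<bar>s\<bar> ^ (Suc m + 1))\<^sup>2 = (\<bar>s\<bar>\<^sup>2) ^ (Suc m + 1)"
      by (simp only: power_mult[symmetric] mult.commute)
    then show ?thesis by (simp only: power2_abs w(1))
  qed
  ultimately have "(\<bar>det T\<bar> * \<bar>s\<bar> ^ (Suc m + 1))\<^sup>2 = 1"
    by (simp only: power_mult_distrib power2_abs)
  then have "\<bar>det T\<bar> * \<bar>s\<bar> ^ (Suc m + 1) = 1 \<or> \<bar>det T\<bar> * \<bar>s\<bar> ^ (Suc m + 1) = - 1"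
    by (simp only: power2_eq_1_iff)
  moreover have "0 \<le> \<bar>det T\<bar> * \<bar>s\<bar> ^ (Suc m + 1)"
    by (intro mult_nonneg_nonneg zero_le_power abs_ge_zero)
  ultimately have "\<bar>det T\<bar> * \<bar>s\<bar> ^ (Suc m + 1) = 1" by linarith
  then have dT: "\<bar>det T\<bar> = 1 / \<bar>s\<bar> ^ (Suc m + 1)"
    using s by (simp only: eq_divide_eq power_eq_0_iff abs_eq_0) simp
  have e: "(real CARD('n) + 1) / 2 = real (Suc m + 1) / 2" by (simp add: m)
  have hy: "hyp_density y = 1 / r powr (real (Suc m + 1) / 2)"
    and hz: "hyp_density z = 1 / q powr (real (Suc m + 1) / 2)"
    unfolding hyp_density_def e r_def q_def by (simp_all add: lorentz_Q_eq lorentz_def)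
  have "(s\<^sup>2) powr (real (Suc m + 1) / 2) = \<bar>s\<bar> ^ (Suc m + 1)"
  proof -
    have "s\<^sup>2 = \<bar>s\<bar> powr 2" using s by simp
    then have "(s\<^sup>2) powr (real (Suc m + 1) / 2) = \<bar>s\<bar> powr (2 * (real (Suc m + 1) / 2))"
      by (simp only: powr_powr)
    also have "2 * (real (Suc m + 1) / 2) = real (Suc m + 1)" by simp
    also have "\<bar>s\<bar> powr real (Suc m + 1) = \<bar>s\<bar> ^ (Suc m + 1)"
      by (rule powr_realpow) (use s in simp)
    finally show ?thesis .
  qed
  then have "q powr (real (Suc m + 1) / 2) = r powr (real (Suc m + 1) / 2) / \<bar>s\<bar> ^ (Suc m + 1)"
    unfolding q using r by (subst powr_divide) auto
  moreover have "\<bar>s\<bar> ^ (Suc m + 1) \<noteq> 0" using s by (simp only: power_eq_0_iff abs_eq_0) simp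
  ultimately have "hyp_density z * \<bar>det T\<bar> = hyp_density y"
    unfolding hy hz dT by simp
  then show "\<exists>D. (\<phi> has_derivative D) (at y) \<and>
           hyp_density (\<phi> y) * \<bar>det (matrix D)\<bar> = hyp_density y"
    using der by (auto simp: z_def T_def)
qed

end

theory Submission
  imports Defs
begin

text \<open>
  Write \<open>b\<^sub>k\<close> for the points in the ball and \<open>a\<^sub>k(x) = 1 - x \<bullet> b\<^sub>k\<close>; a lift of \<open>b\<^sub>k\<close> pairs with \<open>(x, 1)\<close>
  to a constant multiple of \<open>a\<^sub>k(x)\<close>. Let \<open>\<Delta>\<close> be the determinant with rows \<open>b\<^sub>i - b\<^sub>0\<close>, and let \<open>\<beta>\<^sub>k\<close> be
  the barycentric coordinates with respect to the \<open>b\<^sub>k\<close>, so that \<open>\<Sum>\<^sub>k \<beta>\<^sub>k = 1\<close> and, for \<open>x\<close> on the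
  sphere, \<open>\<Sum>\<^sub>k \<beta>\<^sub>k a\<^sub>k = 1 - x \<bullet> x = 0\<close>. On an oriented orthonormal frame at \<open>x\<close> the form takes the value
  \<open>(n - 1)\<^sup>n \<Delta> \<beta>\<^sub>1 (\<gamma> + log a\<^sub>0 - log a\<^sub>1) / \<Prod>\<^sub>k\<^sub>\<noteq>\<^sub>1 a\<^sub>k\<close> with a constant \<open>\<gamma>\<close>, and Stokes' theorem can be avoided
  as follows.

  The integral of \<open>(1 - x \<bullet> z)\<close> to the power \<open>- n\<close> over \<open>x\<close> in the sphere is \<open>vol(S)\<close> times the hyperbolic
  density at \<open>z\<close>, and its integral over \<open>z\<close> in the simplex is
  \<open>\<bar>\<Delta>\<bar> / (n - 1)!\<close> times \<open>F(x) = \<integral>\<^sub>0\<^sup>\<infinity> du / \<Prod>\<^sub>k (a\<^sub>k(x) + u)\<close>. Hence by Fubini the volume is a multiple of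
  the integral of \<open>F\<close> over the sphere. Inserting \<open>1 = \<Sum>\<^sub>j \<beta>\<^sub>j\<close> and \<open>\<Sum>\<^sub>j \<beta>\<^sub>j a\<^sub>j = 0\<close>, i.e.
  \<open>u = \<Sum>\<^sub>j \<beta>\<^sub>j (a\<^sub>j + u)\<close>, splits \<open>F\<close> into \<open>\<beta>\<^sub>1 (log a\<^sub>0 - log a\<^sub>1) / \<Prod>\<^sub>k\<^sub>\<noteq>\<^sub>1 a\<^sub>k\<close> and, for every \<open>j\<close>, \<open>\<beta>\<^sub>j\<close> times a
  function of the \<open>a\<^sub>k\<close> with \<open>k \<noteq> j\<close> that is homogeneous of degree \<open>- n\<close>. The hyperbolic reflection in the
  facet opposite to \<open>b\<^sub>j\<close> multiplies \<open>\<beta>\<^sub>j\<close> and these \<open>a\<^sub>k\<close> by \<open>- 1 / t\<close> and \<open>1 / t\<close>, where \<open>t\<close> to the power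
  \<open>1 - n\<close> is its Jacobian on the sphere. So the latter terms are odd and integrate to 0, as does
  \<open>\<gamma> \<beta>\<^sub>1 / \<Prod>\<^sub>k\<^sub>\<noteq>\<^sub>1 a\<^sub>k\<close>. On the circle these integrals are principal values; the reflection changes the
  excised arcs of length of order \<open>\<epsilon>\<close> only by \<open>O(\<epsilon>\<^sup>2)\<close>.
\<close>

section \<open>Surface measure and reflections of the sphere\<close>

lemma det_identity_plus_rank_one:
  fixes u v :: "real^'n"
  shows "det (matrix (\<lambda>h. h + (v \<bullet> h) *\<^sub>R u)) = 1 + v \<bullet> u"
proof -
  let ?k = "undefined :: 'n"
  let ?f = "\<lambda>(v :: real^'n) (u :: real^'n) h. h + (v \<bullet> h) *\<^sub>R u"
  have lin: "linear (?f v u)" for u v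
    by (intro linearI) (auto simp: algebra_simps inner_add_right)
  \<comment> \<open>Conjugation by an orthogonal matrix taking a coordinate axis to the direction of
    \<open>u\<close> preserves the determinant and makes the matrix differ from the identity in row
    \<open>?k\<close> alone, where Cramer's lemma evaluates it.\<close>
  obtain A :: "real^'n^'n" where A: "orthogonal_matrix A" "norm u *\<^sub>R (A *v axis ?k 1) = u"
  proof (cases "u = 0")
    case True
    then show ?thesis by (intro that[of "mat 1"]) (auto simp: orthogonal_matrix_id)
  next
    case False
    then have "norm (u /\<^sub>R norm u) = 1" by simp
    then obtain A where "orthogonal_matrix A" "A *v axis ?k 1 = u /\<^sub>R norm u"
      using orthogonal_matrix_exists_basis by metis
    then show ?thesis using False by (intro that[of A]) auto
  qed
  let ?w = "transpose A *v v"
  have o: "transpose A ** A = mat 1" using A by (simp add: orthogonal_matrix)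
  have "transpose A ** matrix (?f v u) ** A = matrix (?f ?w (norm u *\<^sub>R axis ?k 1))"
  proof (subst matrix_eq, intro allI)
    fix h
    have "transpose A *v u = norm u *\<^sub>R axis ?k 1"
      by (subst A(2)[symmetric])
        (simp only: matrix_vector_mult_scaleR matrix_vector_mul_assoc o matrix_vector_mul_lid)
    moreover have "v \<bullet> (A *v h) = ?w \<bullet> h"
      by (metis dot_lmul_matrix transpose_matrix_vector)
    moreover have mw: "matrix (?f v u) *v h = ?f v u h" for v u h
      using lin[of v u] by (simp add: matrix_works)
    moreover have "transpose A *v (A *v h) = h"
      by (simp only: matrix_vector_mul_assoc o matrix_vector_mul_lid)
    ultimately show "(transpose A ** matrix (?f v u) ** A) *v h = matrix (?f ?w (norm u *\<^sub>R axis ?k 1)) *v h"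
      unfolding matrix_vector_mul_assoc[symmetric] mw
      by (simp only: matrix_vector_right_distrib matrix_vector_mult_scaleR)
  qed
  then have "det (transpose A ** matrix (?f v u) ** A) = det (matrix (?f ?w (norm u *\<^sub>R axis ?k 1)))"
    by simp
  moreover have "det (transpose A ** matrix (?f v u) ** A) = det (matrix (?f v u))"
    using det_orthogonal_matrix[OF A(1)] by (auto simp: det_mul det_transpose)
  moreover have "row i (mat 1 :: real^'n^'n) = axis i 1" for i
    by (auto simp: row_def mat_def axis_def vec_eq_iff)
  then have "matrix (?f ?w (norm u *\<^sub>R axis ?k 1)) =
      (\<chi> i. if i = ?k then \<Sum>i\<in>UNIV. (axis ?k 1 + norm u *\<^sub>R ?w) $ i *s row i (mat 1) else row i (mat 1))"
    by (simp only: basis_expansion) (auto simp: vec_eq_iff matrix_def axis_def inner_vec_def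
        if_distrib[of "(*) _"] cong: if_cong)
  moreover have "norm u * (?w $ ?k) = v \<bullet> u"
  proof -
    have "?w $ ?k = ?w \<bullet> axis ?k 1" by (simp add: inner_axis)
    also have "\<dots> = v \<bullet> (A *v axis ?k 1)" by (metis dot_lmul_matrix transpose_matrix_vector)
    finally show ?thesis by (metis A(2) inner_scaleR_right)
  qed
  ultimately show ?thesis
    by (simp only: cramer_lemma_transpose) (simp add: axis_def)
qed

section \<open>Substitution and homogeneity in Lebesgue integrals\<close>

text \<open>It suffices to identify the push-forward of the density
  \<open>\<bar>det (matrix (g' x))\<bar>\<close> on \<open>S\<close> with Lebesgue measure on the
  image of \<open>S\<close>. On a Borel set this is the measure of a differentiable injective image;
  images of infinite measure are settled by contradiction, since a finite integral of the density
  would force a finite image.\<close>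

lemma nn_integral_change_of_variables:
  fixes g :: "real^'n::{finite,wellorder} \<Rightarrow> real^'n::_"
  assumes S[measurable]: "S \<in> sets borel" and gS[measurable]: "g ` S \<in> sets borel"
    and der: "\<And>x. x \<in> S \<Longrightarrow> (g has_derivative g' x) (at x within S)"
    and inj: "inj_on g S"
    and g[measurable]: "g \<in> borel_measurable borel"
    and g'[measurable]: "(\<lambda>x. det (matrix (g' x))) \<in> borel_measurable borel"
    and f[measurable]: "f \<in> borel_measurable borel"
  shows "(\<integral>\<^sup>+y. f y * indicator (g ` S) y \<partial>lborel) =
    (\<integral>\<^sup>+x. ennreal \<bar>det (matrix (g' x))\<bar> * f (g x) * indicator S x \<partial>lborel)"
proof -
  let ?J = "\<lambda>x. \<bar>det (matrix (g' x))\<bar>"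
  let ?M = "density lborel (\<lambda>x. ennreal (?J x) * indicator S x)"
  have "density lborel (indicator (g ` S)) = distr ?M borel g"
  proof (rule measure_eqI)
    fix A assume "A \<in> sets (density lborel (indicator (g ` S)))"
    then have A[measurable]: "A \<in> sets borel" by simp
    define T where "T = S \<inter> g -` A"
    have T[measurable]: "T \<in> sets borel"
      using measurable_sets[OF g A] by (auto simp: T_def)
    have gT: "g ` T = A \<inter> g ` S" by (auto simp: T_def)
    have TS: "T \<subseteq> S" by (auto simp: T_def)
    have hm: "g ` T \<in> lmeasurable \<and> measure lebesgue (g ` T) = m \<longleftrightarrow> (?J has_integral m) T" for m
      by (rule has_measure_differentiable_image)
        (use TS inj der in \<open>auto intro: has_derivative_subset inj_on_subset\<close>)
    have "emeasure lborel (g ` T) = (\<integral>\<^sup>+x. ennreal (?J x) * indicator T x \<partial>lborel)"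
    proof (cases "g ` T \<in> lmeasurable")
      case True
      then have "(?J has_integral measure lebesgue (g ` T)) T" using hm by blast
      then have "(\<integral>\<^sup>+x. ennreal (?J x) * indicator T x \<partial>lborel) = ennreal (measure lebesgue (g ` T))"
        by (intro nn_integral_has_integral_lebesgue') auto
      also have "\<dots> = emeasure lebesgue (g ` T)"
        using True by (simp add: emeasure_eq_measure2 fmeasurableD2)
      finally show ?thesis using gT by simp
    next
      case False
      have "(\<integral>\<^sup>+x. ennreal (?J x) * indicator T x \<partial>lborel) = \<infinity>"
      proof (rule ccontr)
        assume "\<not> ?thesis"
        then have "(\<integral>\<^sup>+x. ennreal (?J x * indicator T x) \<partial>lborel) < \<infinity>"
          by (simp add: ennreal_mult' ennreal_indicator top.not_eq_extremum)
        then have "(\<lambda>x. ?J x * indicator T x) integrable_on UNIV"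
          by (intro nn_integral_integrable_on) auto
        moreover have "(\<lambda>x. ?J x * indicator T x) = (\<lambda>x. if x \<in> T then ?J x else 0)"
          by (auto simp: indicator_def)
        ultimately have "?J integrable_on T" by (simp add: integrable_restrict_UNIV)
        then show False using hm False by (auto simp: integrable_on_def)
      qed
      moreover have "emeasure lborel (g ` T) = \<infinity>"
        using False gT by (auto simp: fmeasurable_def not_less top.extremum_unique)
      ultimately show ?thesis by simp
    qed
    also have "\<dots> = (\<integral>\<^sup>+x. ennreal (?J x) * indicator S x * indicator (g -` A) x \<partial>lborel)"
      by (intro nn_integral_cong) (auto simp: T_def indicator_def)
    also have "\<dots> = emeasure ?M (g -` A)"
      using measurable_sets[OF g A] by (subst emeasure_density) auto
    also have "\<dots> = emeasure (distr ?M borel g) A"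
      by (subst emeasure_distr) (auto simp: )
    finally show "emeasure (density lborel (indicator (g ` S))) A = emeasure (distr ?M borel g) A"
      by (subst emeasure_density) (auto simp: gT mult.commute nn_integral_cmult_indicator simp flip: indicator_inter_arith)
  qed simp
  then have "integral\<^sup>N (density lborel (indicator (g ` S))) f = integral\<^sup>N (distr ?M borel g) f" by simp
  then show ?thesis
    by (simp add: nn_integral_density nn_integral_distr mult_ac)
qed

text \<open>The integral of \<open>r\<^sup>n\<close> on \<open>(0, 1]\<close> with respect to \<open>dr / r\<close> is \<open>1 / n\<close>. Inserting it in terms of the
  other gauge and rescaling \<open>y\<close> exchanges the two gauges, as \<open>k y dy\<close> is invariant under scaling.\<close>

lemma nn_integral_gauge_eq:
  fixes k :: "'a::euclidean_space \<Rightarrow> ennreal" and \<rho> \<tau> :: "'a \<Rightarrow> real"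
  assumes k[measurable]: "k \<in> borel_measurable borel"
    and \<rho>[measurable]: "\<rho> \<in> borel_measurable borel" and \<tau>[measurable]: "\<tau> \<in> borel_measurable borel"
    and k_scale: "\<And>t y. 0 < t \<Longrightarrow> y \<noteq> 0 \<Longrightarrow> k (t *\<^sub>R y) = ennreal (1 / t ^ DIM('a)) * k y"
    and \<rho>_scale: "\<And>t y. 0 < t \<Longrightarrow> \<rho> (t *\<^sub>R y) = t * \<rho> y"
    and \<tau>_scale: "\<And>t y. 0 < t \<Longrightarrow> \<tau> (t *\<^sub>R y) = t * \<tau> y"
    and \<rho>_pos: "\<And>y. y \<noteq> 0 \<Longrightarrow> 0 < \<rho> y" and \<tau>_pos: "\<And>y. y \<noteq> 0 \<Longrightarrow> 0 < \<tau> y"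
  shows "(\<integral>\<^sup>+y. k y * (ennreal (\<rho> y ^ DIM('a)) * indicator {..1} (\<rho> y)) \<partial>lborel) =
    (\<integral>\<^sup>+y. k y * (ennreal (\<tau> y ^ DIM('a)) * indicator {..1} (\<tau> y)) \<partial>lborel)"
proof -
  define n where "n = DIM('a)"
  have n: "n > 0" by (simp add: n_def)
  define G where "G r = ennreal (r ^ n) * indicator {..1} r" for r :: real
  have G[measurable]: "G \<in> borel_measurable borel" unfolding G_def by measurable
  \<comment> \<open>\<open>P\<close> is the scale invariant measure ds / s on the half-line. By this
    invariance \<open>G (s * r)\<close> and \<open>G (r / s)\<close> have the same integral, that of
    s^(n - 1) over (0, 1].\<close>
  define P where "P s = ennreal (1 / s) * indicator {0<..} s" for s :: real
  have P[measurable]: "P \<in> borel_measurable borel" unfolding P_def by measurable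
  have c1: "(\<integral>\<^sup>+s. P s * G (s * r) \<partial>lborel) = ennreal (1 / n)" if r: "r > 0" for r
  proof -
    have "(\<integral>\<^sup>+s. P s * G (s * r) \<partial>lborel) = (\<integral>\<^sup>+s. ennreal (s ^ (n - 1) * r ^ n) * indicator {0..1/r} s \<partial>lborel)"
    proof (rule nn_integral_cong_AE)
      have "P s * G (s * r) = ennreal (s ^ (n - 1) * r ^ n) * indicator {0..1/r} s" if "s \<noteq> 0" for s
      proof (cases "s > 0 \<and> s * r \<le> 1")
        case True
        then have "1 / s * (s * r) ^ n = s ^ (n - 1) * r ^ n"
          by (cases n) (use n in \<open>simp_all add: power_mult_distrib\<close>)
        moreover have "P s * G (s * r) = ennreal (1 / s * (s * r) ^ n)"
          using True r by (simp add: P_def G_def ennreal_mult'[symmetric])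
        ultimately show ?thesis using True r by (simp add: field_simps)
      qed (use that r in \<open>auto simp: P_def G_def indicator_def field_simps\<close>)
      note H = this
        show "AE s in lborel. P s * G (s * r) = ennreal (s ^ (n - 1) * r ^ n) * indicator {0..1/r} s"
        using AE_lborel_singleton[of "0::real"] by eventually_elim (rule H)
    qed
    also have "\<dots> = ennreal ((1/r) ^ n * r ^ n / n - 0 ^ n * r ^ n / n)"
      by (rule nn_integral_FTC_Icc) (use r n in \<open>auto intro!: derivative_eq_intros\<close>)
    also have "\<dots> = ennreal (1 / n)" using r n by (simp add: power_divide zero_power)
    finally show ?thesis .
  qed
  have c2: "(\<integral>\<^sup>+s. P s * G (r / s) \<partial>lborel) = ennreal (1 / n)" if r: "r > 0" for r
  proof -
    have "P s * G (r / s) = ennreal (r ^ n * s powr - real (n + 1)) * indicator {r..} s" for s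
    proof (cases "s > 0 \<and> r \<le> s")
      case True
      then have "1 / s * (r / s) ^ n = r ^ n * s powr - real (n + 1)"
        using powr_realpow[of s "n + 1"] by (subst powr_minus) (simp add: divide_inverse power_mult_distrib power_inverse)
      moreover have "P s * G (r / s) = ennreal (1 / s * (r / s) ^ n)"
        using True r by (simp add: P_def G_def ennreal_mult'[symmetric])
      ultimately show ?thesis using True r by simp
    qed (use r in \<open>auto simp: P_def G_def indicator_def field_simps\<close>)
    then have "(\<integral>\<^sup>+s. P s * G (r / s) \<partial>lborel) = (\<integral>\<^sup>+s. ennreal (r ^ n * s powr - real (n + 1)) * indicator {r..} s \<partial>lborel)"
      by simp
    also have "\<dots> = ennreal (0 - - (r ^ n * r powr - real n / n))"
    proof (rule nn_integral_FTC_atLeast[where F = "\<lambda>x. - (r ^ n * x powr - real n / n)"])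
      fix x assume x: "r \<le> x"
      then have x0: "0 < x" using r by simp
      have "((\<lambda>x. - (r ^ n * x powr - real n / n)) has_real_derivative - (r ^ n * (- real n * x powr (- real n - 1)) / n)) (at x)"
        using x0 n by (auto intro!: derivative_eq_intros simp: )
      also have "- (r ^ n * (- real n * x powr (- real n - 1)) / n) = r ^ n * x powr - real (n + 1)"
      proof -
        have e: "- real n - 1 = - real (n + 1)" by simp
        show ?thesis unfolding e using n by (simp del: of_nat_add of_nat_Suc)
      qed
      finally show "((\<lambda>x. - (r ^ n * x powr - real n / n)) has_real_derivative r ^ n * x powr - real (n + 1)) (at x)" .
    next
      have "((\<lambda>x. - (r ^ n * x powr - real n / n)) \<longlongrightarrow> - (r ^ n * 0 / n)) at_top"
        using n by (intro tendsto_intros tendsto_neg_powr filterlim_ident) auto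
      then show "((\<lambda>x. - (r ^ n * x powr - real n / n)) \<longlongrightarrow> 0) at_top" by simp
    qed (use r in auto)
    also have "\<dots> = ennreal (1 / n)"
      using r by (simp add: powr_minus powr_realpow)
    finally show ?thesis .
  qed
  \<comment> \<open>Replacing \<open>y\<close> by \<open>y / s\<close> has a Jacobian that the
    degree \<open>- n\<close> of \<open>k\<close> cancels; the factor \<open>s\<close> moves from
    the gauge \<tau> to the gauge \<rho>.\<close>
  have scale: "(\<integral>\<^sup>+y. P s * (k y * G (\<rho> y) * G (s * \<tau> y)) \<partial>lborel) =
      (\<integral>\<^sup>+y. P s * (k y * G (\<rho> y / s) * G (\<tau> y)) \<partial>lborel)" for s
  proof (cases "s > 0")
    case True
    have "(\<integral>\<^sup>+y. k y * G (\<rho> y) * G (s * \<tau> y) \<partial>lborel) =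
        (\<integral>\<^sup>+y. ennreal ((1/s) ^ n) * (k ((1/s) *\<^sub>R y) * G (\<rho> ((1/s) *\<^sub>R y)) * G (s * \<tau> ((1/s) *\<^sub>R y))) \<partial>lborel)"
      by (subst lborel_affine[of "1/s" "0::'a"])
        (use True in \<open>auto simp: nn_integral_density nn_integral_distr n_def\<close>)
    also have "\<dots> = (\<integral>\<^sup>+y. k y * G (\<rho> y / s) * G (\<tau> y) \<partial>lborel)"
    proof (rule nn_integral_cong_AE)
      have "ennreal ((1/s) ^ n) * (k ((1/s) *\<^sub>R y) * G (\<rho> ((1/s) *\<^sub>R y)) * G (s * \<tau> ((1/s) *\<^sub>R y))) =
          k y * G (\<rho> y / s) * G (\<tau> y)" if "y \<noteq> 0" for y
      proof -
        have "ennreal ((1/s) ^ n) * k ((1/s) *\<^sub>R y) = ennreal ((1/s) ^ n) * ennreal (1 / (1/s) ^ n) * k y"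
          using k_scale[of "1/s" y] True that by (simp add: n_def mult.assoc)
        also have "ennreal ((1/s) ^ n) * ennreal (1 / (1/s) ^ n) = 1"
          using True by (simp add: ennreal_mult'[symmetric] power_divide)
        finally have k1: "ennreal ((1/s) ^ n) * k ((1/s) *\<^sub>R y) = k y" by simp
        have "\<rho> ((1/s) *\<^sub>R y) = \<rho> y / s" "s * \<tau> ((1/s) *\<^sub>R y) = \<tau> y"
          using True by (simp_all add: \<rho>_scale \<tau>_scale)
        then show ?thesis using k1 by (metis mult.assoc)
      qed
      note H = this
        show "AE y in lborel. ennreal ((1/s) ^ n) * (k ((1/s) *\<^sub>R y) * G (\<rho> ((1/s) *\<^sub>R y)) * G (s * \<tau> ((1/s) *\<^sub>R y))) =
          k y * G (\<rho> y / s) * G (\<tau> y)"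
        using AE_lborel_singleton[of "0::'a"] by eventually_elim (rule H)
    qed
    finally show ?thesis by (simp add: nn_integral_cmult)
  qed (simp add: P_def)
  have "(\<integral>\<^sup>+y. k y * G (\<rho> y) \<partial>lborel) * ennreal (1 / n) = (\<integral>\<^sup>+y. k y * G (\<rho> y) * ennreal (1 / n) \<partial>lborel)"
    by (simp add: nn_integral_multc)
  also have "\<dots> = (\<integral>\<^sup>+y. \<integral>\<^sup>+s. P s * (k y * G (\<rho> y) * G (s * \<tau> y)) \<partial>lborel \<partial>lborel)"
  proof (rule nn_integral_cong_AE)
    have "k y * G (\<rho> y) * ennreal (1 / n) = (\<integral>\<^sup>+s. P s * (k y * G (\<rho> y) * G (s * \<tau> y)) \<partial>lborel)" if "y \<noteq> 0" for y
      unfolding c1[OF \<tau>_pos[OF that], symmetric]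
      by (subst nn_integral_cmult[symmetric]) (auto simp: mult_ac)
    note H = this
      show "AE y in lborel. k y * G (\<rho> y) * ennreal (1 / n) = (\<integral>\<^sup>+s. P s * (k y * G (\<rho> y) * G (s * \<tau> y)) \<partial>lborel)"
      using AE_lborel_singleton[of "0::'a"] by eventually_elim (rule H)
  qed
  also have "\<dots> = (\<integral>\<^sup>+s. \<integral>\<^sup>+y. P s * (k y * G (\<rho> y) * G (s * \<tau> y)) \<partial>lborel \<partial>lborel)"
    by (rule lborel_pair.Fubini') measurable
  also have "\<dots> = (\<integral>\<^sup>+s. \<integral>\<^sup>+y. P s * (k y * G (\<rho> y / s) * G (\<tau> y)) \<partial>lborel \<partial>lborel)"
    by (simp only: scale)
  also have "\<dots> = (\<integral>\<^sup>+y. \<integral>\<^sup>+s. P s * (k y * G (\<rho> y / s) * G (\<tau> y)) \<partial>lborel \<partial>lborel)"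
    by (rule lborel_pair.Fubini') measurable
  also have "\<dots> = (\<integral>\<^sup>+y. k y * G (\<tau> y) * ennreal (1 / n) \<partial>lborel)"
  proof (rule nn_integral_cong_AE)
    have "k y * G (\<tau> y) * ennreal (1 / n) = (\<integral>\<^sup>+s. P s * (k y * G (\<rho> y / s) * G (\<tau> y)) \<partial>lborel)" if "y \<noteq> 0" for y
      unfolding c2[OF \<rho>_pos[OF that], symmetric]
      by (subst nn_integral_cmult[symmetric]) (auto simp: mult_ac)
    note H = this
      show "AE y in lborel. (\<integral>\<^sup>+s. P s * (k y * G (\<rho> y / s) * G (\<tau> y)) \<partial>lborel) = k y * G (\<tau> y) * ennreal (1 / n)"
      using AE_lborel_singleton[of "0::'a"] by eventually_elim (rule H[symmetric])
  qed
  also have "\<dots> = (\<integral>\<^sup>+y. k y * G (\<tau> y) \<partial>lborel) * ennreal (1 / n)"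
    by (simp add: nn_integral_multc)
  finally have "(\<integral>\<^sup>+y. k y * G (\<rho> y) \<partial>lborel) * ennreal (1 / n) = (\<integral>\<^sup>+y. k y * G (\<tau> y) \<partial>lborel) * ennreal (1 / n)" .
  moreover have "ennreal (1 / n) * ennreal n = 1"
    using n by (simp add: ennreal_mult'[symmetric])
  moreover have "A = B" if "A * c = B * c" "c * d = 1" for A B c d :: ennreal
    using arg_cong[OF that(1), of "\<lambda>x. x * d"] by (simp only: mult.assoc that(2) mult_1_right)
  ultimately have "(\<integral>\<^sup>+y. k y * G (\<rho> y) \<partial>lborel) = (\<integral>\<^sup>+y. k y * G (\<tau> y) \<partial>lborel)"
    by blast
  then show ?thesis by (simp add: G_def n_def)
qed

section \<open>Surface measure as the radial image of the unit ball\<close>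

lemma sets_sphere_measure [measurable_cong, simp]: "sets sphere_measure = sets borel"
  by (simp add: sphere_measure_def)

lemma space_sphere_measure [simp]: "space sphere_measure = UNIV"
  by (simp add: sphere_measure_def)

lemma borel_measurable_sphere_density [measurable]:
  "(\<lambda>x :: real^'n. of_nat CARD('n) * indicator (cball 0 1) x :: ennreal) \<in> borel_measurable borel"
  by (intro borel_measurable_times_ennreal borel_measurable_const borel_measurable_indicator) auto

lemma nn_integral_sphere:
  fixes f :: "real^'n \<Rightarrow> ennreal"
  assumes [measurable]: "f \<in> borel_measurable borel"
  shows "(\<integral>\<^sup>+x. f x \<partial>sphere_measure) =
    of_nat CARD('n) * (\<integral>\<^sup>+y. indicator (cball 0 1) y * f (y /\<^sub>R norm y) \<partial>lborel)"
proof -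
  have "(\<integral>\<^sup>+x. f x \<partial>sphere_measure) =
      (\<integral>\<^sup>+y. of_nat CARD('n) * indicator (cball 0 1) y * f (y /\<^sub>R norm y) \<partial>lborel)"
    unfolding sphere_measure_def
  proof (subst nn_integral_distr)
    have "(\<lambda>x :: real^'n. of_nat CARD('n) * indicator (cball 0 1) x :: ennreal) \<in> borel_measurable lborel"
      using borel_measurable_sphere_density by simp
    moreover have "(\<lambda>x. f (x /\<^sub>R norm x)) \<in> borel_measurable lborel" by measurable
    ultimately show "(\<integral>\<^sup>+x. f (x /\<^sub>R norm x) \<partial>density lborel (\<lambda>x. of_nat CARD('n) * indicator (cball 0 1) x)) =
        (\<integral>\<^sup>+y. of_nat CARD('n) * indicator (cball 0 1) y * f (y /\<^sub>R norm y) \<partial>lborel)"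
      by (rule nn_integral_density)
  qed simp_all
  also have "\<dots> = of_nat CARD('n) * (\<integral>\<^sup>+y. indicator (cball 0 1) y * f (y /\<^sub>R norm y) \<partial>lborel)"
  proof -
    have "(\<lambda>x. f (x /\<^sub>R norm x)) \<in> borel_measurable lborel" by measurable
    moreover have "indicator (cball 0 1 :: (real^'n) set) \<in> borel_measurable lborel"
      by (intro borel_measurable_indicator) simp
    ultimately show ?thesis
      unfolding mult.assoc by (intro nn_integral_cmult borel_measurable_times_ennreal)
  qed
  finally show ?thesis .
qed

lemma AE_sphere: "AE x in (sphere_measure :: (real^'n) measure). norm x = 1"
proof -
  have "AE x in lborel. 0 < (of_nat CARD('n) * indicator (cball 0 1) x :: ennreal) \<longrightarrow> norm (x /\<^sub>R norm (x::real^'n)) = 1"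
    using AE_lborel_singleton[of "0::real^'n"] by eventually_elim auto
  then have "AE x in density lborel (\<lambda>x. of_nat CARD('n) * indicator (cball 0 1) x). norm (x /\<^sub>R norm (x::real^'n)) = 1"
    by (subst AE_density) auto
  then show ?thesis
    unfolding sphere_measure_def by (subst AE_distr_iff) auto
qed

lemma emeasure_sphere_measure_UNIV:
  "emeasure (sphere_measure :: (real^'n) measure) UNIV = ennreal (CARD('n) * unit_ball_vol CARD('n))"
proof -
  have "emeasure (sphere_measure :: (real^'n) measure) UNIV = of_nat CARD('n) * ennreal (unit_ball_vol CARD('n))"
    using nn_integral_sphere[of "\<lambda>_ :: real^'n. 1"] by (simp add: emeasure_cball)
  also have "(of_nat CARD('n) :: ennreal) = ennreal (real CARD('n))"
    by (rule ennreal_of_nat_eq_real_of_nat)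
  finally show ?thesis by (simp add: ennreal_mult')
qed

lemma finite_measure_sphere: "finite_measure (sphere_measure :: (real^'n) measure)"
  by standard (simp add: emeasure_sphere_measure_UNIV)

lemma nn_integral_sphere_uminus:
  fixes f :: "real^'n \<Rightarrow> ennreal"
  assumes [measurable]: "f \<in> borel_measurable borel"
  shows "(\<integral>\<^sup>+x. f (- x) \<partial>sphere_measure) = (\<integral>\<^sup>+x. f x \<partial>sphere_measure)"
proof -
  have "(\<integral>\<^sup>+y. h y \<partial>lborel) = (\<integral>\<^sup>+y. h (- y) \<partial>lborel)" if h[measurable]: "h \<in> borel_measurable borel" for h :: "real^'n \<Rightarrow> ennreal"
    by (subst lborel_affine[of "- 1" "0 :: real^'n"]) (simp_all add: nn_integral_density nn_integral_distr)
  moreover have "(\<lambda>y. indicator (cball 0 1) y * f (- (y /\<^sub>R norm y))) \<in> borel_measurable borel"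
    by (intro borel_measurable_times_ennreal borel_measurable_indicator) simp_all
  moreover have "indicator (cball 0 1) (- y) = (indicator (cball 0 1) y :: ennreal)" for y :: "real^'n"
    by (simp add: indicator_def)
  ultimately have "(\<integral>\<^sup>+y. indicator (cball 0 1) y * f (- (y /\<^sub>R norm y)) \<partial>lborel) =
      (\<integral>\<^sup>+y. indicator (cball 0 1) y * f (y /\<^sub>R norm y) \<partial>lborel)"
    by force
  then show ?thesis by (simp add: nn_integral_sphere)
qed

section \<open>Hyperbolic reflections on the light cone and on the sphere\<close>

text \<open>Space component of the Lorentz reflection \<open>v - 2 (v, w) w\<close> of the
  light-like vector \<open>v = (y, norm y)\<close>, for \<open>w\<close> with
  \<open>lorentz_Q w = 1\<close>. Admitting all \<open>y\<close> instead of unit vectors turns the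
  projective action on the sphere into a map of degree 1 on the whole space, to which Lebesgue
  measure applies.\<close>

definition lorentz_refl :: "(real^'n) \<times> real \<Rightarrow> real^'n \<Rightarrow> real^'n" where
  "lorentz_refl w y = y - (2 * (fst w \<bullet> y - snd w * norm y)) *\<^sub>R fst w"

lemma lorentz_Q_eq_1_iff: "lorentz_Q w = 1 \<longleftrightarrow> fst w \<bullet> fst w = 1 + (snd w)\<^sup>2"
  by (simp add: lorentz_Q_eq lorentz_def power2_eq_square) linarith

text \<open>The last coordinate of the reflected light-like vector stays positive: with
  \<open>c = snd w\<close>, Cauchy-Schwarz reduces this to
  \<open>2 |c| sqrt (1 + c^2) < 1 + 2 c^2\<close>, and the squares of the two sides differ by
  1.\<close>

lemma norm_lorentz_refl_pos:
  assumes w: "lorentz_Q w = 1" and y: "y \<noteq> 0"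
  shows "0 < norm y - 2 * (fst w \<bullet> y - snd w * norm y) * snd w"
proof -
  define c where "c = snd w"
  have q: "norm (fst w) ^ 2 = 1 + c\<^sup>2"
    using w by (simp add: lorentz_Q_eq_1_iff power2_norm_eq_inner c_def)
  have "\<bar>2 * c\<bar> * norm (fst w) < 1 + 2 * c\<^sup>2"
  proof (rule power2_less_imp_less)
    show "(\<bar>2 * c\<bar> * norm (fst w))\<^sup>2 < (1 + 2 * c\<^sup>2)\<^sup>2"
      unfolding power_mult_distrib q by (simp add: power2_eq_square algebra_simps)
  qed simp
  then have "\<bar>2 * c\<bar> * norm (fst w) * norm y < (1 + 2 * c\<^sup>2) * norm y"
    using y by simp
  moreover have "2 * c * (fst w \<bullet> y) \<le> \<bar>2 * c\<bar> * (norm (fst w) * norm y)"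
  proof -
    have "2 * c * (fst w \<bullet> y) \<le> \<bar>2 * c\<bar> * \<bar>fst w \<bullet> y\<bar>"
      unfolding abs_mult[symmetric] by (rule abs_ge_self)
    also have "\<dots> \<le> \<bar>2 * c\<bar> * (norm (fst w) * norm y)"
      by (intro mult_left_mono Cauchy_Schwarz_ineq2 abs_ge_zero)
    finally show ?thesis .
  qed
  ultimately show ?thesis
    by (simp add: c_def[symmetric] algebra_simps power2_eq_square)
qed

text \<open>A Lorentz isometry keeps a vector light-like, so the norm of the space component is the
  absolute value of the last component, whose sign is given by
  \<open>norm_lorentz_refl_pos\<close>.\<close>

lemma norm_lorentz_refl:
  assumes w: "lorentz_Q w = 1"
  shows "norm (lorentz_refl w y) = norm y - 2 * (fst w \<bullet> y - snd w * norm y) * snd w"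
proof -
  define c s m where "c = snd w" and "s = fst w \<bullet> y - c * norm y" and "m = norm y"
  have q: "fst w \<bullet> fst w = 1 + c\<^sup>2" using w by (simp add: lorentz_Q_eq_1_iff c_def)
  have r: "lorentz_refl w y = y - (2 * s) *\<^sub>R fst w" by (simp add: lorentz_refl_def s_def c_def)
  have "(norm (lorentz_refl w y))\<^sup>2 = m\<^sup>2 - 4 * s * (fst w \<bullet> y) + 4 * s\<^sup>2 * (fst w \<bullet> fst w)"
    unfolding r power2_norm_eq_inner m_def
    by (simp add: inner_diff_left inner_diff_right inner_commute algebra_simps power2_eq_square)
  also have "\<dots> = m\<^sup>2 - 4 * s * (s + c * m) + 4 * s\<^sup>2 * (1 + c\<^sup>2)"
    unfolding q by (simp add: s_def m_def)
  also have "\<dots> = (m - 2 * s * c)\<^sup>2" by (simp add: algebra_simps power2_eq_square)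
  finally have "norm (lorentz_refl w y) = \<bar>m - 2 * s * c\<bar>"
    by (metis abs_norm_cancel power2_eq_iff_nonneg real_sqrt_abs)
  moreover have "0 \<le> m - 2 * s * c"
    using norm_lorentz_refl_pos[OF w, of y] by (cases "y = 0") (auto simp: m_def s_def c_def)
  ultimately show ?thesis by (simp add: m_def s_def c_def)
qed

lemma lorentz_refl_nonzero:
  "lorentz_Q w = 1 \<Longrightarrow> y \<noteq> 0 \<Longrightarrow> 0 < norm (lorentz_refl w y)"
  using norm_lorentz_refl norm_lorentz_refl_pos by metis

lemma lorentz_refl_mirror:
  assumes w: "lorentz_Q w = 1"
  shows "fst w \<bullet> lorentz_refl w y - snd w * norm (lorentz_refl w y) = - (fst w \<bullet> y - snd w * norm y)"
proof -
  have q: "fst w \<bullet> fst w = 1 + (snd w)\<^sup>2" using w by (simp add: lorentz_Q_eq_1_iff)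
  show ?thesis
    unfolding norm_lorentz_refl[OF w] unfolding lorentz_refl_def
    by (simp add: inner_diff_right q algebra_simps power2_eq_square)
qed

lemma lorentz_refl_involution:
  assumes w: "lorentz_Q w = 1"
  shows "lorentz_refl w (lorentz_refl w y) = y"
  unfolding lorentz_refl_def[of w "lorentz_refl w y"] lorentz_refl_mirror[OF w]
  by (simp add: lorentz_refl_def scaleR_left_diff_distrib)

text \<open>Both sides are minus the Lorentz product of the reflected vector with
  \<open>(z, 1)\<close>. The correction vanishes for \<open>z\<close> on the mirror, so for such
  \<open>z\<close> only the conformal factor matters.\<close>

lemma lorentz_refl_pairing:
  assumes w: "lorentz_Q w = 1"
  shows "norm (lorentz_refl w y) - lorentz_refl w y \<bullet> z =
    norm y - y \<bullet> z + 2 * (fst w \<bullet> y - snd w * norm y) * (fst w \<bullet> z - snd w)"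
  unfolding norm_lorentz_refl[OF w] unfolding lorentz_refl_def
  by (simp add: inner_diff_left algebra_simps)

lemma lorentz_refl_scale:
  "0 < t \<Longrightarrow> lorentz_refl w (t *\<^sub>R y) = t *\<^sub>R lorentz_refl w y"
  by (simp add: lorentz_refl_def algebra_simps)

lemma borel_measurable_lorentz_refl [measurable]:
  "lorentz_refl w \<in> borel_measurable borel"
  unfolding lorentz_refl_def[abs_def] by measurable

definition sphere_refl :: "(real^'n) \<times> real \<Rightarrow> real^'n \<Rightarrow> real^'n" where
  "sphere_refl w x = lorentz_refl w x /\<^sub>R norm (lorentz_refl w x)"

lemma borel_measurable_sphere_refl [measurable]:
  "sphere_refl w \<in> borel_measurable borel"
  unfolding sphere_refl_def[abs_def] by measurable

text \<open>On the light cone, identified with the space by \<open>(y, norm y)\<close>, the measure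
  dy / |y| is Lorentz invariant; this is the determinant in \<open>absdet\<close>. The unit ball
  that defines the surface measure is not invariant, so its gauge is first exchanged for the
  reflected one by \<open>nn_integral_gauge_eq\<close>; the substitution then restores the norm, the
  reflection being an involution.\<close>

lemma nn_integral_sphere_refl:
  fixes f :: "real^'n::{finite,wellorder} \<Rightarrow> ennreal"
  assumes w: "lorentz_Q w = 1" and f[measurable]: "f \<in> borel_measurable borel"
  shows "(\<integral>\<^sup>+x. ennreal (1 / norm (lorentz_refl w x) ^ (CARD('n) - 1)) * f (sphere_refl w x) \<partial>sphere_measure) =
    (\<integral>\<^sup>+x. f x \<partial>sphere_measure)"
proof -
  let ?n = "CARD('n)" and ?\<psi> = "lorentz_refl w"
  define g where "g r = ennreal (r ^ ?n) * indicator {..1} r" for r :: real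
  have g[measurable]: "g \<in> borel_measurable borel" unfolding g_def by measurable
  \<comment> \<open>\<open>k\<close> extends \<open>f\<close> to a function of degree
    \<open>- n\<close>; the factor \<open>g (norm y)\<close> puts \<open>norm y ^ n\<close> back and
    cuts off at the unit ball.\<close>
  define k where "k y = f (y /\<^sub>R norm y) * ennreal (1 / norm y ^ ?n)" for y
  have k[measurable]: "k \<in> borel_measurable borel" unfolding k_def by measurable
  define J where "J y h = h + ((fst w - (snd w / norm y) *\<^sub>R y) \<bullet> h) *\<^sub>R (- 2 *\<^sub>R fst w)" for y h
  have det: "det (matrix (J y)) = 1 + (fst w - (snd w / norm y) *\<^sub>R y) \<bullet> (- 2 *\<^sub>R fst w)" for y
    unfolding J_def by (rule det_identity_plus_rank_one)
  have absdet: "\<bar>det (matrix (J y))\<bar> = norm (?\<psi> y) / norm y" if "y \<noteq> 0" for y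
  proof -
    have "norm y * det (matrix (J y)) = - norm (?\<psi> y)"
      using that unfolding det norm_lorentz_refl[OF w] inner_diff_left inner_scaleR_right
        w[unfolded lorentz_Q_eq_1_iff]
      by (simp add: inner_commute[of y] field_simps power2_eq_square)
    then have "det (matrix (J y)) = - (norm (?\<psi> y) / norm y)" using that by (simp add: field_simps)
    then show ?thesis by simp
  qed
  have der: "(?\<psi> has_derivative J y) (at y within - {0})" if "y \<in> - {0}" for y
  proof -
    have "(norm has_derivative (\<lambda>h. h \<bullet> sgn y)) (at y)"
      by (rule has_derivative_norm) (use that in simp)
    then have "((\<lambda>y. y - (2 * (fst w \<bullet> y - snd w * norm y)) *\<^sub>R fst w) has_derivative
        (\<lambda>h. h - (2 * (fst w \<bullet> h - snd w * (h \<bullet> sgn y))) *\<^sub>R fst w)) (at y)"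
      by (auto intro!: derivative_eq_intros)
    also have "(\<lambda>h. h - (2 * (fst w \<bullet> h - snd w * (h \<bullet> sgn y))) *\<^sub>R fst w) = J y"
      by (auto simp: J_def fun_eq_iff sgn_div_norm inner_diff_left inner_commute[of y] divide_inverse)
    finally have "((\<lambda>y. y - (2 * (fst w \<bullet> y - snd w * norm y)) *\<^sub>R fst w) has_derivative J y) (at y)" .
    then show ?thesis unfolding lorentz_refl_def[abs_def] by (rule has_derivative_at_withinI)
  qed
  have nz: "?\<psi> y \<noteq> 0" if "y \<noteq> 0" for y :: "real^'n::_"
    using lorentz_refl_nonzero[OF w that] by auto
  have im: "?\<psi> ` (- {0}) = - {0}"
  proof (intro equalityI subsetI)
    fix y :: "real^'n::_" assume "y \<in> - {0}"
    then show "y \<in> ?\<psi> ` (- {0})"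
      using nz[of y] by (intro image_eqI[where x = "?\<psi> y"]) (simp_all add: lorentz_refl_involution[OF w])
  qed (use nz in auto)
  have inj: "inj_on ?\<psi> (- {0})"
    by (rule inj_on_inverseI[where g = ?\<psi>]) (rule lorentz_refl_involution[OF w])
  have AE0: "AE y in lborel. (y::real^'n::_) \<noteq> 0" by (rule AE_lborel_singleton)
  have "(\<integral>\<^sup>+y. indicator (cball 0 1) y * f (y /\<^sub>R norm y) \<partial>lborel) = (\<integral>\<^sup>+y. k y * g (norm y) \<partial>lborel)"
    by (rule nn_integral_cong_AE, use AE0 in eventually_elim)
      (auto simp: k_def g_def indicator_def ennreal_mult'[symmetric] mult.assoc)
  also have "\<dots> = (\<integral>\<^sup>+y. k y * g (norm (?\<psi> y)) \<partial>lborel)"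
  proof -
    have "k (t *\<^sub>R y) = ennreal (1 / t ^ ?n) * k y" if "0 < t" for t y
    proof -
      have "ennreal (1 / (t * norm y) ^ ?n) = ennreal (1 / t ^ ?n) * ennreal (1 / norm y ^ ?n)"
        using that by (simp add: power_mult_distrib ennreal_mult'[symmetric])
      moreover have "(t *\<^sub>R y) /\<^sub>R norm (t *\<^sub>R y) = y /\<^sub>R norm y" "norm (t *\<^sub>R y) = t * norm y"
        using that by simp_all
      ultimately show ?thesis
        unfolding k_def by (simp only: mult_ac)
    qed
    then show ?thesis
      using nn_integral_gauge_eq[OF k, of norm "\<lambda>y. norm (?\<psi> y)"] lorentz_refl_nonzero[OF w]
      by (simp add: g_def lorentz_refl_scale)
  qed
  also have "\<dots> = (\<integral>\<^sup>+y. k y * g (norm (?\<psi> y)) * indicator (?\<psi> ` (- {0})) y \<partial>lborel)"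
    by (rule nn_integral_cong_AE, use AE0 in eventually_elim) (auto simp: im)
  also have "\<dots> = (\<integral>\<^sup>+y. ennreal \<bar>det (matrix (J y))\<bar> * (k (?\<psi> y) * g (norm (?\<psi> (?\<psi> y)))) * indicator (- {0}) y \<partial>lborel)"
    by (rule nn_integral_change_of_variables) (use der inj in \<open>simp_all add: im det\<close>)
  also have "\<dots> = (\<integral>\<^sup>+y. indicator (cball 0 1) y * (ennreal (1 / norm (?\<psi> (y /\<^sub>R norm y)) ^ (?n - 1)) * f (sphere_refl w (y /\<^sub>R norm y))) \<partial>lborel)"
  proof (rule nn_integral_cong_AE, use AE0 in eventually_elim)
    fix y :: "real^'n::_" assume y: "y \<noteq> 0"
    define m l where "m = norm y" and "l = norm (?\<psi> y)"
    have ml: "0 < m" "0 < l" using y lorentz_refl_nonzero[OF w y] by (auto simp: m_def l_def)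
    have \<psi>: "?\<psi> (y /\<^sub>R norm y) = ?\<psi> y /\<^sub>R m"
      using ml by (simp add: lorentz_refl_scale m_def)
    have nn: "norm (?\<psi> (y /\<^sub>R norm y)) = l / m" using ml by (simp add: \<psi> l_def divide_inverse mult.commute)
    have s: "sphere_refl w (y /\<^sub>R norm y) = ?\<psi> y /\<^sub>R l"
      unfolding sphere_refl_def nn unfolding \<psi> using ml by (simp add: divide_inverse)
    have e: "l / m * (1 / l ^ ?n) * m ^ ?n = 1 / (l / m) ^ (?n - 1)"
    proof -
      obtain q where q: "?n = Suc q" by (metis zero_less_card_finite gr0_implies_Suc)
      show ?thesis using ml unfolding q by (simp add: power_divide)
    qed
    show "ennreal \<bar>det (matrix (J y))\<bar> * (k (?\<psi> y) * g (norm (?\<psi> (?\<psi> y)))) * indicator (- {0}) y =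
      indicator (cball 0 1) y * (ennreal (1 / norm (?\<psi> (y /\<^sub>R norm y)) ^ (?n - 1)) * f (sphere_refl w (y /\<^sub>R norm y)))"
    proof (cases "m \<le> 1")
      case True
      have "ennreal \<bar>det (matrix (J y))\<bar> * (k (?\<psi> y) * g (norm (?\<psi> (?\<psi> y)))) * indicator (- {0}) y =
          f (?\<psi> y /\<^sub>R l) * (ennreal (l / m) * ennreal (1 / l ^ ?n) * ennreal (m ^ ?n))"
        using True y unfolding absdet[OF y] k_def g_def lorentz_refl_involution[OF w]
          m_def[symmetric] l_def[symmetric]
        by (simp add: mult_ac)
      also have "ennreal (l / m) * ennreal (1 / l ^ ?n) * ennreal (m ^ ?n) = ennreal (1 / (l / m) ^ (?n - 1))"
        using ml by (simp only: e[symmetric]) (simp add: ennreal_mult[symmetric])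
      finally show ?thesis unfolding nn s using True by (simp add: m_def mult.commute)
    next
      case False
      then show ?thesis unfolding lorentz_refl_involution[OF w] by (simp add: g_def m_def)
    qed
  qed
  finally have "(\<integral>\<^sup>+y. indicator (cball 0 1) y * f (y /\<^sub>R norm y) \<partial>lborel) =
    (\<integral>\<^sup>+y. indicator (cball 0 1) y * (ennreal (1 / norm (?\<psi> (y /\<^sub>R norm y)) ^ (?n - 1)) * f (sphere_refl w (y /\<^sub>R norm y))) \<partial>lborel)" .
  then show ?thesis by (simp add: nn_integral_sphere)
qed

lemma sphere_measure_refl:
  fixes w :: "(real^'n::{finite,wellorder}) \<times> real"
  assumes w: "lorentz_Q w = 1"
  shows "distr (density sphere_measure (\<lambda>x. ennreal (1 / norm (lorentz_refl w x) ^ (CARD('n) - 1))))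
    borel (sphere_refl w) = sphere_measure"
proof (rule measure_eqI)
  let ?d = "\<lambda>x :: real^'n::_. ennreal (1 / norm (lorentz_refl w x) ^ (CARD('n) - 1))"
  have d: "?d \<in> borel_measurable sphere_measure" by measurable
  fix A assume "A \<in> sets (distr (density sphere_measure ?d) borel (sphere_refl w))"
  then have A[measurable]: "A \<in> sets borel" by simp
  have "emeasure (distr (density sphere_measure ?d) borel (sphere_refl w)) A =
      (\<integral>\<^sup>+x. indicator A x \<partial>distr (density sphere_measure ?d) borel (sphere_refl w))" by simp
  also have "\<dots> = (\<integral>\<^sup>+x. ?d x * indicator A (sphere_refl w x) \<partial>sphere_measure)"
    by (subst nn_integral_distr, simp, simp, subst nn_integral_density[OF d]) auto
  also have "\<dots> = emeasure sphere_measure A"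
    by (subst nn_integral_sphere_refl[OF w]) simp_all
  finally show "emeasure (distr (density sphere_measure ?d) borel (sphere_refl w)) A = emeasure sphere_measure A" .
qed simp

lemma integral_sphere_refl:
  fixes w :: "(real^'n::{finite,wellorder}) \<times> real" and f :: "real^'n::_ \<Rightarrow> real"
  assumes w: "lorentz_Q w = 1" and f: "f \<in> borel_measurable borel"
  shows "(\<integral>x. f x \<partial>sphere_measure) =
    (\<integral>x. f (sphere_refl w x) / norm (lorentz_refl w x) ^ (CARD('n) - 1) \<partial>sphere_measure)"
proof -
  let ?d = "\<lambda>x :: real^'n::_. 1 / norm (lorentz_refl w x) ^ (CARD('n) - 1)"
  have d: "?d \<in> borel_measurable sphere_measure" by measurable
  have fr: "(\<lambda>x. f (sphere_refl w x)) \<in> borel_measurable sphere_measure"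
    using measurable_compose[OF borel_measurable_sphere_refl f] by simp
  have "(\<integral>x. f x \<partial>sphere_measure) =
      (\<integral>x. f x \<partial>distr (density sphere_measure (\<lambda>x. ennreal (?d x))) borel (sphere_refl w))"
    unfolding sphere_measure_refl[OF w] ..
  also have "\<dots> = (\<integral>x. f (sphere_refl w x) \<partial>density sphere_measure (\<lambda>x. ennreal (?d x)))"
    by (rule integral_distr) (use f in simp_all)
  also have "\<dots> = (\<integral>x. ?d x *\<^sub>R f (sphere_refl w x) \<partial>sphere_measure)"
    by (rule integral_density[OF fr d]) simp
  finally show ?thesis by simp
qed

section \<open>Integrals over simplices\<close>

lemma nn_integral_exp_decay:
  assumes c: "0 < (c::real)"
  shows "(\<integral>\<^sup>+t. ennreal (exp (- (c * t))) * indicator {0<..} t \<partial>lborel) = ennreal (1 / c)"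
proof -
  have "(\<integral>\<^sup>+t. ennreal (exp (- (c * t))) * indicator {0<..} t \<partial>lborel) =
      (\<integral>\<^sup>+t. ennreal (exp (- (c * t))) * indicator {0..} t \<partial>lborel)"
    by (rule nn_integral_cong_AE, use AE_lborel_singleton[of "0::real"] in eventually_elim)
      (auto simp: indicator_def)
  also have "\<dots> = ennreal (0 - (- exp (- (c * 0)) / c))"
  proof (rule nn_integral_FTC_atLeast[where F = "\<lambda>t. - exp (- (c * t)) / c"])
    show "((\<lambda>t. - exp (- (c * t)) / c) has_real_derivative exp (- (c * t))) (at t)" for t
      using c by (auto intro!: derivative_eq_intros)
    have "filterlim (\<lambda>t. - (c * t)) at_bot at_top"
      by (subst filterlim_uminus_at_top[symmetric])
        (rule filterlim_tendsto_pos_mult_at_top[OF tendsto_const c filterlim_ident])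
    then have "((\<lambda>t. exp (- (c * t))) \<longlongrightarrow> 0) at_top"
      by (rule filterlim_compose[OF exp_at_bot])
    then have "((\<lambda>t. - exp (- (c * t)) / c) \<longlongrightarrow> - 0 / c) at_top"
      using c by (intro tendsto_intros) auto
    then show "((\<lambda>t. - exp (- (c * t)) / c) \<longlongrightarrow> 0) at_top" by simp
  qed auto
  finally show ?thesis using c by simp
qed

lemma nn_integral_power_exp_decay:
  assumes c: "0 < (c::real)"
  shows "(\<integral>\<^sup>+t. ennreal (t ^ m * exp (- (c * t))) * indicator {0<..} t \<partial>lborel) = ennreal (fact m / c ^ Suc m)"
proof -
  have "(\<integral>\<^sup>+t. ennreal (t ^ m * exp (- t)) * indicator {0<..} t \<partial>lborel) = ennreal (Gamma (real (Suc m)))"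
    unfolding Gamma_conv_nn_integral_real[OF of_nat_0_less_iff[THEN iffD2, OF zero_less_Suc]]
  proof (rule nn_integral_cong_AE, use AE_lborel_singleton[of "0::real"] in eventually_elim)
    fix t :: real assume "t \<noteq> 0"
    then show "ennreal (t ^ m * exp (- t)) * indicator {0<..} t =
        ennreal (indicator {0..} t * t powr (real (Suc m) - 1) / exp t)"
      by (auto simp: indicator_def powr_realpow exp_minus divide_inverse)
  qed
  then have 1: "(\<integral>\<^sup>+t. ennreal (t ^ m * exp (- t)) * indicator {0<..} t \<partial>lborel) = ennreal (fact m)"
    using Gamma_fact[of m, where 'a = real] by (simp add: add.commute)
  have "(\<integral>\<^sup>+t. ennreal (t ^ m * exp (- t)) * indicator {0<..} t \<partial>lborel) =
      ennreal \<bar>c\<bar> * (\<integral>\<^sup>+t. ennreal ((0 + c * t) ^ m * exp (- (0 + c * t))) * indicator {0<..} (0 + c * t) \<partial>lborel)"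
    by (rule nn_integral_real_affine) (use c in auto)
  also have "\<dots> = (\<integral>\<^sup>+t. ennreal (c ^ Suc m) * (ennreal (t ^ m * exp (- (c * t))) * indicator {0<..} t) \<partial>lborel)"
    unfolding nn_integral_cmult[symmetric, where c = "ennreal \<bar>c\<bar>"]
    by (subst nn_integral_cmult[symmetric], measurable, intro nn_integral_cong)
      (use c in \<open>auto simp: indicator_def ennreal_mult'[symmetric] power_mult_distrib zero_less_mult_iff mult_ac\<close>)
  also have "\<dots> = ennreal (c ^ Suc m) * (\<integral>\<^sup>+t. ennreal (t ^ m * exp (- (c * t))) * indicator {0<..} t \<partial>lborel)"
    by (rule nn_integral_cmult) measurable
  finally have "ennreal (c ^ Suc m) * (\<integral>\<^sup>+t. ennreal (t ^ m * exp (- (c * t))) * indicator {0<..} t \<partial>lborel) = ennreal (fact m)"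
    using 1 by simp
  moreover have "ennreal (1 / c ^ Suc m) * ennreal (c ^ Suc m) = 1"
    using c by (subst ennreal_mult'[symmetric]) auto
  ultimately have "(\<integral>\<^sup>+t. ennreal (t ^ m * exp (- (c * t))) * indicator {0<..} t \<partial>lborel) =
      ennreal (1 / c ^ Suc m) * ennreal (fact m)"
    by (metis mult.assoc mult_1)
  then show ?thesis using c by (simp add: ennreal_mult'[symmetric])
qed

text \<open>Both sides are evaluations of the triple integral of \<open>exp (- \<tau> \<ell>(t) - u \<tau>)\<close> over the cone over
  the simplex, in polar and in linear coordinates.\<close>

lemma nn_integral_std_simplex_power:
  fixes A :: "'a::euclidean_space"
  assumes a0: "0 < (a0::real)" and A: "\<And>b. b \<in> Basis \<Longrightarrow> 0 < A \<bullet> b"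
  shows "ennreal (fact (DIM('a) - 1)) * (\<integral>\<^sup>+t. indicator (convex hull (insert 0 Basis)) t *
      ennreal (1 / (a0 + (\<Sum>b\<in>Basis. (t \<bullet> b) * (A \<bullet> b - a0))) ^ DIM('a)) \<partial>lborel) =
    (\<integral>\<^sup>+u. ennreal (1 / ((a0 + u) * (\<Prod>b\<in>Basis. A \<bullet> b + u))) * indicator {0<..} u \<partial>lborel)"
proof -
  define n where "n = DIM('a)"
  have n: "n = Suc (n - 1)" using DIM_positive[where 'a='a] by (simp add: n_def del: DIM_positive)
  define N where "N t = (\<Sum>b\<in>Basis. t \<bullet> b)" for t :: 'a
  define W where "W t = (\<Sum>b\<in>Basis. (t \<bullet> b) * (A \<bullet> b))" for t
  define Q where "Q = {t :: 'a. \<forall>b\<in>Basis. 0 \<le> t \<bullet> b}"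
  have [measurable]: "N \<in> borel_measurable borel" "W \<in> borel_measurable borel"
    unfolding N_def W_def by measurable
  have "closed Q"
  proof -
    have "Q = (\<Inter>b\<in>Basis. {t. 0 \<le> t \<bullet> b})" by (auto simp: Q_def)
    also have "closed \<dots>" by (intro closed_INT ballI closed_Collect_le continuous_intros)
    finally show ?thesis .
  qed
  then have [measurable]: "Q \<in> sets borel" by simp
  have X: "convex hull (insert 0 Basis) = {t :: 'a. t \<in> Q \<and> N t \<le> 1}"
    by (simp add: std_simplex Q_def N_def)
  have N0: "0 \<le> N t" if "t \<in> Q" for t using that by (auto simp: N_def Q_def intro!: sum_nonneg)
  have l: "a0 + (\<Sum>b\<in>Basis. (t \<bullet> b) * (A \<bullet> b - a0)) = a0 * (1 - N t) + W t" for t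
    by (simp add: N_def W_def right_diff_distrib sum_subtractf sum_distrib_left sum_distrib_right algebra_simps)
  have l_pos: "0 < a0 * (1 - N t) + W t" if t: "t \<in> Q" "N t \<le> 1" for t
  proof (cases "N t < 1")
    case True
    have "0 \<le> W t" unfolding W_def
      using t A by (intro sum_nonneg mult_nonneg_nonneg) (auto simp: Q_def less_imp_le)
    moreover have "0 < a0 * (1 - N t)" using True a0 by simp
    ultimately show ?thesis by linarith
  next
    case False
    then have N1: "N t = 1" using t by simp
    then obtain b where b: "b \<in> Basis" "t \<bullet> b \<noteq> 0"
      by (metis N_def sum.neutral zero_neq_one)
    then have "0 < (t \<bullet> b) * (A \<bullet> b)" using t A by (auto simp: Q_def less_le intro!: mult_pos_pos)
    moreover have "0 \<le> (t \<bullet> b) * (A \<bullet> b)" if "b \<in> Basis" for b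
      using t A[OF that] that by (auto simp: Q_def)
    ultimately have "0 < W t" unfolding W_def using b(1) by (intro sum_pos2[where i = b]) auto
    then show ?thesis using N1 by simp
  qed
  define i where "i S x = (indicator S x :: ennreal)" for S :: "real set" and x
  \<comment> \<open>The cone over the simplex in linear coordinates: \<open>s\<close> holds the
    weights of the vertices other than 0, \<open>r\<close> is the weight of the vertex 0, and \<tau>
    = \<open>r + N s\<close> is the radial variable. The exponent is minus
    \<open>a0 * r + W s + u * \<tau>\<close>.\<close>
  define K where "K u r s = (if s \<in> Q then i {0<..} u * i {0<..} r *
      ennreal (exp (- ((a0 + u) * r))) * ennreal (exp (- (W s + u * N s))) else 0)" for u r s
  have [measurable]: "Measurable.pred borel (\<lambda>s. s \<in> Q)" by simp
  have linear: "(\<integral>\<^sup>+s. K u r s \<partial>lborel) = i {0<..} u * i {0<..} r * ennreal (exp (- ((a0 + u) * r))) *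
      ennreal (1 / (\<Prod>b\<in>Basis. A \<bullet> b + u))" for u r
  proof (cases "u > 0")
    case True
    have "(\<integral>\<^sup>+s. (if s \<in> Q then ennreal (exp (- (W s + u * N s))) else 0) \<partial>lborel) =
        (\<integral>\<^sup>+s. (\<Prod>b\<in>Basis. (ennreal (exp (- ((A \<bullet> b + u) * (s \<bullet> b)))) * indicator {0..} (s \<bullet> b))) \<partial>lborel)"
    proof (rule nn_integral_cong)
      fix s :: 'a
      have "W s + u * N s = (\<Sum>b\<in>Basis. (A \<bullet> b + u) * (s \<bullet> b))"
        by (simp add: W_def N_def sum_distrib_left sum.distrib[symmetric] algebra_simps)
      then have "ennreal (exp (- (W s + u * N s))) = (\<Prod>b\<in>Basis. ennreal (exp (- ((A \<bullet> b + u) * (s \<bullet> b)))))"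
        by (simp add: exp_sum sum_negf[symmetric] prod_ennreal)
      moreover have "(\<Prod>b\<in>Basis. indicator {0..} (s \<bullet> b)) = (if s \<in> Q then 1 else 0 :: ennreal)"
        by (auto simp: Q_def indicator_def prod_zero_iff)
      ultimately show "(if s \<in> Q then ennreal (exp (- (W s + u * N s))) else 0) =
          (\<Prod>b\<in>Basis. (ennreal (exp (- ((A \<bullet> b + u) * (s \<bullet> b)))) * indicator {0..} (s \<bullet> b)))"
        by (simp add: prod.distrib)
    qed
    also have "\<dots> = (\<Prod>b\<in>Basis. \<integral>\<^sup>+x. ennreal (exp (- ((A \<bullet> b + u) * x))) * indicator {0..} x \<partial>lborel)"
      by (rule nn_integral_lborel_prod) auto
    also have "\<dots> = (\<Prod>b\<in>Basis. ennreal (1 / (A \<bullet> b + u)))"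
    proof (rule prod.cong)
      fix b :: 'a assume b: "b \<in> Basis"
      have "(\<integral>\<^sup>+x. ennreal (exp (- ((A \<bullet> b + u) * x))) * indicator {0..} x \<partial>lborel) =
          (\<integral>\<^sup>+x. ennreal (exp (- ((A \<bullet> b + u) * x))) * indicator {0<..} x \<partial>lborel)"
        by (rule nn_integral_cong_AE, use AE_lborel_singleton[of "0::real"] in eventually_elim)
          (auto simp: indicator_def)
      also have "\<dots> = ennreal (1 / (A \<bullet> b + u))"
        by (rule nn_integral_exp_decay) (use A[OF b] True in simp)
      finally show "(\<integral>\<^sup>+x. ennreal (exp (- ((A \<bullet> b + u) * x))) * indicator {0..} x \<partial>lborel) = ennreal (1 / (A \<bullet> b + u))" .
    qed simp
    also have "\<dots> = ennreal (1 / (\<Prod>b\<in>Basis. A \<bullet> b + u))"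
      using A True by (subst prod_ennreal) (auto simp: prod_dividef intro!: less_imp_le add_pos_pos)
    finally have *: "(\<integral>\<^sup>+s. (if s \<in> Q then ennreal (exp (- (W s + u * N s))) else 0) \<partial>lborel) =
        ennreal (1 / (\<Prod>b\<in>Basis. A \<bullet> b + u))" .
    have "(\<integral>\<^sup>+s. K u r s \<partial>lborel) = (\<integral>\<^sup>+s. (i {0<..} u * i {0<..} r * ennreal (exp (- ((a0 + u) * r)))) *
        (if s \<in> Q then ennreal (exp (- (W s + u * N s))) else 0) \<partial>lborel)"
      by (intro nn_integral_cong) (auto simp: K_def)
    also have "\<dots> = (i {0<..} u * i {0<..} r * ennreal (exp (- ((a0 + u) * r)))) *
        ennreal (1 / (\<Prod>b\<in>Basis. A \<bullet> b + u))"
      unfolding *[symmetric] by (rule nn_integral_cmult) measurable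
    finally show ?thesis .
  qed (simp add: K_def i_def cong: if_cong)
  have "(\<integral>\<^sup>+s. \<integral>\<^sup>+u. \<integral>\<^sup>+r. K u r s \<partial>lborel \<partial>lborel \<partial>lborel) = (\<integral>\<^sup>+u. \<integral>\<^sup>+s. \<integral>\<^sup>+r. K u r s \<partial>lborel \<partial>lborel \<partial>lborel)"
    unfolding K_def i_def by (rule lborel_pair.Fubini') measurable
  also have "\<dots> = (\<integral>\<^sup>+u. \<integral>\<^sup>+r. \<integral>\<^sup>+s. K u r s \<partial>lborel \<partial>lborel \<partial>lborel)"
    unfolding K_def i_def by (intro nn_integral_cong lborel_pair.Fubini') measurable
  also have "\<dots> = (\<integral>\<^sup>+u. ennreal (1 / ((a0 + u) * (\<Prod>b\<in>Basis. A \<bullet> b + u))) * indicator {0<..} u \<partial>lborel)"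
  proof (rule nn_integral_cong)
    fix u :: real
    show "(\<integral>\<^sup>+r. \<integral>\<^sup>+s. K u r s \<partial>lborel \<partial>lborel) =
        ennreal (1 / ((a0 + u) * (\<Prod>b\<in>Basis. A \<bullet> b + u))) * indicator {0<..} u"
    proof (cases "u > 0")
      case True
      have "(\<integral>\<^sup>+r. \<integral>\<^sup>+s. K u r s \<partial>lborel \<partial>lborel) =
          (\<integral>\<^sup>+r. ennreal (exp (- ((a0 + u) * r))) * indicator {0<..} r * ennreal (1 / (\<Prod>b\<in>Basis. A \<bullet> b + u)) \<partial>lborel)"
        unfolding linear using True by (intro nn_integral_cong) (auto simp: i_def mult_ac)
      also have "\<dots> = ennreal (1 / (a0 + u)) * ennreal (1 / (\<Prod>b\<in>Basis. A \<bullet> b + u))"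
        using True a0 by (subst nn_integral_multc) (auto simp: nn_integral_exp_decay)
      finally show ?thesis using True a0 by (simp add: ennreal_mult'[symmetric])
    qed (simp add: linear i_def)
  qed
  finally have right: "(\<integral>\<^sup>+s. \<integral>\<^sup>+u. \<integral>\<^sup>+r. K u r s \<partial>lborel \<partial>lborel \<partial>lborel) =
    (\<integral>\<^sup>+u. ennreal (1 / ((a0 + u) * (\<Prod>b\<in>Basis. A \<bullet> b + u))) * indicator {0<..} u \<partial>lborel)" .
  \<comment> \<open>The integrand after replacing \<open>r\<close> by \<open>\<tau> - N s\<close>
    and integrating over \<open>u\<close>, which yields the factor
    \<open>1 / \<tau>\<close>.\<close>
  define H where "H s \<tau> = (if s \<in> Q then i {0<..} \<tau> * i {N s..} \<tau> * ennreal (1 / \<tau>) *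
      ennreal (exp (- (a0 * (\<tau> - N s) + W s))) else 0)" for s \<tau>
  have ind: "i {N s..} \<tau> = (if N s \<le> \<tau> then 1 else 0)" for s \<tau> by (simp add: i_def indicator_def)
  have KH: "(\<integral>\<^sup>+u. \<integral>\<^sup>+r. K u r s \<partial>lborel \<partial>lborel) = (\<integral>\<^sup>+\<tau>. H s \<tau> \<partial>lborel)" for s
  proof (cases "s \<in> Q")
    case True
    have "(\<integral>\<^sup>+u. \<integral>\<^sup>+r. K u r s \<partial>lborel \<partial>lborel) =
        (\<integral>\<^sup>+u. \<integral>\<^sup>+\<tau>. i {0<..} u * (i {0<..} (\<tau> - N s) * ennreal (exp (- (a0 * (\<tau> - N s) + W s))) *
          ennreal (exp (- (\<tau> * u)))) \<partial>lborel \<partial>lborel)"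
    proof (rule nn_integral_cong)
      fix u :: real
      have "(\<integral>\<^sup>+r. K u r s \<partial>lborel) = ennreal \<bar>1\<bar> * (\<integral>\<^sup>+\<tau>. K u (- N s + 1 * \<tau>) s \<partial>lborel)"
        unfolding K_def i_def by (rule nn_integral_real_affine) auto
      also have "\<dots> = (\<integral>\<^sup>+\<tau>. i {0<..} u * (i {0<..} (\<tau> - N s) * ennreal (exp (- (a0 * (\<tau> - N s) + W s))) *
          ennreal (exp (- (\<tau> * u)))) \<partial>lborel)"
      proof -
        have "- N s + 1 * \<tau> = \<tau> - N s" for \<tau> by simp
        moreover have "ennreal (exp (- ((a0 + u) * (\<tau> - N s)))) * ennreal (exp (- (W s + u * N s))) =
            ennreal (exp (- (a0 * (\<tau> - N s) + W s))) * ennreal (exp (- (\<tau> * u)))" for \<tau>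
          by (simp add: ennreal_mult'[symmetric] exp_add[symmetric] algebra_simps)
        ultimately show ?thesis using True by (simp add: K_def mult.assoc)
      qed
      finally show "(\<integral>\<^sup>+r. K u r s \<partial>lborel) = \<dots>" .
    qed
    also have "\<dots> = (\<integral>\<^sup>+\<tau>. \<integral>\<^sup>+u. i {0<..} u * (i {0<..} (\<tau> - N s) * ennreal (exp (- (a0 * (\<tau> - N s) + W s))) *
          ennreal (exp (- (\<tau> * u)))) \<partial>lborel \<partial>lborel)"
      unfolding i_def by (rule lborel_pair.Fubini') measurable
    also have "\<dots> = (\<integral>\<^sup>+\<tau>. H s \<tau> \<partial>lborel)"
    proof (rule nn_integral_cong_AE, use AE_lborel_singleton[of "N s"] in eventually_elim)
      fix \<tau> assume \<tau>: "\<tau> \<noteq> N s"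
      show "(\<integral>\<^sup>+u. i {0<..} u * (i {0<..} (\<tau> - N s) * ennreal (exp (- (a0 * (\<tau> - N s) + W s))) *
          ennreal (exp (- (\<tau> * u)))) \<partial>lborel) = H s \<tau>"
      proof (cases "N s < \<tau>")
        case Nt: True
        then have t0: "0 < \<tau>" using N0[OF True] by simp
        have "(\<integral>\<^sup>+u. i {0<..} u * (i {0<..} (\<tau> - N s) * ennreal (exp (- (a0 * (\<tau> - N s) + W s))) *
          ennreal (exp (- (\<tau> * u)))) \<partial>lborel) =
          (\<integral>\<^sup>+u. ennreal (exp (- (a0 * (\<tau> - N s) + W s))) * (ennreal (exp (- (\<tau> * u))) * indicator {0<..} u) \<partial>lborel)"
          using Nt by (intro nn_integral_cong) (simp add: i_def mult_ac)
        also have "\<dots> = ennreal (exp (- (a0 * (\<tau> - N s) + W s))) * ennreal (1 / \<tau>)"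
          by (subst nn_integral_cmult) (auto simp: nn_integral_exp_decay[OF t0])
        finally show ?thesis using True Nt t0 by (simp add: H_def i_def mult_ac)
      next
        case False
        then show ?thesis using \<tau> by (simp add: H_def i_def)
      qed
    qed
    finally show ?thesis .
  qed (simp add: K_def H_def)
  \<comment> \<open>Polar coordinates \<open>s = \<tau> t\<close>: the Jacobian
    \<open>\<tau> ^ n\<close> and the factor \<open>1 / \<tau>\<close> leave the power
    \<open>n - 1\<close>, whose Gamma integral is the source of \<open>fact (n - 1)\<close>.\<close>
  have HX: "(\<integral>\<^sup>+s. H s \<tau> \<partial>lborel) = (\<integral>\<^sup>+t. indicator {t. t \<in> Q \<and> N t \<le> 1} t *
      (ennreal (\<tau> ^ (n - 1) * exp (- ((a0 * (1 - N t) + W t) * \<tau>))) * indicator {0<..} \<tau>) \<partial>lborel)" for \<tau>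
  proof (cases "\<tau> > 0")
    case True
    have "(\<integral>\<^sup>+s. H s \<tau> \<partial>lborel) = (\<integral>\<^sup>+t. ennreal (\<tau> ^ n) * H (\<tau> *\<^sub>R t) \<tau> \<partial>lborel)"
      unfolding H_def ind unfolding i_def
      by (subst lborel_affine[of \<tau> "0::'a"])
        (use True in \<open>auto simp: nn_integral_density nn_integral_distr n_def\<close>)
    also have "\<dots> = (\<integral>\<^sup>+t. indicator {t. t \<in> Q \<and> N t \<le> 1} t *
      (ennreal (\<tau> ^ (n - 1) * exp (- ((a0 * (1 - N t) + W t) * \<tau>))) * indicator {0<..} \<tau>) \<partial>lborel)"
    proof (rule nn_integral_cong)
      fix t
      have "\<tau> *\<^sub>R t \<in> Q \<longleftrightarrow> t \<in> Q" "N (\<tau> *\<^sub>R t) = \<tau> * N t" "W (\<tau> *\<^sub>R t) = \<tau> * W t"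
        using True by (auto simp: Q_def N_def W_def sum_distrib_left mult.assoc zero_le_mult_iff)
      moreover have "\<tau> ^ n * (1 / \<tau>) = \<tau> ^ (n - 1)" by (subst n) (use True in simp)
      ultimately show "ennreal (\<tau> ^ n) * H (\<tau> *\<^sub>R t) \<tau> = indicator {t. t \<in> Q \<and> N t \<le> 1} t *
      (ennreal (\<tau> ^ (n - 1) * exp (- ((a0 * (1 - N t) + W t) * \<tau>))) * indicator {0<..} \<tau>)"
      proof -
        assume *: "\<tau> *\<^sub>R t \<in> Q \<longleftrightarrow> t \<in> Q" "N (\<tau> *\<^sub>R t) = \<tau> * N t" "W (\<tau> *\<^sub>R t) = \<tau> * W t"
          "\<tau> ^ n * (1 / \<tau>) = \<tau> ^ (n - 1)"
        have "a0 * (\<tau> - \<tau> * N t) + \<tau> * W t = (a0 * (1 - N t) + W t) * \<tau>" by (simp add: algebra_simps)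
        then have "\<tau> ^ n * (1 / \<tau>) * exp (- (a0 * (\<tau> - \<tau> * N t) + \<tau> * W t)) =
            \<tau> ^ (n - 1) * exp (- ((a0 * (1 - N t) + W t) * \<tau>))"
          by (simp only: *(4))
        then have "ennreal (\<tau> ^ n) * (ennreal (1 / \<tau>) * ennreal (exp (- (a0 * (\<tau> - \<tau> * N t) + \<tau> * W t)))) =
            ennreal (\<tau> ^ (n - 1) * exp (- ((a0 * (1 - N t) + W t) * \<tau>)))"
          using True by (simp add: ennreal_mult'[symmetric])
        moreover have "\<tau> * N t \<le> \<tau> \<longleftrightarrow> N t \<le> 1" using True by simp
        ultimately show ?thesis
          using True unfolding H_def i_def *(1,2,3) by (simp add: indicator_def)
      qed
    qed
    finally show ?thesis .
  qed (simp add: H_def i_def cong: if_cong)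
  have "(\<integral>\<^sup>+s. \<integral>\<^sup>+u. \<integral>\<^sup>+r. K u r s \<partial>lborel \<partial>lborel \<partial>lborel) = (\<integral>\<^sup>+\<tau>. \<integral>\<^sup>+s. H s \<tau> \<partial>lborel \<partial>lborel)"
    unfolding KH H_def ind unfolding i_def by (rule lborel_pair.Fubini') measurable
  also have "\<dots> = (\<integral>\<^sup>+t. \<integral>\<^sup>+\<tau>. indicator {t. t \<in> Q \<and> N t \<le> 1} t *
      (ennreal (\<tau> ^ (n - 1) * exp (- ((a0 * (1 - N t) + W t) * \<tau>))) * indicator {0<..} \<tau>) \<partial>lborel \<partial>lborel)"
    unfolding HX by (rule lborel_pair.Fubini') measurable
  also have "\<dots> = (\<integral>\<^sup>+t. ennreal (fact (n - 1)) * (indicator {t. t \<in> Q \<and> N t \<le> 1} t * ennreal (1 / (a0 * (1 - N t) + W t) ^ n)) \<partial>lborel)"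
  proof (rule nn_integral_cong)
    fix t
    show "(\<integral>\<^sup>+\<tau>. indicator {t. t \<in> Q \<and> N t \<le> 1} t *
      (ennreal (\<tau> ^ (n - 1) * exp (- ((a0 * (1 - N t) + W t) * \<tau>))) * indicator {0<..} \<tau>) \<partial>lborel) =
      ennreal (fact (n - 1)) * (indicator {t. t \<in> Q \<and> N t \<le> 1} t * ennreal (1 / (a0 * (1 - N t) + W t) ^ n))"
    proof (cases "t \<in> Q \<and> N t \<le> 1")
      case True
      then show ?thesis
        using nn_integral_power_exp_decay[OF l_pos[of t], of "n - 1"] n l_pos[of t]
        by (simp add: ennreal_mult'[symmetric])
    qed simp
  qed
  also have "\<dots> = ennreal (fact (n - 1)) * (\<integral>\<^sup>+t. indicator {t. t \<in> Q \<and> N t \<le> 1} t * ennreal (1 / (a0 * (1 - N t) + W t) ^ n) \<partial>lborel)"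
    by (rule nn_integral_cmult) measurable
  finally show ?thesis unfolding right X l n_def by simp
qed

lemma bij_betw_axis_Basis: "bij_betw (\<lambda>i. axis i 1 :: real^'n) UNIV Basis"
proof -
  have "inj (\<lambda>i. axis i 1 :: real^'n)" by (auto intro!: injI simp: axis_eq_axis)
  moreover have "range (\<lambda>i. axis i 1 :: real^'n) = Basis" by (auto simp: Basis_vec_def)
  ultimately show ?thesis by (simp add: bij_betw_def)
qed

lemma atMost_eq_insert_coord_pos:
  "{..CARD('n::{finite,wellorder})} = insert 0 (range (coord_pos :: 'n \<Rightarrow> nat))"
  using coord_pos_bij[where 'n='n] by (auto simp: bij_betw_def)

lemma prod_atMost_coord_pos:
  "(\<Prod>k\<le>CARD('n::{finite,wellorder}). f k) = f 0 * (\<Prod>i\<in>UNIV. f (coord_pos (i :: 'n)) :: real)"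
proof -
  have "inj (coord_pos :: 'n \<Rightarrow> nat)" "0 \<notin> range (coord_pos :: 'n \<Rightarrow> nat)"
    using coord_pos_bij[where 'n='n] by (auto simp: bij_betw_def)
  then show ?thesis
    unfolding atMost_eq_insert_coord_pos by (simp add: prod.reindex)
qed

text \<open>The affine map from the standard simplex onto the geodesic simplex has the differences
  \<open>y i - y 0\<close> as columns, hence Jacobian \<Delta>, and pulls
  \<open>1 - x \<bullet> z\<close> back to the affine function with values
  \<open>1 - x \<bullet> y k\<close> at the vertices.\<close>

lemma nn_integral_geodesic_simplex:
  fixes y :: "nat \<Rightarrow> real^'n::{finite,wellorder}"
  assumes a: "\<And>k. k \<le> CARD('n) \<Longrightarrow> 0 < 1 - x \<bullet> y k"
    and \<Delta>: "det_rows (\<lambda>i. y i - y 0) \<noteq> 0"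
  shows "ennreal (fact (CARD('n) - 1)) *
      (\<integral>\<^sup>+z. indicator (geodesic_simplex y) z * ennreal (1 / (1 - x \<bullet> z) ^ CARD('n)) \<partial>lborel) =
    ennreal \<bar>det_rows (\<lambda>i. y i - y 0)\<bar> *
      (\<integral>\<^sup>+u. ennreal (1 / (\<Prod>k\<le>CARD('n). 1 - x \<bullet> y k + u)) * indicator {0<..} u \<partial>lborel)"
proof -
  let ?n = "CARD('n)" and ?c = "coord_pos :: 'n \<Rightarrow> nat" and ?\<Delta> = "det_rows (\<lambda>i. y i - y 0)"
  let ?S = "convex hull (insert 0 Basis) :: (real^'n::_) set"
  have c: "?c i \<le> ?n" for i using coord_pos_bij[where 'n='n] by (auto simp: bij_betw_def)
  define d where "d i = y (?c i) - y 0" for i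
  define L where "L t = (\<Sum>i\<in>UNIV. t $ i *\<^sub>R d i)" for t :: "real^'n::_"
  define g where "g t = y 0 + L t" for t
  have L: "linear L" unfolding L_def
    by (intro linearI) (simp_all add: scaleR_left_distrib sum.distrib scaleR_sum_right)
  have Lax: "L (axis i 1) = d i" for i
    by (simp add: L_def axis_def if_distrib[of "\<lambda>x. x *\<^sub>R _"] cong: if_cong)
  have "matrix L = transpose (\<chi> i. d i)"
    by (simp add: matrix_def Lax transpose_def)
  then have detL: "det (matrix L) = ?\<Delta>" by (simp add: det_rows_def d_def)
  have "g ` ?S = (+) (y 0) ` (convex hull (L ` insert 0 Basis))"
    by (simp add: g_def convex_hull_linear_image[OF L] image_image[of "(+) (y 0)" L, symmetric] del: image_insert)
  also have "L ` insert 0 Basis = insert 0 (range d)"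
  proof -
    have B: "Basis = range (\<lambda>i. axis i 1 :: real^'n::_)"
      using bij_betw_axis_Basis[where 'n='n] by (simp add: bij_betw_def)
    show ?thesis unfolding B by (simp add: image_image Lax linear_0[OF L])
  qed
  also have "(+) (y 0) ` (convex hull insert 0 (range d)) = convex hull ((+) (y 0) ` insert 0 (range d))"
    by (rule convex_hull_translation[symmetric])
  also have "(+) (y 0) ` insert 0 (range d) = y ` {0..?n}"
    unfolding atLeast0AtMost atMost_eq_insert_coord_pos by (auto simp: d_def image_image)
  finally have gS: "g ` ?S = geodesic_simplex y" by (simp add: geodesic_simplex_def)
  have "compact ?S" by (intro compact_convex_hull finite_imp_compact) simp
  then have S[measurable]: "?S \<in> sets borel" by (simp add: compact_imp_closed)
  have "compact (geodesic_simplex y)"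
    unfolding geodesic_simplex_def by (intro compact_convex_hull finite_imp_compact) simp
  then have T[measurable]: "geodesic_simplex y \<in> sets borel" by (simp add: compact_imp_closed)
  have contg: "continuous_on UNIV g"
    unfolding g_def using linear_continuous_on[OF L[unfolded linear_conv_bounded_linear]] by (intro continuous_intros)
  then have g[measurable]: "g \<in> borel_measurable borel" by (rule borel_measurable_continuous_onI)
  define f where "f z = ennreal (1 / (1 - x \<bullet> z) ^ ?n)" for z
  have f[measurable]: "f \<in> borel_measurable borel" unfolding f_def by measurable
  have "inj g"
    using \<Delta> detL det_nz_iff_inj[OF L] by (auto simp: g_def inj_def)
  moreover have "(g has_derivative L) (at t within ?S)" for t
    unfolding g_def using linear_imp_has_derivative[OF L] by (auto intro!: derivative_eq_intros)
  ultimately have "(\<integral>\<^sup>+z. f z * indicator (g ` ?S) z \<partial>lborel) =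
      (\<integral>\<^sup>+t. ennreal \<bar>det (matrix L)\<bar> * f (g t) * indicator ?S t \<partial>lborel)"
    by (intro nn_integral_change_of_variables) (auto simp: gS intro: inj_on_subset)
  also have "\<dots> = ennreal \<bar>?\<Delta>\<bar> * (\<integral>\<^sup>+t. f (g t) * indicator ?S t \<partial>lborel)"
    unfolding detL mult.assoc by (rule nn_integral_cmult) measurable
  finally have 1: "(\<integral>\<^sup>+z. f z * indicator (geodesic_simplex y) z \<partial>lborel) =
      ennreal \<bar>?\<Delta>\<bar> * (\<integral>\<^sup>+t. f (g t) * indicator ?S t \<partial>lborel)"
    by (simp add: gS)
  define A :: "real^'n::_" where "A = (\<chi> i. 1 - x \<bullet> y (?c i))"
  have Ab: "A \<bullet> axis i 1 = 1 - x \<bullet> y (?c i)" for i by (simp add: A_def inner_axis)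
  have l: "1 - x \<bullet> g t = (1 - x \<bullet> y 0) + (\<Sum>b\<in>Basis. (t \<bullet> b) * (A \<bullet> b - (1 - x \<bullet> y 0)))" for t
  proof -
    have "(\<Sum>b\<in>Basis. (t \<bullet> b) * (A \<bullet> b - (1 - x \<bullet> y 0))) = (\<Sum>i\<in>UNIV. t $ i * (x \<bullet> y 0 - x \<bullet> y (?c i)))"
      by (subst sum.reindex_bij_betw[OF bij_betw_axis_Basis, symmetric]) (simp add: A_def inner_axis)
    also have "\<dots> = - (x \<bullet> L t)"
      by (simp add: L_def d_def inner_sum_right inner_diff_right sum_negf[symmetric] algebra_simps)
    finally show ?thesis by (simp add: g_def inner_add_right)
  qed
  have "ennreal (fact (?n - 1)) * (\<integral>\<^sup>+t. indicator ?S t * ennreal (1 / (1 - x \<bullet> g t) ^ ?n) \<partial>lborel) =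
      (\<integral>\<^sup>+u. ennreal (1 / ((1 - x \<bullet> y 0 + u) * (\<Prod>b\<in>Basis. A \<bullet> b + u))) * indicator {0<..} u \<partial>lborel)"
  proof -
    have "0 < A \<bullet> b" if b: "b \<in> Basis" for b
    proof -
      obtain i where "b = axis i 1" using b bij_betw_axis_Basis[where 'n='n] by (auto simp: bij_betw_def)
      then show ?thesis using a c by (simp add: Ab)
    qed
    from nn_integral_std_simplex_power[OF a[of 0] this] show ?thesis unfolding l by simp
  qed
  also have "(\<lambda>u. (1 - x \<bullet> y 0 + u) * (\<Prod>b\<in>Basis. A \<bullet> b + u)) = (\<lambda>u. \<Prod>k\<le>?n. 1 - x \<bullet> y k + u)"
  proof
    fix u
    have "(\<Prod>b\<in>Basis. A \<bullet> b + u) = (\<Prod>i\<in>UNIV. 1 - x \<bullet> y (?c i) + u)"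
      by (subst prod.reindex_bij_betw[OF bij_betw_axis_Basis, symmetric]) (simp add: Ab)
    then show "(1 - x \<bullet> y 0 + u) * (\<Prod>b\<in>Basis. A \<bullet> b + u) = (\<Prod>k\<le>?n. 1 - x \<bullet> y k + u)"
      by (simp add: prod_atMost_coord_pos)
  qed
  finally have 2: "ennreal (fact (?n - 1)) * (\<integral>\<^sup>+t. indicator ?S t * f (g t) \<partial>lborel) =
      (\<integral>\<^sup>+u. ennreal (1 / (\<Prod>k\<le>?n. 1 - x \<bullet> y k + u)) * indicator {0<..} u \<partial>lborel)"
    unfolding f_def .
  show ?thesis using 1 unfolding 2[symmetric] f_def by (simp add: mult_ac)
qed

section \<open>Logarithmic differentials on a frame\<close>

lemma sphere_frame_frame:
  fixes x :: "real^'n::{finite,wellorder}"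
  assumes "2 \<le> CARD('n)" "norm x = 1"
  shows "sphere_frame x (frame x)"
  unfolding frame_def by (rule someI_ex[OF sphere_frame_exists[OF assms]])

text \<open>Every derivative of \<open>f\<close> within the sphere agrees with \<open>f'\<close> along the great circle through \<open>x\<close>
  in the direction \<open>v\<close>.\<close>

lemma sphere_d_tangent:
  fixes f :: "real^'n \<Rightarrow> real"
  assumes f: "(f has_derivative f') (at x)" and x: "norm x = 1" and v: "norm v = 1" "x \<bullet> v = 0"
  shows "sphere_d f x v = f' v"
proof -
  let ?S = "sphere 0 1 :: (real^'n) set" and ?D = "sphere_d f x"
  have fS: "(f has_derivative f') (at x within ?S)" using f by (rule has_derivative_at_withinI)
  have D: "(f has_derivative ?D) (at x within ?S)"
    unfolding sphere_d_def frechet_derivative_def 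
    by (rule someI[where P = "\<lambda>D. (f has_derivative D) (at x within ?S)", OF fS])
  define c where "c t = cos t *\<^sub>R x + sin t *\<^sub>R v" for t
  have c: "(c has_derivative (\<lambda>t. t *\<^sub>R v)) (at 0)"
    unfolding c_def by (auto intro!: derivative_eq_intros)
  have "x \<bullet> x = 1" "v \<bullet> v = 1" "v \<bullet> x = 0"
    using x v by (simp_all add: norm_eq_sqrt_inner inner_commute)
  then have "c t \<bullet> c t = 1" for t
    using v sin_cos_squared_add[of t] by (simp add: c_def inner_add_left inner_add_right power2_eq_square)
  then have cS: "range c \<subseteq> ?S" by (auto simp: norm_eq_sqrt_inner)
  have c0: "c 0 = x" by (simp add: c_def)
  have comp: "((\<lambda>t. f (c t)) has_derivative (\<lambda>t. g (t *\<^sub>R v))) (at 0)"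
    if "(f has_derivative g) (at x within ?S)" for g
    using has_derivative_in_compose[OF c, of f g] has_derivative_subset[OF that cS] by (simp add: c0)
  have "(\<lambda>t::real. ?D (t *\<^sub>R v)) = (\<lambda>t. f' (t *\<^sub>R v))"
    by (rule has_derivative_unique[OF comp[OF D] comp[OF fS]])
  from fun_cong[OF this, of 1] show ?thesis by simp
qed

text \<open>Leibniz's formula over the index set \<open>{1..n}\<close> used by \<open>wedge\<close>:
  conjugation with \<open>coord_pos\<close> is a sign preserving bijection between the permutations
  of the two index sets.\<close>

lemma det_eq_sum_nat_permutations:
  fixes N :: "nat \<Rightarrow> nat \<Rightarrow> real"
  shows "det (\<chi> a b :: 'n::{finite,wellorder}. N (coord_pos a) (coord_pos b)) =
    (\<Sum>p | p permutes {1..CARD('n)}. of_int (sign p) * (\<Prod>i\<in>{1..CARD('n)}. N i (p i)))"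
proof -
  let ?c = "coord_pos :: 'n \<Rightarrow> nat" and ?K = "{1..CARD('n)}"
  have bij: "bij_betw ?c UNIV ?K" by (rule coord_pos_bij)
  have inj: "inj ?c" using bij by (simp add: bij_betw_def)
  let ?m = "map_permutation UNIV ?c"
  have "bij_betw ?m {p. p permutes UNIV} {p. p permutes ?K}"
  proof (rule bij_betw_byWitness[where f' = "map_permutation ?K (inv ?c)"])
    have biji: "bij_betw (inv ?c) ?K UNIV" using bij by (rule bij_betw_inv_into)
    show "\<forall>p\<in>{p. p permutes UNIV}. map_permutation ?K (inv ?c) (?m p) = p"
      using map_permutation_compose_inv[OF bij] inj by simp
    show "\<forall>p\<in>{p. p permutes ?K}. ?m (map_permutation ?K (inv ?c) p) = p"
      using map_permutation_compose_inv[OF biji] bij by (auto simp: bij_betw_def f_inv_into_f)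
    show "?m ` {p. p permutes UNIV} \<subseteq> {p. p permutes ?K}"
      using map_permutation_permutes[OF bij] by blast
    show "map_permutation ?K (inv ?c) ` {p. p permutes ?K} \<subseteq> {p. p permutes UNIV}"
      using map_permutation_permutes[OF biji] by blast
  qed
  then have "(\<Sum>p | p permutes ?K. of_int (sign p) * (\<Prod>i\<in>?K. N i (p i))) =
      (\<Sum>p | p permutes (UNIV :: 'n set). of_int (sign (?m p)) * (\<Prod>i\<in>?K. N i (?m p i)))"
    by (rule sum.reindex_bij_betw[symmetric])
  also have "\<dots> = det (\<chi> a b :: 'n. N (?c a) (?c b))"
    unfolding det_def
  proof (rule sum.cong[OF refl])
    fix p :: "'n \<Rightarrow> 'n" assume "p \<in> {p. p permutes UNIV}"
    then have p: "p permutes UNIV" by simp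
    have "(\<Prod>i\<in>?K. N i (?m p i)) = (\<Prod>a\<in>UNIV. N (?c a) (?m p (?c a)))"
      by (rule prod.reindex_bij_betw[OF bij, symmetric])
    also have "\<dots> = (\<Prod>a\<in>UNIV. N (?c a) (?c (p a)))"
      by (simp add: map_permutation_apply inj)
    finally show "of_int (sign (?m p)) * (\<Prod>i\<in>?K. N i (?m p i)) =
        of_int (sign p) * (\<Prod>i\<in>UNIV. (\<chi> a b :: 'n. N (?c a) (?c b)) $ i $ p i)"
      using sign_map_permutation[OF inj p] by simp
  qed
  finally show ?thesis ..
qed

text \<open>Multiplying the rows of \<open>A(1 := x)\<close> by the transposed frame, which has
  determinant 1, gives the matrix of all inner products. Its first row is (1, 0, ..., 0), so only
  permutations fixing 1 survive in the determinant, and these make up the wedge product.\<close>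

lemma wedge_frame:
  fixes x :: "real^'n::{finite,wellorder}"
  assumes n: "2 \<le> CARD('n)" and fr: "sphere_frame x v"
    and \<alpha>: "\<And>i j. i \<in> {2..CARD('n)} \<Longrightarrow> j \<in> {2..CARD('n)} \<Longrightarrow> \<alpha> i x (v j) = A i \<bullet> v j"
  shows "wedge {2..CARD('n)} \<alpha> x v = det_rows (A(1 := x))"
proof -
  let ?c = "coord_pos :: 'n \<Rightarrow> nat" and ?K = "{1..CARD('n)}" and ?L = "{2..CARD('n)}"
  have K: "?K = insert 1 ?L" using n by auto
  have v: "v 1 = x" "\<And>i j. i \<in> ?K \<Longrightarrow> j \<in> ?K \<Longrightarrow> v i \<bullet> v j = (if i = j then 1 else 0)" "det_rows v = 1"
    using fr by (auto simp: sphere_frame_def)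
  define N where "N i j = (A(1 := x)) i \<bullet> v j" for i j
  have N1: "N 1 j = (if j = 1 then 1 else 0)" if "j \<in> ?K" for j
    using v(2)[of 1 j] that n by (simp add: N_def v(1)[symmetric])
  let ?M = "(\<chi> a. (A(1 := x)) (coord_pos a)) :: real^'n::_^'n::_" and ?V = "(\<chi> a. v (coord_pos a)) :: real^'n::_^'n::_"
  have "?M ** transpose ?V = (\<chi> a b. N (?c a) (?c b))"
    by (simp add: vec_eq_iff matrix_matrix_mult_def transpose_def N_def inner_vec_def)
  then have "det (\<chi> a b :: 'n. N (?c a) (?c b)) = det ?M * det ?V"
    by (metis det_mul det_transpose)
  then have "det_rows (A(1 := x)) = det (\<chi> a b :: 'n. N (?c a) (?c b))"
    using v(3) by (simp add: det_rows_def)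
  also have "\<dots> = (\<Sum>p | p permutes ?K. of_int (sign p) * (\<Prod>i\<in>?K. N i (p i)))"
    by (rule det_eq_sum_nat_permutations)
  also have "\<dots> = (\<Sum>p | p permutes ?L. of_int (sign p) * (\<Prod>i\<in>?K. N i (p i)))"
  proof (rule sum.mono_neutral_right)
    show "{p. p permutes ?L} \<subseteq> {p. p permutes ?K}"
      using permutes_subset[of _ ?L ?K] K by auto
    show "\<forall>p\<in>{p. p permutes ?K} - {p. p permutes ?L}. of_int (sign p) * (\<Prod>i\<in>?K. N i (p i)) = 0"
    proof
      fix p assume p: "p \<in> {p. p permutes ?K} - {p. p permutes ?L}"
      have "p 1 \<noteq> 1"
      proof
        assume "p 1 = 1"
        then have "p permutes ?L"
        proof (intro permutes_superset[of p ?K ?L])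
          fix z assume "z \<in> ?K - ?L"
          then have "z = 1" by auto
          then show "p z = z" using \<open>p 1 = 1\<close> by simp
        qed (use p in blast)
        then show False using p by simp
      qed
      moreover have "p 1 \<in> ?K" using p K permutes_in_image[of p ?K 1] by auto
      ultimately have "N 1 (p 1) = 0" using N1 by simp
      then have "(\<Prod>i\<in>?K. N i (p i)) = 0" using K by (intro prod_zero) auto
      then show "of_int (sign p) * (\<Prod>i\<in>?K. N i (p i)) = 0" by simp
    qed
  qed (rule finite_permutations, simp)
  also have "\<dots> = wedge ?L \<alpha> x v"
    unfolding wedge_def
  proof (rule sum.cong[OF refl])
    fix p assume "p \<in> {p. p permutes ?L}"
    then have p: "p permutes ?L" by simp
    have "p 1 = 1" using permutes_not_in[OF p] by simp
    then have "N 1 (p 1) = 1" using N1[of 1] n by simp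
    moreover have "(\<Prod>i\<in>?L. N i (p i)) = (\<Prod>i\<in>?L. \<alpha> i x (v (p i)))"
      using permutes_in_image[OF p] by (intro prod.cong) (auto simp: N_def \<alpha>)
    moreover have "(\<Prod>i\<in>?K. N i (p i)) = N 1 (p 1) * (\<Prod>i\<in>?L. N i (p i))"
      unfolding K by (rule prod.insert) auto
    ultimately show "of_int (sign p) * (\<Prod>i\<in>?K. N i (p i)) = of_int (sign p) * (\<Prod>i\<in>?L. \<alpha> i x (v (p i)))"
      by simp
  qed
  finally show ?thesis ..
qed

lemma det_rows_linear_image:
  fixes f :: "real^'n::{finite,wellorder} \<Rightarrow> real^'n::_"
  assumes "linear f"
  shows "det_rows (\<lambda>i. f (v i)) = det (matrix f) * det_rows v"
proof -
  have "f w $ b = (\<Sum>j\<in>UNIV. w $ j * matrix f $ b $ j)" for w b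
  proof -
    have "matrix f *v w = f w" using assms by (simp add: matrix_works)
    then have "f w $ b = (matrix f *v w) $ b" by simp
    then show ?thesis by (simp add: matrix_vector_mult_def mult.commute)
  qed
  then have "(\<chi> i :: 'n. f (v (coord_pos i))) = (\<chi> i. v (coord_pos i)) ** transpose (matrix f)"
    by (simp add: vec_eq_iff matrix_matrix_mult_def transpose_def)
  then show ?thesis by (simp add: det_rows_def det_mul det_transpose)
qed

lemma det_rows_scale:
  fixes v :: "nat \<Rightarrow> real^'n::{finite,wellorder}"
  shows "det_rows (\<lambda>i. c i *\<^sub>R v i) = (\<Prod>i\<in>{1..CARD('n)}. c i) * det_rows v"
proof -
  have "det_rows (\<lambda>i. c i *\<^sub>R v i) = (\<Prod>a\<in>UNIV. c (coord_pos (a :: 'n))) * det_rows v"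
    unfolding det_rows_def by (subst det_rows_mul[symmetric]) (simp add: scalar_mult_eq_scaleR)
  also have "(\<Prod>a\<in>UNIV. c (coord_pos (a :: 'n))) = (\<Prod>i\<in>{1..CARD('n)}. c i)"
    by (rule prod.reindex_bij_betw[OF coord_pos_bij])
  finally show ?thesis .
qed

text \<open>The rank one perturbation \<open>h \<mapsto> h + (x \<bullet> h) y\<^sub>0 / a\<^sub>0\<close> of the identity, where \<open>a\<^sub>0 = 1 - x \<bullet> y\<^sub>0\<close>,
  has determinant \<open>1 / a\<^sub>0\<close>; it maps \<open>x - y\<^sub>0\<close> to \<open>x\<close> and \<open>z - y\<^sub>0\<close> to \<open>z - (1 - x \<bullet> z) y\<^sub>0 / a\<^sub>0\<close>.\<close>

lemma det_rows_log_differentials: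
  fixes x :: "real^'n::{finite,wellorder}"
  assumes n: "2 \<le> CARD('n)" and x: "norm x = 1" and a: "\<And>i. i \<le> CARD('n) \<Longrightarrow> 1 - x \<bullet> y i \<noteq> 0"
  shows "det_rows ((\<lambda>i. m *\<^sub>R (y i /\<^sub>R (1 - x \<bullet> y i) - y 0 /\<^sub>R (1 - x \<bullet> y 0)))(1 := x)) =
    m ^ (CARD('n) - 1) * det_rows ((\<lambda>i. y i - y 0)(1 := x - y 0)) / (\<Prod>k\<in>{..CARD('n)} - {1}. 1 - x \<bullet> y k)"
proof -
  define a where "a k = 1 - x \<bullet> y k" for k
  have a0: "a i \<noteq> 0" if "i \<le> CARD('n)" for i using assms(3)[OF that] by (simp add: a_def)
  define f where "f h = h + (x \<bullet> h) *\<^sub>R (y 0 /\<^sub>R a 0)" for h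
  have f: "linear f" unfolding f_def by (intro linearI) (auto simp: algebra_simps inner_add_right)
  have df: "det (matrix f) = 1 / a 0"
  proof -
    have "det (matrix f) = 1 + x \<bullet> (y 0 /\<^sub>R a 0)" unfolding f_def by (rule det_identity_plus_rank_one)
    also have "\<dots> = 1 / a 0" using a0[of 0] by (simp add: a_def field_simps)
    finally show ?thesis .
  qed
  have xx: "x \<bullet> x = 1" using x by (simp add: norm_eq_sqrt_inner)
  have fx: "f (x - y 0) = x"
  proof -
    have "x \<bullet> (x - y 0) = a 0" by (simp add: inner_diff_right xx a_def)
    then show ?thesis using a0[of 0] by (simp add: f_def)
  qed
  have fy: "y i /\<^sub>R a i - y 0 /\<^sub>R a 0 = f (y i - y 0) /\<^sub>R a i" if "a i \<noteq> 0" for i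
  proof -
    have "x \<bullet> (y i - y 0) = a 0 - a i" by (simp add: inner_diff_right a_def)
    moreover have "y 0 = (a 0 * inverse (a 0)) *\<^sub>R y 0" using a0[of 0] by simp
    ultimately have "f (y i - y 0) = y i - (a i * inverse (a 0)) *\<^sub>R y 0"
      by (simp add: f_def left_diff_distrib scaleR_left_diff_distrib)
    then show ?thesis using that by (simp add: scaleR_diff_right)
  qed
  \<comment> \<open>Row 1 is \<open>x = f (x - y 0)\<close> without a denominator, so
    \<open>a 1\<close> is missing from the product, whereas \<open>a 0\<close> enters through the
    determinant of \<open>f\<close>.\<close>
  define c where "c i = (if i = 1 then 1 else m / a i)" for i :: nat
  define w where "w = (\<lambda>i. y i - y 0)(1 := x - y 0)"
  have "det_rows ((\<lambda>i. m *\<^sub>R (y i /\<^sub>R a i - y 0 /\<^sub>R a 0))(1 := x)) = det_rows (\<lambda>i. c i *\<^sub>R f (w i))"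
    unfolding det_rows_def
  proof (rule arg_cong[of _ _ det], intro vec_eq_iff[THEN iffD2] allI)
    fix k b :: 'n
    have "coord_pos k \<in> {1..CARD('n)}" using coord_pos_bij[where 'n='n] by (auto simp: bij_betw_def)
    then have "((\<lambda>i. m *\<^sub>R (y i /\<^sub>R a i - y 0 /\<^sub>R a 0))(1 := x)) (coord_pos k) = c (coord_pos k) *\<^sub>R f (w (coord_pos k))"
      using fx fy[of "coord_pos k"] a0[of "coord_pos k"]
      by (auto simp: c_def w_def divide_inverse)
    then show "(\<chi> i. ((\<lambda>i. m *\<^sub>R (y i /\<^sub>R a i - y 0 /\<^sub>R a 0))(1 := x)) (coord_pos i)) $ k $ b =
        (\<chi> i. c (coord_pos i) *\<^sub>R f (w (coord_pos i))) $ k $ b"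
      by simp
  qed
  also have "\<dots> = (\<Prod>i\<in>{1..CARD('n)}. c i) * (1 / a 0 * det_rows w)"
    by (simp add: det_rows_scale det_rows_linear_image[OF f] df)
  also have "(\<Prod>i\<in>{1..CARD('n)}. c i) = m ^ (CARD('n) - 1) / (\<Prod>i\<in>{2..CARD('n)}. a i)"
  proof -
    have K: "{1..CARD('n)} = insert 1 {2..CARD('n)}" using n by auto
    have "(\<Prod>i\<in>{1..CARD('n)}. c i) = c 1 * (\<Prod>i\<in>{2..CARD('n)}. c i)"
      unfolding K by (rule prod.insert) auto
    also have "(\<Prod>i\<in>{2..CARD('n)}. c i) = (\<Prod>i\<in>{2..CARD('n)}. m / a i)"
      by (rule prod.cong) (auto simp: c_def)
    finally show ?thesis by (simp add: c_def prod_dividef)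
  qed
  also have "m ^ (CARD('n) - 1) / (\<Prod>i\<in>{2..CARD('n)}. a i) * (1 / a 0 * det_rows w) =
      m ^ (CARD('n) - 1) * det_rows w / (\<Prod>k\<in>{..CARD('n)} - {1}. a k)"
  proof -
    have "{..CARD('n)} - {1} = insert 0 {2..CARD('n)}" by auto
    then have "(\<Prod>k\<in>{..CARD('n)} - {1}. a k) = a 0 * (\<Prod>i\<in>{2..CARD('n)}. a i)" by simp
    then show ?thesis by simp
  qed
  finally show ?thesis unfolding a_def w_def .
qed

section \<open>Powers of \<open>1 - x \<bullet> z\<close> on the sphere\<close>

lemma nn_integral_sphere_axial:
  fixes z :: "real^'n::{finite,wellorder}" and k :: 'n
  assumes z: "norm z = 1" and F[measurable]: "F \<in> borel_measurable borel"
  shows "(\<integral>\<^sup>+x. F (1 - x \<bullet> z) \<partial>sphere_measure) =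
    of_nat CARD('n) * (\<integral>\<^sup>+t. indicator (cball 0 1) t * F (1 - t $ k / norm t) \<partial>lborel)"
proof -
  obtain A :: "real^'n::_^'n::_" where A: "orthogonal_matrix A" "A *v axis k 1 = z"
    using orthogonal_matrix_exists_basis[OF z] by metis
  define g where "g = (*v) A"
  have orth: "orthogonal_transformation g"
    using A(1) by (simp add: g_def orthogonal_transformation_matrix)
  have lin: "linear g" by (simp add: g_def)
  have detA: "\<bar>det (matrix g)\<bar> = 1"
    using det_orthogonal_matrix[OF A(1)] by (auto simp: g_def)
  have surj: "range g = UNIV" using orthogonal_transformation_surj[OF orth] .
  have inj: "inj g" using orthogonal_transformation_inj[OF orth] .
  have cont: "continuous_on UNIV g" by (simp add: g_def matrix_vector_mult_linear_continuous_on)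
  then have gm[measurable]: "g \<in> borel_measurable borel" by (rule borel_measurable_continuous_onI)
  define f where "f y = indicator (cball 0 1) y * F (1 - (y /\<^sub>R norm y) \<bullet> z)" for y
  have i[measurable]: "indicator (cball 0 1) \<in> borel_measurable (borel :: (real^'n::_) measure)"
    by (intro borel_measurable_indicator) simp
  have f[measurable]: "f \<in> borel_measurable borel" unfolding f_def by measurable
  have "(\<integral>\<^sup>+y. f y \<partial>lborel) = (\<integral>\<^sup>+y. f y * indicator (g ` UNIV) y \<partial>lborel)"
    by (simp add: surj)
  also have "\<dots> = (\<integral>\<^sup>+t. ennreal \<bar>det (matrix g)\<bar> * f (g t) * indicator UNIV t \<partial>lborel)"
    by (rule nn_integral_change_of_variables)
      (use lin inj in \<open>auto simp: surj linear_imp_has_derivative\<close>)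
  also have "\<dots> = (\<integral>\<^sup>+t. indicator (cball 0 1) t * F (1 - t $ k / norm t) \<partial>lborel)"
  proof (rule nn_integral_cong)
    fix t
    have "norm (g t) = norm t" by (rule orthogonal_transformation_norm[OF orth])
    moreover have "g t \<bullet> z = t $ k"
      using orth A(2) by (simp add: orthogonal_transformation_def g_def inner_axis flip: A(2))
    ultimately show "ennreal \<bar>det (matrix g)\<bar> * f (g t) * indicator UNIV t = indicator (cball 0 1) t * F (1 - t $ k / norm t)"
      by (simp add: detA f_def indicator_def divide_inverse mult.commute)
  qed
  finally have "(\<integral>\<^sup>+y. f y \<partial>lborel) = (\<integral>\<^sup>+t. indicator (cball 0 1) t * F (1 - t $ k / norm t) \<partial>lborel)" .
  then show ?thesis by (subst nn_integral_sphere) (simp_all add: f_def)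
qed

text \<open>The ray over a point lies in the hyperplane orthogonal to any \<open>b\<close>
  orthogonal to \<open>z\<close>; a nonzero such \<open>b\<close> exists in dimension at least
  2.\<close>

lemma AE_sphere_neq:
  fixes z :: "real^'n"
  assumes n: "2 \<le> CARD('n)"
  shows "AE x in sphere_measure. x \<noteq> z"
proof -
  obtain b where b: "b \<noteq> 0" "orthogonal z b"
    using orthogonal_to_vector_exists[of z] n by auto
  have "negligible {y. b \<bullet> y = 0}" by (rule negligible_hyperplane) (use b in simp)
  then have "AE y in lebesgue. y \<notin> {y. b \<bullet> y = 0}"
    by (intro AE_not_in) (simp add: negligible_iff_null_sets)
  then have "AE y in lborel. b \<bullet> y \<noteq> 0" by (simp add: AE_completion_iff)
  then have "AE y in lborel. indicator (cball 0 1) y * (indicator {z} (y /\<^sub>R norm y) :: ennreal) = 0"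
  proof eventually_elim
    fix y assume y: "b \<bullet> y \<noteq> 0"
    have "y /\<^sub>R norm y \<noteq> z"
    proof
      assume "y /\<^sub>R norm y = z"
      then have "b \<bullet> (y /\<^sub>R norm y) = 0" using b by (simp add: orthogonal_def inner_commute)
      then show False using y by auto
    qed
    then show "indicator (cball 0 1) y * (indicator {z} (y /\<^sub>R norm y) :: ennreal) = 0" by simp
  qed
  then have "(\<integral>\<^sup>+y. indicator (cball 0 1) y * indicator {z} (y /\<^sub>R norm y) \<partial>lborel) = (\<integral>\<^sup>+y. 0 \<partial>(lborel :: (real^'n) measure))"
    by (rule nn_integral_cong_AE)
  then have "(\<integral>\<^sup>+x. indicator {z} x \<partial>sphere_measure) = 0"
    by (subst nn_integral_sphere) simp_all
  then have "{z} \<in> null_sets sphere_measure" by (simp add: null_sets_def)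
  from AE_not_in[OF this] show ?thesis by simp
qed

section \<open>The function \<open>ell\<close> and the integrability of its powers\<close>

text \<open>Minus the Lorentz product of \<open>(x, 1)\<close> and \<open>(z, 1)\<close>, as a
  function on the sphere attached to the point \<open>z\<close>.\<close>

definition ell :: "real^'n \<Rightarrow> real^'n \<Rightarrow> real" where
  "ell z x = 1 - x \<bullet> z"

lemma borel_measurable_ell [measurable]: "ell z \<in> borel_measurable borel"
  unfolding ell_def[abs_def] by measurable

text \<open>On the sphere twice \<open>ell z x\<close> equals
  \<open>|x - z|^2 + (1 - |z|^2)\<close>. Hence \<open>ell z\<close> vanishes on the sphere only at
  an ideal point \<open>z\<close> itself, and there to second order.\<close>

lemma ell_ge_norm_diff:
  assumes "norm x = 1" "norm z \<le> 1"
  shows "(norm (x - z))\<^sup>2 / 2 \<le> ell z x"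
proof -
  have "(norm (x - z))\<^sup>2 = 1 - 2 * (x \<bullet> z) + (norm z)\<^sup>2"
  proof -
    have "x \<bullet> x = 1" using assms(1) by (simp add: norm_eq_sqrt_inner)
    then show ?thesis by (simp add: power2_norm_eq_inner inner_diff_left inner_diff_right inner_commute)
  qed
  moreover have "(norm z)\<^sup>2 \<le> 1" using assms(2) by (simp add: power_le_one)
  ultimately show ?thesis by (simp add: ell_def)
qed

lemma ell_eq_norm_diff:
  assumes "norm x = 1" "norm z = 1"
  shows "ell z x = (norm (x - z))\<^sup>2 / 2"
proof -
  have "(norm (x - z))\<^sup>2 = 1 - 2 * (x \<bullet> z) + (norm z)\<^sup>2"
  proof -
    have "x \<bullet> x = 1" using assms(1) by (simp add: norm_eq_sqrt_inner)
    then show ?thesis by (simp add: power2_norm_eq_inner inner_diff_left inner_diff_right inner_commute)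
  qed
  then show ?thesis using assms by (simp add: ell_def)
qed

lemma ell_le_2: "norm x = 1 \<Longrightarrow> norm z \<le> 1 \<Longrightarrow> ell z x \<le> 2"
  using Cauchy_Schwarz_ineq2[of x z] by (auto simp: ell_def abs_le_iff)

lemma ell_ge_interior: "norm x = 1 \<Longrightarrow> 1 - norm z \<le> ell z x"
  using Cauchy_Schwarz_ineq2[of x z] by (auto simp: ell_def abs_le_iff)

lemma ell_pos:
  assumes "norm x = 1" "norm z \<le> 1" "x \<noteq> z"
  shows "0 < ell z x"
proof -
  have "0 < (norm (x - z))\<^sup>2 / 2" using assms by simp
  then show ?thesis using ell_ge_norm_diff[OF assms(1,2)] by linarith
qed

lemma AE_ell_pos:
  fixes z :: "real^'n"
  assumes "2 \<le> CARD('n)" "norm z \<le> 1"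
  shows "AE x in sphere_measure. 0 < ell z x"
  using AE_sphere AE_sphere_neq[OF assms(1), of z] by eventually_elim (rule ell_pos[OF _ assms(2)])

lemma nn_integral_powr_near_0:
  fixes s :: real
  assumes s: "s < 1"
  shows "(\<integral>\<^sup>+t. ennreal (\<bar>t\<bar> powr - s) * indicator {-1..1} t \<partial>lborel) < \<infinity>"
proof -
  let ?f = "\<lambda>t. ennreal (\<bar>t\<bar> powr - s) * indicator {0..1} t"
  have "(\<integral>\<^sup>+t. ?f t \<partial>lborel) = (\<integral>\<^sup>+t. ennreal (t powr - s) * indicator {0..1} t \<partial>lborel)"
    by (intro nn_integral_cong) (auto simp: indicator_def)
  also have "\<dots> = ennreal (1 powr (- s + 1) / (- s + 1))"
    by (intro nn_integral_has_integral_lebesgue' has_integral_powr_from_0) (use s in auto)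
  finally have 1: "(\<integral>\<^sup>+t. ?f t \<partial>lborel) < \<infinity>" by simp
  have "(\<integral>\<^sup>+t. ?f t \<partial>lborel) = ennreal \<bar>- 1\<bar> * (\<integral>\<^sup>+t. ?f (0 + (- 1) * t) \<partial>lborel)"
    by (rule nn_integral_real_affine) auto
  then have 2: "(\<integral>\<^sup>+t. ?f (- t) \<partial>lborel) < \<infinity>" using 1 by simp
  have "(\<integral>\<^sup>+t. ennreal (\<bar>t\<bar> powr - s) * indicator {-1..1} t \<partial>lborel) \<le> (\<integral>\<^sup>+t. ?f t + ?f (- t) \<partial>lborel)"
    by (intro nn_integral_mono) (auto simp: indicator_def)
  also have "\<dots> = (\<integral>\<^sup>+t. ?f t \<partial>lborel) + (\<integral>\<^sup>+t. ?f (- t) \<partial>lborel)"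
    by (rule nn_integral_add) measurable
  also have "\<dots> < \<infinity>" using 1 2 by simp
  finally show ?thesis .
qed

text \<open>In coordinates with first axis \<open>z\<close>, the function \<open>ell z\<close> is at least half the square of each of
  the other \<open>n - 1\<close> coordinates, so its power \<open>- \<gamma>\<close> is dominated by a product of integrable functions
  of one variable.\<close>

lemma nn_integral_ell_powr:
  fixes z :: "real^'n::{finite,wellorder}"
  assumes n: "2 \<le> CARD('n)" and z: "norm z \<le> 1" and \<gamma>: "0 < \<gamma>" "2 * \<gamma> < real CARD('n) - 1"
  shows "(\<integral>\<^sup>+x. ennreal (ell z x powr - \<gamma>) \<partial>sphere_measure) < \<infinity>"
proof (cases "norm z < 1")
  case True
  have "(\<integral>\<^sup>+x. ennreal (ell z x powr - \<gamma>) \<partial>sphere_measure) \<le>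
      (\<integral>\<^sup>+x. ennreal ((1 - norm z) powr - \<gamma>) \<partial>(sphere_measure :: (real^'n::_) measure))"
  proof (rule nn_integral_mono_AE, use AE_sphere in eventually_elim)
    fix x :: "real^'n::_" assume "norm x = 1"
    then show "ennreal (ell z x powr - \<gamma>) \<le> ennreal ((1 - norm z) powr - \<gamma>)"
      using ell_ge_interior[of x z] True \<gamma> by (intro ennreal_leI powr_mono2') auto
  qed
  also have "\<dots> < \<infinity>"
    by (simp add: emeasure_sphere_measure_UNIV ennreal_mult_less_top)
  finally show ?thesis .
next
  case False
  then have z1: "norm z = 1" using z by simp
  let ?k = "undefined :: 'n"
  define m where "m = CARD('n) - 1"
  have m: "0 < m" "real m = real CARD('n) - 1" using n by (auto simp: m_def)
  \<comment> \<open>The exponent \<gamma> is shared equally among the \<open>n - 1\<close>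
    transverse coordinates. Each of them carries the power \<open>- 2 s\<close>, integrable near 0
    exactly because \<open>2 \<gamma> < n - 1\<close>.\<close>
  define s where "s = \<gamma> / m"
  have s: "0 < s" "2 * s < 1" using \<gamma> m by (auto simp: s_def field_simps)
  define h where "h b t = (if b = axis ?k 1 then indicator {-1..1} t
    else ennreal (2 powr s) * (ennreal (\<bar>t\<bar> powr - (2 * s)) * indicator {-1..1} t))" for b :: "real^'n::_" and t
  have [measurable]: "h b \<in> borel_measurable borel" for b
    unfolding h_def by (cases "b = axis ?k 1") auto
  have ax: "bij_betw (\<lambda>i. axis i 1 :: real^'n::_) UNIV Basis"
    by (auto simp: bij_betw_def inj_def axis_eq_axis Basis_vec_def)
  have "(\<integral>\<^sup>+x. ennreal (ell z x powr - \<gamma>) \<partial>sphere_measure) =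
      of_nat CARD('n) * (\<integral>\<^sup>+t. indicator (cball 0 1) t * ennreal ((1 - t $ ?k / norm t) powr - \<gamma>) \<partial>lborel)"
    unfolding ell_def by (rule nn_integral_sphere_axial[OF z1]) measurable
  also have "(\<integral>\<^sup>+t. indicator (cball 0 1) t * ennreal ((1 - t $ ?k / norm t) powr - \<gamma>) \<partial>lborel) \<le>
      (\<integral>\<^sup>+t. (\<Prod>b\<in>Basis. h b (t \<bullet> b)) \<partial>(lborel :: (real^'n::_) measure))"
  proof (rule nn_integral_mono_AE)
    have "AE t in lborel. (t :: real^'n::_) $ i \<noteq> 0" for i :: 'n
    proof -
      have "negligible {t :: real^'n::_. axis i 1 \<bullet> t = 0}"
        by (rule negligible_hyperplane) (simp add: axis_eq_0_iff)
      then have "AE t in lebesgue. t \<notin> {t :: real^'n::_. axis i 1 \<bullet> t = 0}"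
        by (intro AE_not_in) (simp add: negligible_iff_null_sets)
      then show ?thesis by (simp add: AE_completion_iff inner_axis')
    qed
    then have "AE t in lborel. \<forall>i\<in>(UNIV :: 'n set). (t :: real^'n::_) $ i \<noteq> 0"
      by (subst AE_finite_all) auto
    then show "AE t in lborel. indicator (cball 0 1) t * ennreal ((1 - t $ ?k / norm t) powr - \<gamma>) \<le> (\<Prod>b\<in>Basis. h b (t \<bullet> b))"
    proof eventually_elim
      fix t :: "real^'n::_" assume t0: "\<forall>i\<in>UNIV. t $ i \<noteq> 0"
      show "indicator (cball 0 1) t * ennreal ((1 - t $ ?k / norm t) powr - \<gamma>) \<le> (\<Prod>b\<in>Basis. h b (t \<bullet> b))"
      proof (cases "norm t \<le> 1")
        case True
        have tn: "0 < norm t" using t0 by (metis UNIV_I zero_index zero_less_norm_iff)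
        have t1: "t $ i \<in> {-1..1}" for i using component_le_norm_cart[of t i] True by (auto simp: abs_le_iff)
        define M where "M = 1 - t $ ?k / norm t"
        have M: "(t $ i)\<^sup>2 / 2 \<le> M" if i: "i \<noteq> ?k" for i
        proof -
          have "(norm t)\<^sup>2 = (\<Sum>j\<in>UNIV. (t $ j)\<^sup>2)"
            unfolding power2_norm_eq_inner by (simp add: inner_vec_def power2_eq_square)
          also have "\<dots> \<ge> (\<Sum>j\<in>{?k, i}. (t $ j)\<^sup>2)" by (rule sum_mono2) auto
          finally have "(t $ ?k)\<^sup>2 + (t $ i)\<^sup>2 \<le> (norm t)\<^sup>2" using i by simp
          then have *: "(t $ i)\<^sup>2 \<le> (norm t - t $ ?k) * (norm t + t $ ?k)"
            by (simp add: power2_eq_square algebra_simps)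
          have k: "\<bar>t $ ?k\<bar> \<le> norm t" by (rule component_le_norm_cart)
          have "(norm t - t $ ?k) * (norm t + t $ ?k) \<le> (norm t - t $ ?k) * (2 * norm t)"
            using k by (intro mult_left_mono) (auto simp: abs_le_iff)
          also have "\<dots> = 2 * (norm t)\<^sup>2 * M" using tn by (simp add: M_def field_simps power2_eq_square)
          also have "\<dots> \<le> 2 * 1 * M"
            using k tn True by (intro mult_right_mono mult_left_mono) (auto simp: M_def abs_le_iff power_le_one)
          finally show ?thesis using * by simp
        qed
        have "0 \<le> M" using component_le_norm_cart[of t ?k] tn by (simp add: M_def abs_le_iff)
        have cm: "card (UNIV - {?k}) = m" by (simp add: m_def card_Diff_singleton)
        have "M powr - \<gamma> = (\<Prod>i\<in>UNIV - {?k}. M powr - s)"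
        proof (cases "M = 0")
          case True
          then show ?thesis using m cm by (simp add: zero_power)
        next
          case False
          have "(M powr - s) ^ m = M powr (- s * m)" by (subst powr_power) (use m False in \<open>auto simp: mult.commute\<close>)
          also have "- s * m = - \<gamma>" using m(1) by (simp add: s_def)
          finally show ?thesis using cm by simp
        qed
        also have "\<dots> \<le> (\<Prod>i\<in>UNIV - {?k}. 2 powr s * \<bar>t $ i\<bar> powr - (2 * s))"
        proof (rule prod_mono)
          fix i assume i: "i \<in> UNIV - {?k}"
          have "M powr - s \<le> ((t $ i)\<^sup>2 / 2) powr - s"
            using M[of i] i t0 s by (intro powr_mono2') auto
          also have "(t $ i)\<^sup>2 = \<bar>t $ i\<bar> powr 2" using t0 by simp
          also have "(\<bar>t $ i\<bar> powr 2 / 2) powr - s = 2 powr s * \<bar>t $ i\<bar> powr - (2 * s)"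
            by (simp add: powr_divide powr_powr powr_minus_divide del: powr_numeral)
          finally show "0 \<le> M powr - s \<and> M powr - s \<le> 2 powr s * \<bar>t $ i\<bar> powr - (2 * s)" by simp
        qed
        finally have "ennreal (M powr - \<gamma>) \<le> ennreal (\<Prod>i\<in>UNIV - {?k}. 2 powr s * \<bar>t $ i\<bar> powr - (2 * s))"
          by (rule ennreal_leI)
        also have "\<dots> = (\<Prod>i\<in>UNIV - {?k}. ennreal (2 powr s * \<bar>t $ i\<bar> powr - (2 * s)))"
          by (rule prod_ennreal[symmetric]) simp
        also have "\<dots> = (\<Prod>i\<in>UNIV - {?k}. h (axis i 1) (t $ i))"
          using t1 by (intro prod.cong) (auto simp: h_def axis_eq_axis ennreal_mult')
        also have "\<dots> = (\<Prod>i\<in>UNIV. h (axis i 1) (t $ i))"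
          using t1 by (subst prod.remove[of UNIV ?k]) (auto simp: h_def)
        also have "\<dots> = (\<Prod>b\<in>Basis. h b (t \<bullet> b))"
          by (subst prod.reindex_bij_betw[OF ax, symmetric]) (simp add: inner_axis)
        finally show ?thesis using True by (simp add: M_def)
      qed simp
    qed
  qed
  also have "(\<integral>\<^sup>+t. (\<Prod>b\<in>Basis. h b (t \<bullet> b)) \<partial>(lborel :: (real^'n::_) measure)) = (\<Prod>b\<in>Basis. \<integral>\<^sup>+t. h b t \<partial>lborel)"
    by (rule nn_integral_lborel_prod) auto
  also have "of_nat CARD('n) * (\<Prod>b\<in>Basis. \<integral>\<^sup>+t. h b t \<partial>lborel) < (\<infinity> :: ennreal)"
  proof -
    have "(\<integral>\<^sup>+t. h b t \<partial>lborel) < \<infinity>" for b :: "real^'n::_"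
    proof (cases "b = axis ?k 1")
      case False
      then have "(\<integral>\<^sup>+t. h b t \<partial>lborel) = ennreal (2 powr s) * (\<integral>\<^sup>+t. ennreal (\<bar>t\<bar> powr - (2 * s)) * indicator {-1..1} t \<partial>lborel)"
        unfolding h_def by (simp add: nn_integral_cmult)
      then show ?thesis using nn_integral_powr_near_0[OF s(2)] by (simp add: ennreal_mult_less_top)
    qed (simp add: h_def)
    moreover have "prod f A < \<infinity>" if "finite A" "\<And>b. f b < \<infinity>" for f :: "real^'n::_ \<Rightarrow> ennreal" and A
      using that by (induction A rule: finite_induct) (auto simp: ennreal_mult_less_top)
    ultimately have "(\<Prod>b\<in>Basis. \<integral>\<^sup>+t. h b t \<partial>lborel) < (\<infinity> :: ennreal)"
      by simp
    then show ?thesis by (simp add: ennreal_mult_less_top less_top of_nat_less_top)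
  qed
  finally show ?thesis by (simp add: mult_left_mono)
qed

section \<open>Regularized integrals over the half-line\<close>

text \<open>Separates the variables at the common singularity a = u = 0: the power of
  \<open>u\<close> is integrable there, and the power -1/4 of \<open>a = ell z x\<close> is of order
  \<open>|x - z| powr (- 1/2)\<close> at an ideal point, still integrable on the circle.\<close>

lemma inverse_add_le_powr:
  fixes a u :: real
  assumes "0 < a" "0 < u"
  shows "1 / (a + u) \<le> a powr (- 1/4) * u powr (- 3/4)"
proof -
  have "a powr (1/4) * u powr (3/4) \<le> (a + u) powr (1/4) * (a + u) powr (3/4)"
    using assms by (intro mult_mono powr_mono2) auto
  also have "\<dots> = a + u" using assms by (simp add: powr_add[symmetric])
  finally have "1 / (a + u) \<le> 1 / (a powr (1/4) * u powr (3/4))"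
    using assms by (intro divide_left_mono) auto
  moreover have "a powr (- 1/4) = 1 / a powr (1/4)" "u powr (- 3/4) = 1 / u powr (3/4)"
    using powr_minus_divide[of a "1/4"] powr_minus_divide[of u "3/4"] by simp_all
  ultimately show ?thesis by simp
qed

text \<open>A common integrable majorant in \<open>u\<close>, of order -3/4 at 0 and -7/4 at
  infinity. The factor \<open>2 / (2 + u)\<close> bounds \<open>a / (a + u)\<close> for
  \<open>a \<le> 2\<close>, and 2 is the maximum of \<open>ell\<close> over the sphere and the
  closed ball.\<close>

definition reg_kernel :: "real \<Rightarrow> real" where
  "reg_kernel u = 2 / (2 + u) * u powr (- 3/4)"

lemma borel_measurable_reg_kernel [measurable]: "reg_kernel \<in> borel_measurable borel"
  unfolding reg_kernel_def[abs_def] by measurable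

lemma reg_kernel_nonneg: "0 < u \<Longrightarrow> 0 \<le> reg_kernel u"
  by (simp add: reg_kernel_def)

lemma reg_kernel_integrable: "set_integrable lborel {0<..} reg_kernel"
proof -
  have "(\<integral>\<^sup>+u. ennreal (reg_kernel u) * indicator {0<..} u \<partial>lborel) \<le>
      (\<integral>\<^sup>+u. ennreal (u powr (- 3/4)) * indicator {0..1} u + 2 * (ennreal (u powr (- 7/4)) * indicator {1..} u) \<partial>lborel)"
  proof (rule nn_integral_mono)
    fix u :: real
    show "ennreal (reg_kernel u) * indicator {0<..} u \<le>
      ennreal (u powr (- 3/4)) * indicator {0..1} u + 2 * (ennreal (u powr (- 7/4)) * indicator {1..} u)"
    proof (cases "0 < u")
      case True
      show ?thesis
      proof (cases "u \<le> 1")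
        case u1: True
        have "reg_kernel u \<le> 1 * u powr (- 3/4)"
          unfolding reg_kernel_def using True by (intro mult_right_mono) auto
        then have "ennreal (reg_kernel u) \<le> ennreal (u powr (- 3/4))" by (simp add: ennreal_leI)
        then show ?thesis using True u1 by (simp add: add_increasing2)
      next
        case False
        have "u powr (- 7/4) = u powr (- 1 + - 3/4)" by simp
        also have "\<dots> = u powr (- 1) * u powr (- 3/4)" by (rule powr_add)
        also have "u powr (- 1) = 1 / u" using True by (simp add: powr_minus divide_inverse)
        finally have e: "u powr (- 7/4) = 1 / u * u powr (- 3/4)" .
        have "reg_kernel u \<le> 2 * (1 / u) * u powr (- 3/4)"
          unfolding reg_kernel_def using True by (intro mult_right_mono) (auto simp: field_simps)
        then have "ennreal (reg_kernel u) \<le> ennreal (2 * u powr (- 7/4))" unfolding e by (simp add: ennreal_leI)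
        also have "\<dots> = 2 * ennreal (u powr (- 7/4))" by (simp add: ennreal_mult')
        finally show ?thesis using False by simp
      qed
    qed simp
  qed
  also have "\<dots> = (\<integral>\<^sup>+u. ennreal (u powr (- 3/4)) * indicator {0..1} u \<partial>lborel) +
      2 * (\<integral>\<^sup>+u. ennreal (u powr (- 7/4)) * indicator {1..} u \<partial>lborel)"
    by (subst nn_integral_add) (auto simp: nn_integral_cmult)
  also have "(\<integral>\<^sup>+u. ennreal (u powr (- 3/4)) * indicator {0..1} u \<partial>lborel) = ennreal (1 powr (- 3/4 + 1) / (- 3/4 + 1))"
    by (intro nn_integral_has_integral_lebesgue' has_integral_powr_from_0) auto
  also have "(\<integral>\<^sup>+u. ennreal (u powr (- 7/4)) * indicator {1..} u \<partial>lborel) = ennreal (- (1 powr (- 7/4 + 1)) / (- 7/4 + 1))"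
    by (intro nn_integral_has_integral_lebesgue' has_integral_powr_to_inf) auto
  finally have fin: "(\<integral>\<^sup>+u. ennreal (reg_kernel u) * indicator {0<..} u \<partial>lborel) < \<infinity>"
    by (rule order.strict_trans1) (simp add: ennreal_mult_less_top)
  have "(\<integral>\<^sup>+u. ennreal (norm (indicator {0<..} u *\<^sub>R reg_kernel u)) \<partial>lborel) =
      (\<integral>\<^sup>+u. ennreal (reg_kernel u) * indicator {0<..} u \<partial>lborel)"
    by (intro nn_integral_cong) (auto simp: indicator_def reg_kernel_nonneg)
  then show ?thesis
    using fin unfolding set_integrable_def by (intro integrableI_bounded) auto
qed

definition reg_const :: real where "reg_const = (LINT u:{0<..}|lborel. reg_kernel u)"

lemma reg_const_nonneg: "0 \<le> reg_const"
  unfolding reg_const_def set_lebesgue_integral_def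
  by (intro integral_nonneg_AE AE_I2) (auto simp: indicator_def reg_kernel_nonneg)

lemma set_integrable_reg_kernel_bound:
  fixes f :: "real \<Rightarrow> real"
  assumes [measurable]: "f \<in> borel_measurable borel" and f: "\<And>u. 0 < u \<Longrightarrow> \<bar>f u\<bar> \<le> c * reg_kernel u"
  shows "set_integrable lborel {0<..} f" "\<bar>LINT u:{0<..}|lborel. f u\<bar> \<le> c * reg_const"
proof -
  have k: "set_integrable lborel {0<..} (\<lambda>u. c * reg_kernel u)"
    using reg_kernel_integrable by (rule set_integrable_mult_right)
  show i: "set_integrable lborel {0<..} f"
  proof (rule set_integrable_bound[OF k])
    show "AE u in lborel. u \<in> {0<..} \<longrightarrow> norm (f u) \<le> norm (c * reg_kernel u)"
    proof (intro AE_I2 impI)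
      fix u :: real assume "u \<in> {0<..}"
      then have "\<bar>f u\<bar> \<le> c * reg_kernel u" using f by simp
      then show "norm (f u) \<le> norm (c * reg_kernel u)" by simp
    qed
  qed (simp add: set_borel_measurable_def)
  have "\<bar>LINT u:{0<..}|lborel. f u\<bar> \<le> (LINT u:{0<..}|lborel. \<bar>f u\<bar>)"
    using set_integral_norm_bound[OF i] by simp
  also have "\<dots> \<le> (LINT u:{0<..}|lborel. c * reg_kernel u)"
    by (rule set_integral_mono) (use i k f in \<open>auto intro: set_integrable_abs\<close>)
  also have "\<dots> = c * reg_const" by (simp add: reg_const_def)
  finally show "\<bar>LINT u:{0<..}|lborel. f u\<bar> \<le> c * reg_const" .
qed

text \<open>Each summand of the expansion of \<open>1 / \<Prod>k\<in>{..n}. a k + u\<close> below is singular at \<open>u = 0\<close>; the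
  subtracted term removes the pole and is compatible with a common rescaling of \<open>a\<close> and \<open>u\<close>.\<close>

definition reg :: "nat set \<Rightarrow> nat \<Rightarrow> (nat \<Rightarrow> real) \<Rightarrow> real \<Rightarrow> real" where
  "reg I r a u = (1 / (\<Prod>k\<in>I. a k + u) - a r / (a r + u) / (\<Prod>k\<in>I. a k)) / u"

definition Reg :: "nat set \<Rightarrow> nat \<Rightarrow> (nat \<Rightarrow> real) \<Rightarrow> real" where
  "Reg I r a = (LINT u:{0<..}|lborel. reg I r a u)"

lemma borel_measurable_reg [measurable]: "reg I r a \<in> borel_measurable borel"
  unfolding reg_def[abs_def] by measurable

text \<open>With \<open>q k = a k / (a k + u)\<close>, up to the product of the
  \<open>1 / a k\<close> the integrand is \<open>q r\<close> times
  \<open>(\<Prod>k\<in>J. q k) - 1\<close> over \<open>u\<close>. Weierstrass' inequality bounds the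
  difference by the sum of the \<open>1 - q k = u / (a k + u)\<close>, which cancels the
  \<open>u\<close> below; the factor \<open>q r\<close> supplies the decay at infinity.\<close>

lemma reg_bound:
  assumes I: "finite I" "r \<in> I" and a: "\<And>k. k \<in> I \<Longrightarrow> 0 < a k \<and> a k \<le> 2" and u: "0 < u"
  shows "\<bar>reg I r a u\<bar> \<le> (\<Prod>k\<in>I. 1 / a k) * (\<Sum>k\<in>I. a k powr (- 1/4)) * reg_kernel u"
proof -
  define q where "q k = a k / (a k + u)" for k
  define J where "J = I - {r}"
  have q: "0 \<le> q k" "q k \<le> 1" "1 - q k = u / (a k + u)" if "k \<in> I" for k
    using a[OF that] u by (auto simp: q_def field_simps)
  have aP: "1 / (\<Prod>k\<in>I. a k + u) = (\<Prod>k\<in>I. 1 / a k) * (\<Prod>k\<in>I. q k)"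
  proof -
    have "(\<Prod>k\<in>I. 1 / a k) * (\<Prod>k\<in>I. q k) = (\<Prod>k\<in>I. 1 / a k * q k)" by (rule prod.distrib[symmetric])
    also have "\<dots> = (\<Prod>k\<in>I. 1 / (a k + u))"
    proof (rule prod.cong)
      fix k assume "k \<in> I"
      then show "1 / a k * q k = 1 / (a k + u)" using a[of k] by (simp add: q_def)
    qed simp
    finally show ?thesis by (simp add: prod_dividef)
  qed
  have "(\<Prod>k\<in>I. q k) = q r * (\<Prod>k\<in>J. q k)" using I by (simp add: J_def prod.remove)
  moreover have "a r / (a r + u) / (\<Prod>k\<in>I. a k) = (\<Prod>k\<in>I. 1 / a k) * q r"
    by (simp add: q_def prod_dividef)
  ultimately have "reg I r a u = (\<Prod>k\<in>I. 1 / a k) * q r * ((\<Prod>k\<in>J. q k) - 1) / u"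
    unfolding reg_def aP by (simp add: algebra_simps diff_divide_distrib)
  moreover have "0 \<le> (\<Prod>k\<in>I. 1 / a k)" using a by (intro prod_nonneg) (auto simp: less_imp_le)
  moreover have "(\<Prod>k\<in>J. q k) \<le> 1" using q by (intro prod_le_1) (auto simp: J_def)
  ultimately have "\<bar>reg I r a u\<bar> = (\<Prod>k\<in>I. 1 / a k) * (q r * ((1 - (\<Prod>k\<in>J. q k)) / u))"
    using q(1)[OF I(2)] u by (simp add: abs_mult)
  also have "\<dots> \<le> (\<Prod>k\<in>I. 1 / a k) * (2 / (2 + u) * ((\<Sum>k\<in>I. a k powr (- 1/4)) * u powr (- 3/4)))"
  proof (intro mult_left_mono mult_mono)
    show "q r \<le> 2 / (2 + u)" using a[OF I(2)] u by (simp add: q_def field_simps)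
    have "1 - (\<Sum>k\<in>J. 1 - q k) \<le> (\<Prod>k\<in>J. 1 - (1 - q k))"
      by (rule Weierstrass_prod_ineq) (use q(1,2) in \<open>auto simp: J_def\<close>)
    then have "1 - (\<Prod>k\<in>J. q k) \<le> (\<Sum>k\<in>J. 1 - q k)" by simp
    also have "\<dots> \<le> (\<Sum>k\<in>I. 1 - q k)"
      using I q(2) by (intro sum_mono2) (auto simp: J_def)
    finally have "(1 - (\<Prod>k\<in>J. q k)) / u \<le> (\<Sum>k\<in>I. 1 - q k) / u"
      using u by (simp add: divide_right_mono)
    also have "\<dots> = (\<Sum>k\<in>I. 1 / (a k + u))"
      using u q(3) by (simp add: sum_divide_distrib)
    also have "\<dots> \<le> (\<Sum>k\<in>I. a k powr (- 1/4) * u powr (- 3/4))"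
      using a u by (intro sum_mono inverse_add_le_powr) auto
    finally show "(1 - (\<Prod>k\<in>J. q k)) / u \<le> (\<Sum>k\<in>I. a k powr (- 1/4)) * u powr (- 3/4)"
      by (simp add: sum_distrib_right)
  qed (use u a \<open>(\<Prod>k\<in>J. q k) \<le> 1\<close> \<open>0 \<le> (\<Prod>k\<in>I. 1 / a k)\<close> in auto)
  finally show ?thesis by (simp add: reg_kernel_def mult_ac)
qed

lemma
  assumes "finite I" "r \<in> I" and "\<And>k. k \<in> I \<Longrightarrow> 0 < a k \<and> a k \<le> 2"
  shows reg_integrable: "set_integrable lborel {0<..} (reg I r a)"
    and Reg_bound: "\<bar>Reg I r a\<bar> \<le> (\<Prod>k\<in>I. 1 / a k) * (\<Sum>k\<in>I. a k powr (- 1/4)) * reg_const"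
  unfolding Reg_def by (rule set_integrable_reg_kernel_bound[OF borel_measurable_reg reg_bound[OF assms]]; assumption)+

text \<open>Substitution of \<open>u / t\<close> for \<open>u\<close>: jointly in \<open>a\<close>
  and \<open>u\<close> the integrand has degree \<open>- card I - 1\<close>, and du restores one
  degree.\<close>

lemma Reg_scale:
  assumes t: "0 < t"
  shows "Reg I r (\<lambda>k. a k / t) = t ^ card I * Reg I r a"
proof -
  have "reg I r (\<lambda>k. a k / t) (u / t) = t * (t ^ card I * reg I r a u)" for u
  proof -
    have 1: "(\<Prod>k\<in>I. a k / t + u / t) = (\<Prod>k\<in>I. a k + u) / t ^ card I"
      by (simp add: add_divide_distrib[symmetric] prod_dividef)
    have 2: "(\<Prod>k\<in>I. a k / t) = (\<Prod>k\<in>I. a k) / t ^ card I"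
      by (simp add: prod_dividef)
    have 3: "a r / t / (a r / t + u / t) = a r / (a r + u)"
      using t by (simp add: add_divide_distrib[symmetric])
    have "(1 / (U / T) - q / (P / T)) / (u / t) = t * (T * ((1 / U - q / P) / u))" for U T q P :: real
      by (simp add: algebra_simps diff_divide_distrib)
    then show ?thesis unfolding reg_def 1 2 3 .
  qed
  then have *: "indicator {0<..} (0 + 1 / t * u) *\<^sub>R reg I r (\<lambda>k. a k / t) (0 + 1 / t * u) =
      t * (t ^ card I * (indicator {0<..} u *\<^sub>R reg I r a u))" for u
    using t by (auto simp: indicator_def zero_less_divide_iff)
  have "Reg I r (\<lambda>k. a k / t) = \<bar>1 / t\<bar> *\<^sub>R (\<integral>u. t * (t ^ card I * (indicator {0<..} u *\<^sub>R reg I r a u)) \<partial>lborel)"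
    unfolding Reg_def set_lebesgue_integral_def *[symmetric]
    by (rule lborel_integral_real_affine) (use t in simp)
  then show ?thesis using t by (simp add: Reg_def set_lebesgue_integral_def)
qed

lemma integral_inverse_diff_aux:
  fixes a b :: real
  assumes b: "0 < b" "b \<le> a"
  shows "set_integrable lborel {0<..} (\<lambda>u. 1 / (b + u) - 1 / (a + u))"
    "(LINT u:{0<..}|lborel. 1 / (b + u) - 1 / (a + u)) = ln a - ln b"
proof -
  let ?f = "\<lambda>u. 1 / (b + u) - 1 / (a + u)"
  have nn: "0 \<le> ?f u" if "0 \<le> u" for u
    using b that by (simp add: field_simps)
  have "(\<integral>\<^sup>+u. ennreal (indicator {0<..} u *\<^sub>R ?f u) \<partial>lborel) = (\<integral>\<^sup>+u. ennreal (?f u) * indicator {0..} u \<partial>lborel)"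
    by (rule nn_integral_cong_AE, use AE_lborel_singleton[of "0::real"] in eventually_elim)
      (auto simp: indicator_def)
  also have "\<dots> = ennreal (0 - (ln (b + 0) - ln (a + 0)))"
  proof (rule nn_integral_FTC_atLeast[where F = "\<lambda>u. ln (b + u) - ln (a + u)"])
    show "((\<lambda>u. ln (b + u) - ln (a + u)) has_real_derivative ?f u) (at u)" if "0 \<le> u" for u
      using b that by (auto intro!: derivative_eq_intros)
    have "((\<lambda>u. (b - a) / (a + u) + 1) \<longlongrightarrow> 0 + 1) at_top"
      by (intro tendsto_add tendsto_const tendsto_divide_0[OF tendsto_const] filterlim_at_top_imp_at_infinity
          filterlim_tendsto_add_at_top[OF tendsto_const filterlim_ident])
    then have "((\<lambda>u. ln ((b - a) / (a + u) + 1)) \<longlongrightarrow> ln 1) at_top"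
      by (intro tendsto_ln) auto
    moreover have "\<forall>\<^sub>F u in at_top. ln ((b - a) / (a + u) + 1) = ln (b + u) - ln (a + u)"
      using eventually_gt_at_top[of 0]
    proof eventually_elim
      fix u :: real assume "0 < u"
      then have "(b - a) / (a + u) + 1 = (b + u) / (a + u)" using b by (simp add: field_simps)
      then show "ln ((b - a) / (a + u) + 1) = ln (b + u) - ln (a + u)"
        using b \<open>0 < u\<close> by (simp add: ln_div)
    qed
    ultimately show "((\<lambda>u. ln (b + u) - ln (a + u)) \<longlongrightarrow> 0) at_top"
      by (simp add: tendsto_cong)
  qed (use nn in auto)
  finally have "has_bochner_integral lborel (\<lambda>u. indicator {0<..} u *\<^sub>R ?f u) (ln a - ln b)"
    using b nn by (intro has_bochner_integral_nn_integral) (auto simp: indicator_def)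
  then show "set_integrable lborel {0<..} ?f" "(LINT u:{0<..}|lborel. ?f u) = ln a - ln b"
    by (auto simp: set_integrable_def set_lebesgue_integral_def has_bochner_integral_iff)
qed

lemma integral_inverse_diff:
  fixes a b :: real
  assumes "0 < b" "0 < a"
  shows "set_integrable lborel {0<..} (\<lambda>u. 1 / (b + u) - 1 / (a + u))"
    "(LINT u:{0<..}|lborel. 1 / (b + u) - 1 / (a + u)) = ln a - ln b"
proof -
  have "set_integrable lborel {0<..} (\<lambda>u. 1 / (b + u) - 1 / (a + u)) \<and>
    (LINT u:{0<..}|lborel. 1 / (b + u) - 1 / (a + u)) = ln a - ln b"
  proof (cases "b \<le> a")
    case False
    then have i: "set_integrable lborel {0<..} (\<lambda>u. 1 / (a + u) - 1 / (b + u))"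
      "(LINT u:{0<..}|lborel. 1 / (a + u) - 1 / (b + u)) = ln b - ln a"
      using integral_inverse_diff_aux[of a b] assms by auto
    have e: "(\<lambda>u. 1 / (b + u) - 1 / (a + u)) = (\<lambda>u. - (1 / (a + u) - 1 / (b + u)))" by auto
    show ?thesis
      unfolding e using i by (simp add: set_integrable_def set_lebesgue_integral_def del: minus_diff_eq)
  qed (use integral_inverse_diff_aux assms in auto)
  then show "set_integrable lborel {0<..} (\<lambda>u. 1 / (b + u) - 1 / (a + u))"
    "(LINT u:{0<..}|lborel. 1 / (b + u) - 1 / (a + u)) = ln a - ln b" by auto
qed

text \<open>With \<open>r = 1\<close> in every summand, the main parts add up to
  \<open>1 / (\<Prod>k\<le>N. a k + u)\<close> because \<Sum> \<beta> (a + u) = u, and the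
  corrections cancel because \<Sum> \<beta> a = 0. For \<open>j = 1\<close> the index 1 does not lie
  in the product; changing \<open>r\<close> to 0 there produces the difference of
  \<open>1 / (a 1 + u)\<close> and \<open>1 / (a 0 + u)\<close>, whose integral is a difference of
  logarithms.\<close>

lemma reg_expansion:
  assumes a: "\<And>k. k \<le> N \<Longrightarrow> 0 < a k" and N: "1 \<le> N" and u: "0 < u"
    and \<beta>: "(\<Sum>k\<le>N. \<beta> k) = 1" "(\<Sum>k\<le>N. \<beta> k * a k) = 0"
  shows "1 / (\<Prod>k\<le>N. a k + u) = (\<Sum>j\<le>N. \<beta> j * reg ({..N} - {j}) (if j = 1 then 0 else 1) a u) +
    \<beta> 1 / (\<Prod>k\<in>{..N} - {1}. a k) * (1 / (a 1 + u) - 1 / (a 0 + u))"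
proof -
  let ?A = "\<Prod>k\<le>N. a k" and ?U = "\<Prod>k\<le>N. a k + u" and ?q = "a 1 / (a 1 + u)"
  have A: "1 / (\<Prod>k\<in>{..N} - {j}. a k) = a j / ?A" if "j \<le> N" for j
    using a[OF that] that by (simp add: prod.remove[of "{..N}" j])
  have U: "1 / (\<Prod>k\<in>{..N} - {j}. a k + u) = (a j + u) / ?U" if "j \<le> N" for j
    using a[OF that] u that by (simp add: prod.remove[of "{..N}" j])
  have "(\<Sum>j\<le>N. \<beta> j * reg ({..N} - {j}) 1 a u) = (\<Sum>j\<le>N. \<beta> j * (a j + u) / ?U / u - ?q * (\<beta> j * a j) / ?A / u)"
  proof (rule sum.cong[OF refl])
    fix j assume "j \<in> {..N}"
    then have j: "j \<le> N" by simp
    have "reg ({..N} - {j}) 1 a u = ((a j + u) / ?U - ?q * (a j / ?A)) / u"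
      unfolding reg_def U[OF j] A[OF j, symmetric] by simp
    then show "\<beta> j * reg ({..N} - {j}) 1 a u = \<beta> j * (a j + u) / ?U / u - ?q * (\<beta> j * a j) / ?A / u"
      by (simp add: right_diff_distrib diff_divide_distrib mult_ac)
  qed
  also have "\<dots> = (\<Sum>j\<le>N. \<beta> j * (a j + u)) / ?U / u - ?q * (\<Sum>j\<le>N. \<beta> j * a j) / ?A / u"
    by (simp add: sum_subtractf sum_divide_distrib sum_distrib_left)
  also have "(\<Sum>j\<le>N. \<beta> j * (a j + u)) = u"
    using \<beta> by (simp add: distrib_left sum.distrib flip: sum_distrib_right)
  finally have 1: "(\<Sum>j\<le>N. \<beta> j * reg ({..N} - {j}) 1 a u) = 1 / ?U" using u \<beta> by simp
  have "reg I 1 a u = reg I 0 a u + 1 / (\<Prod>k\<in>I. a k) * (1 / (a 1 + u) - 1 / (a 0 + u))" for I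
  proof -
    have e: "(a 0 / (a 0 + u) - a 1 / (a 1 + u)) / u = 1 / (a 1 + u) - 1 / (a 0 + u)"
      using a[of 0] a[of 1] N u by (simp add: divide_simps) (simp add: algebra_simps)
    have "(W - q1 / P) / u = (W - q0 / P) / u + 1 / P * ((q0 - q1) / u)" for W q0 q1 P :: real
      by (simp add: diff_divide_distrib right_diff_distrib)
    then show ?thesis unfolding reg_def e[symmetric] .
  qed
  then have "(\<Sum>j\<le>N. \<beta> j * reg ({..N} - {j}) 1 a u) =
      (\<Sum>j\<le>N. \<beta> j * reg ({..N} - {j}) (if j = 1 then 0 else 1) a u +
        (if j = 1 then \<beta> 1 / (\<Prod>k\<in>{..N} - {1}. a k) * (1 / (a 1 + u) - 1 / (a 0 + u)) else 0))"
    by (intro sum.cong) (auto simp: distrib_left)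
  also have "\<dots> = (\<Sum>j\<le>N. \<beta> j * reg ({..N} - {j}) (if j = 1 then 0 else 1) a u) +
    \<beta> 1 / (\<Prod>k\<in>{..N} - {1}. a k) * (1 / (a 1 + u) - 1 / (a 0 + u))"
    using N by (simp add: sum.distrib)
  finally show ?thesis using 1 by simp
qed

lemma integral_inverse_prod:
  assumes a: "\<And>k. k \<le> N \<Longrightarrow> 0 < a k \<and> a k \<le> 2" and N: "1 \<le> N"
    and \<beta>: "(\<Sum>k\<le>N. \<beta> k) = 1" "(\<Sum>k\<le>N. \<beta> k * a k) = 0"
  shows "(LINT u:{0<..}|lborel. 1 / (\<Prod>k\<le>N. a k + u)) =
      (\<Sum>j\<le>N. \<beta> j * Reg ({..N} - {j}) (if j = 1 then 0 else 1) a) +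
      \<beta> 1 / (\<Prod>k\<in>{..N} - {1}. a k) * (ln (a 0) - ln (a 1))"
proof -
  let ?r = "\<lambda>j::nat. if j = 1 then 0 else 1 :: nat" and ?p = "\<beta> 1 / (\<Prod>k\<in>{..N} - {1}. a k)"
  have i1: "set_integrable lborel {0<..} (\<lambda>u. \<beta> j * reg ({..N} - {j}) (?r j) a u)" if "j \<le> N" for j
    using a N by (intro set_integrable_mult_right reg_integrable) auto
  have i2: "set_integrable lborel {0<..} (\<lambda>u. ?p * (1 / (a 1 + u) - 1 / (a 0 + u)))"
    using integral_inverse_diff(1)[of "a 1" "a 0"] a N by (intro set_integrable_mult_right) auto
  have i3: "set_integrable lborel {0<..} (\<lambda>u. \<Sum>j\<le>N. \<beta> j * reg ({..N} - {j}) (?r j) a u)"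
    unfolding set_integrable_def scaleR_sum_right
    by (intro Bochner_Integration.integrable_sum) (use i1 in \<open>auto simp: set_integrable_def\<close>)
  have ex: "1 / (\<Prod>k\<le>N. a k + u) = (\<Sum>j\<le>N. \<beta> j * reg ({..N} - {j}) (?r j) a u) +
      ?p * (1 / (a 1 + u) - 1 / (a 0 + u))" if "0 < u" for u
    by (rule reg_expansion[OF _ N that \<beta>]) (use a in auto)
  have "(LINT u:{0<..}|lborel. 1 / (\<Prod>k\<le>N. a k + u)) =
      (LINT u:{0<..}|lborel. (\<Sum>j\<le>N. \<beta> j * reg ({..N} - {j}) (?r j) a u) + ?p * (1 / (a 1 + u) - 1 / (a 0 + u)))"
    by (intro set_lebesgue_integral_cong ballI allI impI ex) auto
  also have "\<dots> = (LINT u:{0<..}|lborel. \<Sum>j\<le>N. \<beta> j * reg ({..N} - {j}) (?r j) a u) +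
      (LINT u:{0<..}|lborel. ?p * (1 / (a 1 + u) - 1 / (a 0 + u)))"
    by (rule set_integral_add[OF i3 i2])
  also have "(LINT u:{0<..}|lborel. \<Sum>j\<le>N. \<beta> j * reg ({..N} - {j}) (?r j) a u) =
      (\<Sum>j\<le>N. (LINT u:{0<..}|lborel. \<beta> j * reg ({..N} - {j}) (?r j) a u))"
    unfolding set_lebesgue_integral_def scaleR_sum_right
    by (rule Bochner_Integration.integral_sum) (use i1 in \<open>auto simp: set_integrable_def\<close>)
  finally show ?thesis
    using integral_inverse_diff(2)[of "a 1" "a 0"] a N by (simp add: Reg_def)
qed

text \<open>Only the factor \<open>k0\<close> may be small; it is split by
  \<open>inverse_add_le_powr\<close>. A second factor \<open>l\<close>, bounded below by \<delta>,
  is spent on the decay at infinity, and every other one is at most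
  \<open>1 / \<delta>\<close>.\<close>

lemma inverse_prod_bound:
  assumes I: "finite I" "k0 \<in> I" "l \<in> I" "l \<noteq> k0" and a: "0 < a k0" "\<And>k. k \<in> I - {k0} \<Longrightarrow> \<delta> \<le> a k"
    and \<delta>: "0 < \<delta>" "\<delta> \<le> 2" and u: "0 < u"
  shows "1 / (\<Prod>k\<in>I. a k + u) \<le> (1 / \<delta>) ^ (card I - 1) * a k0 powr (- 1/4) * reg_kernel u"
proof -
  define J where "J = I - {k0} - {l}"
  have J: "finite J" "card J = card I - 2" using I by (auto simp: J_def)
  have c: "Suc (card J) = card I - 1"
  proof -
    have "2 \<le> card I" using card_mono[OF I(1), of "{k0, l}"] I by simp
    then show ?thesis using J by simp
  qed
  have pos: "0 < a k + u" if "k \<in> I" for k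
  proof (cases "k = k0")
    case False
    then show ?thesis using a(2)[of k] that \<delta> u by auto
  qed (use a u in simp)
  have "(\<Prod>k\<in>I. 1 / (a k + u)) = 1 / (a k0 + u) * (1 / (a l + u) * (\<Prod>k\<in>J. 1 / (a k + u)))"
    using I by (simp add: J_def prod.remove[of I k0] prod.remove[of "I - {k0}" l])
  moreover have "0 \<le> (\<Prod>k\<in>J. 1 / (a k + u))"
    using pos by (intro prod_nonneg) (auto simp: J_def less_imp_le)
  moreover have "1 / (a k0 + u) * (1 / (a l + u) * (\<Prod>k\<in>J. 1 / (a k + u))) \<le>
      a k0 powr (- 1/4) * u powr (- 3/4) * (1 / \<delta> * (2 / (2 + u)) * (\<Prod>k\<in>J. 1 / \<delta>))"
  proof (intro mult_mono inverse_add_le_powr)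
    have "\<delta> \<le> a l" using a I by auto
    then have "1 / (a l + u) \<le> 1 / (\<delta> + u)" using \<delta> u by (intro divide_left_mono) auto
    also have "\<dots> \<le> 2 / (\<delta> * (2 + u))"
    proof -
      have "\<delta> * (2 + u) \<le> 2 * (\<delta> + u)"
        using mult_right_mono[of \<delta> 2 u] \<delta> u by (simp add: algebra_simps)
      then show ?thesis using \<delta> u
        by (simp only: pos_divide_le_eq times_divide_eq_left pos_le_divide_eq mult_pos_pos add_pos_pos
            zero_less_numeral mult_1)
    qed
    also have "\<dots> = 1 / \<delta> * (2 / (2 + u))" by simp
    finally show "1 / (a l + u) \<le> 1 / \<delta> * (2 / (2 + u))" .
    show "(\<Prod>k\<in>J. 1 / (a k + u)) \<le> (\<Prod>k\<in>J. 1 / \<delta>)"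
    proof (rule prod_mono)
      fix k assume k: "k \<in> J"
      then have "\<delta> \<le> a k + u" using a(2)[of k] u by (auto simp: J_def)
      then show "0 \<le> 1 / (a k + u) \<and> 1 / (a k + u) \<le> 1 / \<delta>" using \<delta> by (auto intro!: divide_left_mono)
    qed
  qed (use a(1) u \<delta> pos[OF I(3)] \<open>0 \<le> (\<Prod>k\<in>J. 1 / (a k + u))\<close> in simp_all)
  moreover have "a k0 powr (- 1/4) * u powr (- 3/4) * (1 / \<delta> * (2 / (2 + u)) * (\<Prod>k\<in>J. 1 / \<delta>)) = (1 / \<delta>) ^ Suc (card J) * a k0 powr (- 1/4) * reg_kernel u"
    by (simp add: reg_kernel_def mult_ac)
  ultimately show ?thesis unfolding c by (simp add: prod_dividef)
qed

section \<open>Functions that are odd under a reflection\<close>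

text \<open>A Lipschitz bound for the square root that asks for a lower bound of the larger argument
  alone, so that the smaller one may be 0, as it is for an arc around its centre.\<close>

lemma sqrt_diff_le:
  fixes a b c :: real
  assumes "0 \<le> a" "a \<le> b" "0 < c" "c\<^sup>2 \<le> b"
  shows "sqrt b - sqrt a \<le> (b - a) / c"
proof -
  have "(sqrt b - sqrt a) * c \<le> (sqrt b - sqrt a) * (sqrt b + sqrt a)"
    using assms real_le_rsqrt[OF assms(4)] by (intro mult_left_mono) (auto intro: add_increasing2)
  also have "\<dots> = b - a" using assms by (simp add: algebra_simps)
  finally show ?thesis using assms by (simp add: pos_le_divide_eq)
qed

text \<open>\<open>ell p x\<close> is 1 minus the cosine of the angle between \<open>x\<close> and
  \<open>p\<close>, so \<open>\<tau> A\<close> is the tangent of the angle at which it equals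
  \<open>A\<close>. The cone over the two arcs lies in two triangular regions \<open>U 1\<close> and
  \<open>U (- 1)\<close>, and a shear moves each into a box of width 1 and height \<open>h\<close>.
  The factor 4 consists of these two pieces and the factor \<open>n = 2\<close> of the surface
  measure.\<close>

lemma measure_sphere_arc:
  fixes p :: "real^'n::{finite,wellorder}"
  assumes n: "CARD('n) = 2" and p: "norm p = 1" and A: "0 \<le> A1" "A1 \<le> A2" "A2 \<le> 1/2"
  shows "measure sphere_measure {x. A1 \<le> ell p x \<and> ell p x \<le> A2} \<le>
    4 * (sqrt (1 / (1 - A2)\<^sup>2 - 1) - sqrt (1 / (1 - A1)\<^sup>2 - 1))"
proof -
  define \<tau> where "\<tau> A = sqrt (1 / (1 - A)\<^sup>2 - 1)" for A :: real
  have one: "1 \<le> 1 / (1 - A)\<^sup>2" if "0 \<le> A" "A \<le> 1/2" for A :: real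
    using that by (simp add: power_le_one)
  have \<tau>0: "0 \<le> \<tau> A1" "0 \<le> \<tau> A2" using A one by (auto simp: \<tau>_def)
  have mono: "\<tau> A1 \<le> \<tau> A2"
    unfolding \<tau>_def using A by (intro real_sqrt_le_mono diff_right_mono divide_left_mono power_mono) auto
  define h where "h = \<tau> A2 - \<tau> A1"
  have h: "0 \<le> h" using mono by (simp add: h_def)
  obtain k l :: 'n where kl: "UNIV = {k, l}" "k \<noteq> l"
    using n by (auto simp: card_2_iff)
  define U where "U s = {t :: real^'n::_. 0 \<le> t $ k \<and> t $ k \<le> 1 \<and> \<tau> A1 * t $ k \<le> s * t $ l \<and> s * t $ l \<le> \<tau> A2 * t $ k}" for s
  have "closed (U s)" for s
    unfolding U_def by (intro closed_Collect_conj closed_Collect_le continuous_intros)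
  then have U[measurable]: "U s \<in> sets borel" for s by simp
  have ax: "bij_betw (\<lambda>i. axis i 1 :: real^'n::_) UNIV Basis"
    by (rule bij_betw_axis_Basis)
  have emU: "emeasure lborel (U s) \<le> ennreal h" if s: "s = 1 \<or> s = - 1" for s :: real
  proof -
    define lo hi :: "real^'n::_" where "lo = (\<chi> i. if i = k then 0 else (s - 1) / 2 * h)"
      and "hi = (\<chi> i. if i = k then 1 else (s + 1) / 2 * h)"
    define g where "g t = t + (((s * \<tau> A1) *\<^sub>R axis k 1) \<bullet> t) *\<^sub>R axis l 1" for t :: "real^'n::_"
    have g: "linear g" unfolding g_def
      by (intro linearI) (auto simp: algebra_simps inner_add_right)
    have "det (matrix g) = 1 + ((s * \<tau> A1) *\<^sub>R axis k 1) \<bullet> (axis l 1 :: real^'n::_)"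
      unfolding g_def by (rule det_identity_plus_rank_one)
    then have det: "det (matrix g) = 1" using kl(2) by (simp add: inner_axis_axis)
    have inj: "inj g" using det_nz_iff_inj[OF g] det by simp
    have surj: "range g = UNIV" using linear_injective_imp_surjective[OF g inj] by simp
    have gk: "g t $ k = t $ k" "g t $ l = t $ l + s * \<tau> A1 * t $ k" for t
    proof -
      have "g t = t + (s * \<tau> A1 * t $ k) *\<^sub>R axis l 1" by (simp add: g_def inner_axis' mult.assoc)
      then show "g t $ k = t $ k" "g t $ l = t $ l + s * \<tau> A1 * t $ k"
        using kl(2) by (simp_all add: axis_def)
    qed
    have "continuous_on UNIV g"
      using linear_continuous_on[OF g[unfolded linear_conv_bounded_linear]] .
    then have [measurable]: "g \<in> borel_measurable borel" by (rule borel_measurable_continuous_onI)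
    have "emeasure lborel (U s) = (\<integral>\<^sup>+t. indicator (U s) t * indicator (g ` UNIV) t \<partial>lborel)"
      by (simp add: surj)
    also have "\<dots> = (\<integral>\<^sup>+t. ennreal \<bar>det (matrix g)\<bar> * indicator (U s) (g t) * indicator UNIV t \<partial>lborel)"
      by (rule nn_integral_change_of_variables) (use inj g in \<open>auto simp: surj linear_imp_has_derivative\<close>)
    also have "\<dots> \<le> (\<integral>\<^sup>+t. indicator (cbox lo hi) t \<partial>lborel)"
    proof (rule nn_integral_mono)
      fix t :: "real^'n::_"
      have "t \<in> cbox lo hi" if "g t \<in> U s"
      proof -
        have t: "0 \<le> t $ k" "t $ k \<le> 1" "\<tau> A1 * t $ k \<le> s * (t $ l + s * \<tau> A1 * t $ k)"
          "s * (t $ l + s * \<tau> A1 * t $ k) \<le> \<tau> A2 * t $ k"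
          using that by (auto simp: U_def gk)
        have "s * s = 1" using s by auto
        then have e: "s * (t $ l + s * \<tau> A1 * t $ k) = s * t $ l + \<tau> A1 * t $ k"
          by (simp add: distrib_left mult.assoc[symmetric])
        have "0 \<le> s * t $ l" "s * t $ l \<le> h * t $ k"
          using t(3,4) unfolding e h_def by (simp_all add: left_diff_distrib)
        moreover have "h * t $ k \<le> h * 1" using t h by (intro mult_left_mono) auto
        ultimately have "0 \<le> s * t $ l" "s * t $ l \<le> h" by auto
        then have "lo $ i \<le> t $ i \<and> t $ i \<le> hi $ i" for i
          using s t(1,2) kl by (cases "i = k") (auto simp: lo_def hi_def)
        then show ?thesis by (simp add: mem_box_cart)
      qed
      then show "ennreal \<bar>det (matrix g)\<bar> * indicator (U s) (g t) * indicator UNIV t \<le> indicator (cbox lo hi) t"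
        by (auto simp: det indicator_def)
    qed
    also have "\<dots> = emeasure lborel (cbox lo hi)" by simp
    also have "\<dots> = ennreal (\<Prod>b\<in>Basis. (hi - lo) \<bullet> b)"
    proof (rule emeasure_lborel_cbox)
      fix b :: "real^'n::_" assume "b \<in> Basis"
      then obtain i where "b = axis i 1" by (auto simp: Basis_vec_def)
      then show "lo \<bullet> b \<le> hi \<bullet> b" using s h by (auto simp: lo_def hi_def inner_axis)
    qed
    also have "(\<Prod>b\<in>Basis. (hi - lo) \<bullet> b) = (\<Prod>i\<in>UNIV. (hi - lo) $ i)"
      by (subst prod.reindex_bij_betw[OF ax, symmetric]) (simp add: inner_axis)
    also have "\<dots> = h"
      unfolding kl(1) using kl(2) s by (auto simp: lo_def hi_def)
    finally show ?thesis .
  qed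
  have "emeasure sphere_measure {x. A1 \<le> ell p x \<and> ell p x \<le> A2} =
      (\<integral>\<^sup>+x. indicator {A1..A2} (1 - x \<bullet> p) \<partial>sphere_measure)"
  proof -
    have "indicator {A1..A2} (1 - x \<bullet> p) = (indicator {x. A1 \<le> ell p x \<and> ell p x \<le> A2} x :: ennreal)" for x
      by (simp add: ell_def indicator_def)
    moreover have "{x. A1 \<le> ell p x \<and> ell p x \<le> A2} \<in> sets sphere_measure" by measurable
    ultimately show ?thesis by (simp only: nn_integral_indicator)
  qed
  also have "\<dots> = of_nat CARD('n) * (\<integral>\<^sup>+t. indicator (cball 0 1) t * indicator {A1..A2} (1 - t $ k / norm t) \<partial>(lborel :: (real^'n::_) measure))"
    by (rule nn_integral_sphere_axial[OF p]) simp
  also have "(\<integral>\<^sup>+t. indicator (cball 0 1) t * indicator {A1..A2} (1 - t $ k / norm t) \<partial>(lborel :: (real^'n::_) measure)) \<le>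
      (\<integral>\<^sup>+t. indicator (U 1) t + indicator (U (- 1)) t \<partial>lborel)"
  proof (rule nn_integral_mono_AE, use AE_lborel_singleton[of "0 :: real^'n::_"] in eventually_elim)
    fix t :: "real^'n::_" assume t: "t \<noteq> 0"
    have "t \<in> U 1 \<union> U (- 1)" if t1: "norm t \<le> 1" and a: "A1 \<le> 1 - t $ k / norm t" "1 - t $ k / norm t \<le> A2"
    proof -
      define a where "a = 1 - t $ k / norm t"
      have tn: "0 < norm t" using t by simp
      have a12: "A1 \<le> a" "a \<le> A2" "a \<le> 1/2" "0 \<le> a" using a A by (auto simp: a_def)
      have tk: "t $ k = (1 - a) * norm t" using tn by (simp add: a_def)
      have tk0: "0 < t $ k" using tk a12 tn by simp
      have "(norm t)\<^sup>2 = (t $ k)\<^sup>2 + (t $ l)\<^sup>2"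
        unfolding power2_norm_eq_inner by (simp add: inner_vec_def kl power2_eq_square)
      then have "(t $ l)\<^sup>2 = (norm t)\<^sup>2 - (t $ k)\<^sup>2" by simp
      also have "(norm t)\<^sup>2 = (t $ k)\<^sup>2 / (1 - a)\<^sup>2" using tk a12 by (simp add: power_mult_distrib)
      finally have "(t $ l)\<^sup>2 = (t $ k)\<^sup>2 * (1 / (1 - a)\<^sup>2 - 1)" by (simp add: algebra_simps)
      then have "\<bar>t $ l\<bar> = t $ k * \<tau> a"
        using tk0 by (metis \<tau>_def abs_of_pos real_sqrt_abs real_sqrt_mult)
      moreover have "\<tau> A1 \<le> \<tau> a" "\<tau> a \<le> \<tau> A2"
        unfolding \<tau>_def using a12 A by (auto intro!: real_sqrt_le_mono diff_right_mono divide_left_mono power_mono)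
      ultimately have "\<tau> A1 * t $ k \<le> \<bar>t $ l\<bar>" "\<bar>t $ l\<bar> \<le> \<tau> A2 * t $ k"
        using tk0 by (auto simp: mult.commute)
      moreover have "t $ k \<le> 1" using component_le_norm_cart[of t k] t1 by linarith
      ultimately show ?thesis using tk0 by (cases "0 \<le> t $ l") (auto simp: U_def)
    qed
    then show "indicator (cball 0 1) t * indicator {A1..A2} (1 - t $ k / norm t) \<le>
        (indicator (U 1) t + indicator (U (- 1)) t :: ennreal)"
      by (auto simp: indicator_def)
  qed
  also have "(\<integral>\<^sup>+t. indicator (U 1) t + indicator (U (- 1)) t \<partial>lborel) = emeasure lborel (U 1) + emeasure lborel (U (- 1))"
    by (subst nn_integral_add) auto
  also have "\<dots> \<le> ennreal h + ennreal h" by (intro add_mono emU) auto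
  also have "\<dots> = ennreal (2 * h)" using h by (simp add: ennreal_plus[symmetric] del: ennreal_plus)
  finally have "emeasure sphere_measure {x. A1 \<le> ell p x \<and> ell p x \<le> A2} \<le> of_nat CARD('n) * ennreal (2 * h)"
    by (simp add: mult_left_mono)
  also have "\<dots> = ennreal (4 * h)" using h by (simp add: n ennreal_mult')
  finally show ?thesis
    using h unfolding measure_def by (simp add: h_def \<tau>_def enn2real_leI)
qed

text \<open>Here \<open>c\<close> stands for the radius of the arc, as \<open>sqrt (2 * A2)\<close>
  is the chordal distance to its outer ends. The squared tangent has slope at most 32 on [0, 1/2]
  and is at least \<open>2 * A2\<close> at the outer end, so \<open>sqrt_diff_le\<close> applies;
  128 is 4 times 32.\<close>

lemma measure_sphere_arc_le:
  fixes p :: "real^'n::{finite,wellorder}"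
  assumes n: "CARD('n) = 2" and p: "norm p = 1" and A: "0 \<le> A1" "A1 \<le> A2" "A2 \<le> 1/2"
    and c: "0 < c" "c\<^sup>2 \<le> 2 * A2"
  shows "measure sphere_measure {x. A1 \<le> ell p x \<and> ell p x \<le> A2} \<le> 128 * (A2 - A1) / c"
proof -
  let ?t = "\<lambda>A::real. 1 / (1 - A)\<^sup>2 - 1"
  have q: "1/4 \<le> (1 - A)\<^sup>2" "(1 - A)\<^sup>2 \<le> 1" if "0 \<le> A" "A \<le> 1/2" for A :: real
    using that power_mono[of "1/2" "1 - A" 2] power_le_one[of "1 - A" 2] by (auto simp: power_one_over)
  have t0: "0 \<le> ?t A1" using A q[of A1] by simp
  have t12: "?t A1 \<le> ?t A2" using A q by (intro diff_right_mono divide_left_mono power_mono) auto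
  have "2 * A2 \<le> ?t A2"
  proof -
    have "(1 + 2 * A2) * (1 - A2)\<^sup>2 = 1 - A2\<^sup>2 * (3 - 2 * A2)" by (simp add: power2_eq_square algebra_simps)
    also have "\<dots> \<le> 1" using A by simp
    finally have "1 + 2 * A2 \<le> 1 / (1 - A2)\<^sup>2" using A by (simp add: pos_le_divide_eq)
    then show ?thesis by simp
  qed
  then have "sqrt (?t A2) - sqrt (?t A1) \<le> (?t A2 - ?t A1) / c"
    using t0 t12 c by (intro sqrt_diff_le) auto
  also have "?t A2 - ?t A1 \<le> 32 * (A2 - A1)"
  proof -
    have "?t A2 - ?t A1 = (A2 - A1) * (2 - A1 - A2) * (1 / (1 - A1)\<^sup>2 * (1 / (1 - A2)\<^sup>2))"
      using A by (simp add: field_simps) (simp add: power2_eq_square algebra_simps)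
    also have "\<dots> \<le> (A2 - A1) * 2 * (4 * 4)"
      using A q[of A1] q[of A2] by (intro mult_mono mult_nonneg_nonneg) (auto simp: pos_divide_le_eq)
    finally show ?thesis by simp
  qed
  then have "(?t A2 - ?t A1) / c \<le> 32 * (A2 - A1) / c" using c by (intro divide_right_mono) auto
  finally have "sqrt (?t A2) - sqrt (?t A1) \<le> 32 * (A2 - A1) / c" by linarith
  then have "4 * (sqrt (?t A2) - sqrt (?t A1)) \<le> 4 * (32 * (A2 - A1) / c)" by (intro mult_left_mono) auto
  also have "\<dots> = 128 * (A2 - A1) / c" by simp
  finally show ?thesis using measure_sphere_arc[OF n p A] by (rule order_trans[rotated])
qed

lemma norm_sphere_refl:
  assumes "lorentz_Q w = 1" "norm x = 1"
  shows "norm (sphere_refl w x) = 1"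
  using lorentz_refl_nonzero[OF assms(1), of x] assms(2) by (force simp: sphere_refl_def)

lemma ell_sphere_refl:
  assumes w: "lorentz_Q w = 1" and x: "norm x = 1" and z: "fst w \<bullet> z = snd w"
  shows "ell z (sphere_refl w x) = ell z x / norm (lorentz_refl w x)"
proof -
  have "0 < norm (lorentz_refl w x)" using lorentz_refl_nonzero[OF w, of x] x by force
  moreover have "norm (lorentz_refl w x) - lorentz_refl w x \<bullet> z = ell z x"
    using lorentz_refl_pairing[OF w, of x z] x z by (simp add: ell_def)
  ultimately show ?thesis by (simp add: ell_def sphere_refl_def field_simps)
qed

lemma sphere_refl_mirror:
  assumes w: "lorentz_Q w = 1" and x: "norm x = 1"
  shows "fst w \<bullet> sphere_refl w x - snd w = - (fst w \<bullet> x - snd w) / norm (lorentz_refl w x)"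
proof -
  have "0 < norm (lorentz_refl w x)" using lorentz_refl_nonzero[OF w, of x] x by force
  then show ?thesis
    using lorentz_refl_mirror[OF w, of x] x by (simp add: sphere_refl_def field_simps)
qed

text \<open>A hyperplane meeting the open ball has a space-like Lorentz normal
  \<open>(c, d)\<close>, since \<open>\<bar>d\<bar> < norm c\<close> by Cauchy-Schwarz; \<kappa> is
  its Lorentz length.\<close>

lemma exists_reflection:
  fixes c :: "real^'n"
  assumes "c \<noteq> 0" "norm z0 < 1" "c \<bullet> z0 = d"
  obtains w \<kappa> where "0 < \<kappa>" "lorentz_Q w = 1" "c = \<kappa> *\<^sub>R fst w" "d = \<kappa> * snd w"
proof -
  have "\<bar>d\<bar> \<le> norm c * norm z0" using Cauchy_Schwarz_ineq2[of c z0] assms by simp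
  also have "\<dots> < norm c * 1" using assms by (intro mult_strict_left_mono) auto
  finally have "\<bar>d\<bar>\<^sup>2 < (norm c)\<^sup>2" by (intro power_strict_mono) auto
  then have "d\<^sup>2 < c \<bullet> c" by (simp add: power2_norm_eq_inner)
  define \<kappa> where "\<kappa> = sqrt (c \<bullet> c - d\<^sup>2)"
  have k: "0 < \<kappa>" "\<kappa>\<^sup>2 = c \<bullet> c - d\<^sup>2" using \<open>d\<^sup>2 < c \<bullet> c\<close> by (auto simp: \<kappa>_def)
  have "c \<bullet> c / \<kappa>\<^sup>2 = 1 + (d / \<kappa>)\<^sup>2"
    using k by (simp add: power_divide field_simps)
  then have "lorentz_Q (c /\<^sub>R \<kappa>, d / \<kappa>) = 1"
    by (simp add: lorentz_Q_eq_1_iff power2_eq_square divide_inverse mult_ac)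
  then show ?thesis using k that[of \<kappa> "(c /\<^sub>R \<kappa>, d / \<kappa>)"] by simp
qed

text \<open>The reflection in the hyperbolic hyperplane \<open>c \<bullet> x = d\<close> divides \<open>c \<bullet> x - d\<close> by \<open>- t\<close> and
  \<open>ell z x\<close> by \<open>t\<close> for all points \<open>z\<close> of the hyperplane, where \<open>t\<close> is the conformal factor at \<open>x\<close>.\<close>

definition mirror_odd :: "real^'n \<Rightarrow> real \<Rightarrow> (real^'n) set \<Rightarrow> (real^'n \<Rightarrow> real) \<Rightarrow> bool" where
  "mirror_odd c d Z f \<longleftrightarrow> (\<forall>x x' t. norm x = 1 \<longrightarrow> norm x' = 1 \<longrightarrow> 0 < t \<longrightarrow>
    c \<bullet> x' - d = - (c \<bullet> x - d) / t \<longrightarrow> (\<forall>z\<in>Z. ell z x' = ell z x / t) \<longrightarrow>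
    f x' = - (t ^ (CARD('n) - 1)) * f x)"

lemma mirror_odd_refl:
  fixes f :: "real^'n \<Rightarrow> real"
  assumes f: "mirror_odd c d Z f" and w: "lorentz_Q w = 1" and x: "norm x = 1"
    and \<kappa>: "c = \<kappa> *\<^sub>R fst w" "d = \<kappa> * snd w" "0 < \<kappa>" and Z: "\<And>z. z \<in> Z \<Longrightarrow> c \<bullet> z = d"
  shows "f (sphere_refl w x) / norm (lorentz_refl w x) ^ (CARD('n) - 1) = - f x"
proof -
  let ?t = "norm (lorentz_refl w x)"
  have t: "0 < ?t" using lorentz_refl_nonzero[OF w, of x] x by force
  have "c \<bullet> sphere_refl w x - d = \<kappa> * (fst w \<bullet> sphere_refl w x - snd w)"
    by (simp add: \<kappa> right_diff_distrib)
  also have "\<dots> = - (c \<bullet> x - d) / ?t"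
    unfolding sphere_refl_mirror[OF w x] by (simp add: \<kappa> right_diff_distrib diff_divide_distrib)
  finally have "c \<bullet> sphere_refl w x - d = - (c \<bullet> x - d) / ?t" .
  moreover have "ell z (sphere_refl w x) = ell z x / ?t" if "z \<in> Z" for z
    using ell_sphere_refl[OF w x, of z] Z[OF that] \<kappa> by simp
  ultimately have "f (sphere_refl w x) = - (?t ^ (CARD('n) - 1)) * f x"
    using f x norm_sphere_refl[OF w x] t unfolding mirror_odd_def by blast
  then show ?thesis using t by simp
qed

text \<open>For \<open>c = 0\<close> there is no mirror, but the condition may be applied to
  \<open>x' = x\<close> and \<open>t = 1\<close>, which gives f x = - f x.\<close>

lemma mirror_odd_degenerate:
  fixes f :: "real^'n \<Rightarrow> real"
  assumes "mirror_odd 0 0 Z f" "norm x = 1"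
  shows "f x = 0"
proof -
  have "f x = - (1 ^ (CARD('n) - 1)) * f x"
    using assms(1)[unfolded mirror_odd_def, rule_format, of x x 1] assms(2) by simp
  then show ?thesis by simp
qed

lemma integral_mirror_odd:
  fixes f :: "real^'n::{finite,wellorder} \<Rightarrow> real"
  assumes f: "mirror_odd c d Z f" and [measurable]: "f \<in> borel_measurable borel"
    and z0: "norm z0 < 1" "c \<bullet> z0 = d" and Z: "\<And>z. z \<in> Z \<Longrightarrow> c \<bullet> z = d"
  shows "(\<integral>x. f x \<partial>sphere_measure) = 0"
proof (cases "c = 0")
  case True
  then have "f x = 0" if "norm x = 1" for x using mirror_odd_degenerate[of Z f x] f z0 that by simp
  then have "(\<integral>x. f x \<partial>sphere_measure) = (\<integral>x. 0 \<partial>(sphere_measure :: (real^'n::_) measure))"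
    by (intro integral_cong_AE, measurable) (use AE_sphere in eventually_elim, simp)
  then show ?thesis by simp
next
  case False
  obtain w \<kappa> where w: "0 < \<kappa>" "lorentz_Q w = 1" "c = \<kappa> *\<^sub>R fst w" "d = \<kappa> * snd w"
    using exists_reflection[OF False z0] .
  have "(\<integral>x. f x \<partial>sphere_measure) =
      (\<integral>x. f (sphere_refl w x) / norm (lorentz_refl w x) ^ (CARD('n) - 1) \<partial>sphere_measure)"
    by (rule integral_sphere_refl[OF w(2)]) measurable
  also have "\<dots> = (\<integral>x. - f x \<partial>sphere_measure)"
    by (intro integral_cong_AE, measurable)
      (use AE_sphere in eventually_elim, rule mirror_odd_refl[OF f w(2) _ w(3,4,1) Z])
  finally show ?thesis by simp
qed

text \<open>The hyperbolic reflection exchanging \<open>z\<close> and the origin turns the integrand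
  into a constant multiple of \<open>ell z\<close>, whose average over \<open>x\<close> and
  \<open>- x\<close> is 1. The constant is the density, because \<open>s\<close> is the square root
  of \<open>1 - z \<bullet> z\<close>.\<close>

lemma nn_integral_ell_power_card:
  fixes z :: "real^'n::{finite,wellorder}"
  assumes z: "norm z < 1"
  shows "(\<integral>\<^sup>+x. ennreal (1 / ell z x ^ CARD('n)) \<partial>sphere_measure) =
    ennreal (CARD('n) * unit_ball_vol CARD('n)) * ennreal (hyp_density z)"
proof -
  let ?n = "CARD('n)" and ?v = "CARD('n) * unit_ball_vol CARD('n)"
  define q where "q = 1 - z \<bullet> z"
  have q: "0 < q" using z by (simp add: q_def norm_eq_sqrt_inner)
  have hz: "hyp_density z = 1 / sqrt q ^ Suc ?n"
  proof -
    have "sqrt q ^ Suc ?n = q powr ((real ?n + 1) / 2)"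
      using q powr_realpow[of "sqrt q" "Suc ?n"] by (simp add: powr_half_sqrt[symmetric] powr_powr add.commute)
    then show ?thesis by (simp add: hyp_density_def lorentz_Q_eq lorentz_def q_def)
  qed
  have lin: "(\<integral>\<^sup>+x. ennreal (ell z x) \<partial>sphere_measure) = ennreal ?v"
  proof -
    let ?I = "\<integral>\<^sup>+x. ennreal (ell z x) \<partial>sphere_measure"
    have "?I + ?I = ?I + (\<integral>\<^sup>+x. ennreal (ell z (- x)) \<partial>sphere_measure)"
      by (subst nn_integral_sphere_uminus) measurable
    also have "\<dots> = (\<integral>\<^sup>+x. ennreal (ell z x) + ennreal (ell z (- x)) \<partial>sphere_measure)"
      by (rule nn_integral_add[symmetric]) measurable
    also have "\<dots> = (\<integral>\<^sup>+x. 2 \<partial>(sphere_measure :: (real^'n::_) measure))"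
    proof (rule nn_integral_cong_AE, use AE_sphere in eventually_elim)
      fix x :: "real^'n::_" assume "norm x = 1"
      then have "0 \<le> ell z x" "0 \<le> ell z (- x)"
        using ell_ge_interior[of x z] ell_ge_interior[of "- x" z] z by auto
      then have "ennreal (ell z x) + ennreal (ell z (- x)) = ennreal (ell z x + ell z (- x))" by simp
      also have "ell z x + ell z (- x) = 2" by (simp add: ell_def)
      finally show "ennreal (ell z x) + ennreal (ell z (- x)) = 2" by simp
    qed
    also have "\<dots> = ennreal ?v + ennreal ?v"
      by (simp add: emeasure_sphere_measure_UNIV mult_2)
    finally have e: "?I + ?I = ennreal ?v + ennreal ?v" .
    have "?I < \<infinity>"
    proof (rule ccontr)
      assume "\<not> ?I < \<infinity>"
      then have "?I = \<infinity>" by (simp add: not_less top_unique)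
      then have "?I + ?I = \<infinity>" by simp
      then show False using e by (simp add: ennreal_plus[symmetric] del: ennreal_plus)
    qed
    then obtain r where r: "?I = ennreal r" "0 \<le> r" by (cases ?I) auto
    moreover have v: "0 \<le> ?v" by simp
    ultimately have "ennreal (r + r) = ennreal (?v + ?v)" using e by (simp only: ennreal_plus)
    then have "r + r = ?v + ?v" using r v by (subst (asm) ennreal_inj) auto
    then show ?thesis using r by simp
  qed
  show ?thesis
  proof (cases "z = 0")
    case True
    then show ?thesis
      by (simp add: ell_def hyp_density_0 emeasure_sphere_measure_UNIV)
  next
    case False
    define s where "s = sqrt q"
    have s: "0 < s" "s < 1" "s\<^sup>2 = q" using q False by (auto simp: s_def q_def)
    define c where "c = 1 - s"
    have cz: "z \<bullet> z = 1 - s * s" using s(3) by (simp add: q_def power2_eq_square)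
    \<comment> \<open>the reflection exchanging \<open>(z, 1) / s\<close> and \<open>(0, 1)\<close>\<close>
    obtain w \<kappa> where w: "0 < \<kappa>" "lorentz_Q w = 1" "z = \<kappa> *\<^sub>R fst w" "c = \<kappa> * snd w"
    proof (rule exists_reflection[of z "(1 / (1 + s)) *\<^sub>R z" c])
      \<comment> \<open>The witness is the hyperbolic midpoint of 0 and \<open>z\<close>, the point
        represented by the sum of \<open>(z, 1) / s\<close> and \<open>(0, 1)\<close>; the normal
        \<open>(z, c)\<close> of the mirror is proportional to their difference.\<close>
      show "norm ((1 / (1 + s)) *\<^sub>R z) < 1" using z s by (simp add: field_simps)
      have "(1 - s * s) / (1 + s) = 1 - s" using s by (simp add: field_simps)
      then show "z \<bullet> ((1 / (1 + s)) *\<^sub>R z) = c" by (simp add: cz c_def)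
    qed (use False in auto)
    have k2: "\<kappa>\<^sup>2 = 2 * s * (1 - s)"
    proof -
      have "\<kappa>\<^sup>2 * (fst w \<bullet> fst w) = z \<bullet> z" by (subst (1 2) w(3)) (simp add: power2_eq_square)
      then have "\<kappa>\<^sup>2 + c\<^sup>2 = 1 - s * s"
        using w(2,4) by (simp add: lorentz_Q_eq_1_iff cz distrib_left power_mult_distrib)
      then show ?thesis by (simp add: c_def power2_eq_square algebra_simps)
    qed
    have b: "fst w \<bullet> x - snd w = (s - ell z x) / \<kappa>" for x
    proof -
      have "\<kappa> * (fst w \<bullet> x - snd w) = z \<bullet> x - c" by (subst w(3), subst w(4)) (simp add: right_diff_distrib)
      then show ?thesis using w(1) by (simp add: field_simps ell_def c_def inner_commute)
    qed
    have lam: "norm (lorentz_refl w x) = ell z x / s" if x: "norm x = 1" for x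
    proof -
      have "norm (lorentz_refl w x) = 1 - 2 * ((s - ell z x) / \<kappa>) * snd w"
        using norm_lorentz_refl[OF w(2), of x] x b[of x] by simp
      also have "snd w = c / \<kappa>" using w by simp
      also have "1 - 2 * ((s - ell z x) / \<kappa>) * (c / \<kappa>) = 1 - 2 * (s - ell z x) * c / \<kappa>\<^sup>2"
        by (simp add: power2_eq_square)
      also have "\<dots> = ell z x / s" using s unfolding k2 by (simp add: c_def field_simps)
      finally show ?thesis .
    qed
    have pair: "norm (lorentz_refl w x) - lorentz_refl w x \<bullet> z = s" if x: "norm x = 1" for x
    proof -
      have "norm (lorentz_refl w x) - lorentz_refl w x \<bullet> z = ell z x + 2 * (fst w \<bullet> x - snd w) * (fst w \<bullet> z - snd w)"
        using lorentz_refl_pairing[OF w(2), of x z] x by (simp add: ell_def)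
      also have "\<dots> = ell z x + 2 * (s - ell z x) * (s - ell z z) / \<kappa>\<^sup>2"
        by (simp add: b power2_eq_square)
      also have "\<dots> = s"
      proof -
        have e: "s - ell z z = s * (1 - s)" by (simp add: ell_def cz algebra_simps)
        have "2 * (s - ell z x) * (s * (1 - s)) / (2 * s * (1 - s)) = s - ell z x"
        proof -
          have e: "2 * (s - ell z x) * (s * (1 - s)) = (s - ell z x) * (2 * s * (1 - s))" by (simp only: mult_ac)
          have "2 * s * (1 - s) \<noteq> 0" using s by simp
          then show ?thesis unfolding e by (rule nonzero_mult_div_cancel_right)
        qed
        then show ?thesis unfolding k2 e by simp
      qed
      finally show ?thesis .
    qed
    have "(\<integral>\<^sup>+x. ennreal (1 / ell z x ^ ?n) \<partial>sphere_measure) =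
      (\<integral>\<^sup>+x. ennreal (1 / norm (lorentz_refl w x) ^ (?n - 1)) * ennreal (1 / ell z (sphere_refl w x) ^ ?n) \<partial>sphere_measure)"
      by (rule nn_integral_sphere_refl[OF w(2), symmetric]) measurable
    also have "\<dots> = (\<integral>\<^sup>+x. ennreal (1 / s ^ Suc ?n) * ennreal (ell z x) \<partial>sphere_measure)"
    proof (rule nn_integral_cong_AE, use AE_sphere in eventually_elim)
      fix x :: "real^'n::_" assume x: "norm x = 1"
      let ?l = "norm (lorentz_refl w x)"
      have l: "0 < ?l" using lorentz_refl_nonzero[OF w(2), of x] x by force
      have "ell z (sphere_refl w x) = s / ?l"
        using pair[OF x] l by (simp add: ell_def sphere_refl_def field_simps)
      moreover have "1 / ?l ^ (?n - 1) * (1 / (s / ?l) ^ ?n) = 1 / s ^ Suc ?n * ell z x"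
      proof -
        obtain m where m: "?n = Suc m" by (metis zero_less_card_finite gr0_implies_Suc)
        have "ell z x = s * ?l" using lam[OF x] s by simp
        then show ?thesis using l s unfolding m by (simp add: power_divide)
      qed
      ultimately show "ennreal (1 / ?l ^ (?n - 1)) * ennreal (1 / ell z (sphere_refl w x) ^ ?n) =
          ennreal (1 / s ^ Suc ?n) * ennreal (ell z x)"
        using l s by (simp add: ennreal_mult'[symmetric])
    qed
    also have "\<dots> = ennreal (1 / s ^ Suc ?n) * ennreal ?v"
      by (subst nn_integral_cmult) (simp_all add: lin)
    finally show ?thesis by (simp add: hz s_def mult.commute)
  qed
qed

section \<open>Principal values on the circle\<close>

lemma integrable_sphere_bounded:
  fixes f :: "real^'n \<Rightarrow> real"
  assumes "f \<in> borel_measurable borel" "\<And>x. norm x = 1 \<Longrightarrow> \<bar>f x\<bar> \<le> B"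
  shows "integrable sphere_measure f"
proof -
  have "AE x in sphere_measure. norm (f x) \<le> B"
    using AE_sphere by eventually_elim (use assms(2) in simp)
  then show ?thesis
    by (rule finite_measure.integrable_const_bound[OF finite_measure_sphere]) (use assms(1) in simp)
qed

definition cut_sphere :: "(real^'n) set \<Rightarrow> real \<Rightarrow> (real^'n) set" where
  "cut_sphere P \<epsilon> = {x \<in> sphere 0 1. \<forall>p\<in>P. \<epsilon> \<le> dist x p}"

lemma cut_sphere_borel [measurable]: "cut_sphere P \<epsilon> \<in> sets borel"
proof -
  have "cut_sphere P \<epsilon> = sphere 0 1 \<inter> (\<Inter>p\<in>P. {x. \<epsilon> \<le> dist x p})"
    by (auto simp: cut_sphere_def)
  also have "closed \<dots>" by (intro closed_Int closed_INT ballI closed_Collect_le continuous_intros) auto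
  finally show ?thesis by simp
qed

text \<open>Only ideal points of \<open>Z\<close> can make \<open>f\<close> large: below
  \<open>\<eta>0\<close>, which is at most \<open>1 - norm z\<close> for every interior
  \<open>z\<close>, the inequality \<open>\<eta> \<le> ell z x\<close> is automatic for the interior
  points.\<close>

lemma bounded_away_from_singularities:
  fixes f :: "real^'n \<Rightarrow> real"
  assumes Z: "finite Z" "\<And>z. z \<in> Z \<Longrightarrow> norm z \<le> 1"
    and bound: "\<And>x. norm x = 1 \<Longrightarrow> (\<And>z. z \<in> Z \<Longrightarrow> 0 < ell z x) \<Longrightarrow>
      \<bar>f x\<bar> \<le> C * (\<Sum>z\<in>Z. ell z x powr (- 3/4))"
  obtains \<eta>0 B where "0 < \<eta>0" "0 \<le> B"
    "\<And>x \<eta>. norm x = 1 \<Longrightarrow> 0 < \<eta> \<Longrightarrow> \<eta> \<le> \<eta>0 \<Longrightarrow> (\<And>z. z \<in> Z \<Longrightarrow> norm z = 1 \<Longrightarrow> \<eta> \<le> ell z x) \<Longrightarrow>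
      \<bar>f x\<bar> \<le> B * \<eta> powr (- 3/4)"
proof -
  define \<eta>0 where "\<eta>0 = Min (insert 1 ((\<lambda>z. 1 - norm z) ` {z \<in> Z. norm z < 1}))"
  have \<eta>0: "0 < \<eta>0" using Z(1) by (simp add: \<eta>0_def)
  have \<eta>0_le: "\<eta>0 \<le> 1 - norm z" if "z \<in> Z" "norm z < 1" for z
    unfolding \<eta>0_def using Z(1) that by (intro Min_le) auto
  show ?thesis
  proof (rule that[OF \<eta>0, of "\<bar>C\<bar> * card Z"])
    fix x :: "real^'n" and \<eta> assume x: "norm x = 1" and \<eta>: "0 < \<eta>" "\<eta> \<le> \<eta>0"
      and le: "\<And>z. z \<in> Z \<Longrightarrow> norm z = 1 \<Longrightarrow> \<eta> \<le> ell z x"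
    have ge: "\<eta> \<le> ell z x" if "z \<in> Z" for z
    proof (cases "norm z = 1")
      case False
      then show ?thesis using \<eta>0_le[of z] ell_ge_interior[OF x, of z] Z(2)[OF that] that \<eta> by force
    qed (use le that in simp)
    have "\<bar>f x\<bar> \<le> C * (\<Sum>z\<in>Z. ell z x powr (- 3/4))"
      using bound x ge \<eta> by (meson order.strict_trans2)
    also have "\<dots> \<le> \<bar>C\<bar> * (\<Sum>z\<in>Z. \<eta> powr (- 3/4))"
      using ge \<eta> by (intro mult_mono sum_mono powr_mono2') (auto intro!: sum_nonneg)
    finally show "\<bar>f x\<bar> \<le> \<bar>C\<bar> * card Z * \<eta> powr (- 3/4)" by (simp add: mult_ac)
  qed simp
qed

lemma cut_sphere_bound:
  fixes f :: "real^'n \<Rightarrow> real"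
  assumes Z: "finite Z" "\<And>z. z \<in> Z \<Longrightarrow> norm z \<le> 1"
    and bound: "\<And>x. norm x = 1 \<Longrightarrow> (\<And>z. z \<in> Z \<Longrightarrow> 0 < ell z x) \<Longrightarrow>
      \<bar>f x\<bar> \<le> C * (\<Sum>z\<in>Z. ell z x powr (- 3/4))"
    and \<epsilon>: "0 < \<epsilon>"
  shows "\<exists>B. \<forall>x. norm x = 1 \<longrightarrow> (\<forall>z\<in>Z. norm z = 1 \<longrightarrow> \<epsilon> \<le> dist x z) \<longrightarrow> \<bar>f x\<bar> \<le> B"
proof -
  obtain \<eta>0 B where B: "0 < \<eta>0" "0 \<le> B" and le:
    "\<And>x \<eta>. norm x = 1 \<Longrightarrow> 0 < \<eta> \<Longrightarrow> \<eta> \<le> \<eta>0 \<Longrightarrow> (\<And>z. z \<in> Z \<Longrightarrow> norm z = 1 \<Longrightarrow> \<eta> \<le> ell z x) \<Longrightarrow>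
      \<bar>f x\<bar> \<le> B * \<eta> powr (- 3/4)"
    by (rule bounded_away_from_singularities[OF Z bound]; blast)
  define \<eta> where "\<eta> = min \<eta>0 (\<epsilon>\<^sup>2 / 2)"
  have \<eta>: "0 < \<eta>" "\<eta> \<le> \<eta>0" using B \<epsilon> by (auto simp: \<eta>_def)
  have "\<bar>f x\<bar> \<le> B * \<eta> powr (- 3/4)"
    if x: "norm x = 1" and d: "\<forall>z\<in>Z. norm z = 1 \<longrightarrow> \<epsilon> \<le> dist x z" for x
  proof (rule le[OF x \<eta>])
    fix z assume "z \<in> Z" "norm z = 1"
    then have "\<epsilon>\<^sup>2 \<le> (dist x z)\<^sup>2" using d \<epsilon> by (intro power_mono) auto
    then have "\<epsilon>\<^sup>2 / 2 \<le> ell z x" using ell_eq_norm_diff[OF x \<open>norm z = 1\<close>] by (simp add: dist_norm)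
    then show "\<eta> \<le> ell z x" by (simp add: \<eta>_def)
  qed
  then show ?thesis by blast
qed

lemma integrable_cut_sphere:
  fixes f :: "real^'n \<Rightarrow> real"
  assumes Z: "finite Z" "\<And>z. z \<in> Z \<Longrightarrow> norm z \<le> 1" and [measurable]: "f \<in> borel_measurable borel"
    and bound: "\<And>x. norm x = 1 \<Longrightarrow> (\<And>z. z \<in> Z \<Longrightarrow> 0 < ell z x) \<Longrightarrow>
      \<bar>f x\<bar> \<le> C * (\<Sum>z\<in>Z. ell z x powr (- 3/4))"
    and P: "{z \<in> Z. norm z = 1} \<subseteq> P" and \<epsilon>: "0 < \<epsilon>"
  shows "integrable sphere_measure (\<lambda>x. indicator (cut_sphere P \<epsilon>) x * f x)"
proof -
  obtain B where B: "\<And>x. norm x = 1 \<Longrightarrow> (\<forall>z\<in>Z. norm z = 1 \<longrightarrow> \<epsilon> \<le> dist x z) \<Longrightarrow> \<bar>f x\<bar> \<le> B"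
    using cut_sphere_bound[OF Z bound \<epsilon>] by blast
  show ?thesis
  proof (rule integrable_sphere_bounded)
    fix x :: "real^'n" assume x: "norm x = 1"
    show "\<bar>indicator (cut_sphere P \<epsilon>) x * f x\<bar> \<le> \<bar>B\<bar>"
    proof (cases "x \<in> cut_sphere P \<epsilon>")
      case True
      then have "\<forall>z\<in>Z. norm z = 1 \<longrightarrow> \<epsilon> \<le> dist x z" using P by (auto simp: cut_sphere_def)
      then show ?thesis using B[OF x] True by simp
    qed simp
  qed measurable
qed

text \<open>The cut sphere and its mirror image differ by arcs contained in the sets \<open>A \<epsilon> p\<close> below. These have
  measure \<open>O(\<epsilon>\<^sup>2)\<close>, whereas \<open>f\<close> is there only of order \<open>\<epsilon>\<close> to the power \<open>- 3/2\<close>.\<close>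

lemma principal_value_mirror_odd_exact:
  fixes f :: "real^'n::{finite,wellorder} \<Rightarrow> real"
  assumes n: "CARD('n) = 2"
    and f: "mirror_odd c d Z f" and fm[measurable]: "f \<in> borel_measurable borel"
    and z0: "norm z0 < 1" "c \<bullet> z0 = d" and Z: "finite Z" "\<And>z. z \<in> Z \<Longrightarrow> norm z \<le> 1" "\<And>z. z \<in> Z \<Longrightarrow> c \<bullet> z = d"
    and bound: "\<And>x. norm x = 1 \<Longrightarrow> (\<And>z. z \<in> Z \<Longrightarrow> 0 < ell z x) \<Longrightarrow>
      \<bar>f x\<bar> \<le> C * (\<Sum>z\<in>Z. ell z x powr (- 3/4))"
  defines "P \<equiv> {z \<in> Z. norm z = 1}"
  shows "((\<lambda>\<epsilon>. \<integral>x. indicator (cut_sphere P \<epsilon>) x * f x \<partial>sphere_measure) \<longlongrightarrow> 0) (at_right 0)"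
proof (cases "c = 0")
  case True
  then have 0: "f x = 0" if "norm x = 1" for x using mirror_odd_degenerate[of Z f x] f z0 that by simp
  have "(\<integral>x. indicator (cut_sphere P \<epsilon>) x * f x \<partial>sphere_measure) = (\<integral>x. 0 \<partial>(sphere_measure :: (real^'n::_) measure))" for \<epsilon>
    by (intro integral_cong_AE, measurable) (use AE_sphere in eventually_elim, simp add: 0)
  then show ?thesis by simp
next
  case False
  obtain w \<kappa> where w: "0 < \<kappa>" "lorentz_Q w = 1" "c = \<kappa> *\<^sub>R fst w" "d = \<kappa> * snd w"
    using exists_reflection[OF False z0] .
  define lm where "lm x = norm (lorentz_refl w x)" for x
  define \<phi> where "\<phi> = sphere_refl w"
  have \<phi>[measurable]: "\<phi> \<in> borel_measurable borel" by (simp add: \<phi>_def)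
  have lm_eq: "lm x = 1 - 2 * (fst w \<bullet> x - snd w) * snd w" if "norm x = 1" for x
    using norm_lorentz_refl[OF w(2), of x] that by (simp add: lm_def)
  \<comment> \<open>A bound for the conformal factor \<open>lm\<close>; as the reflection is an
    involution, the same \<open>M\<close> bounds \<open>1 / lm\<close>.\<close>
  define M where "M = 1 + 2 * (norm (fst w) + \<bar>snd w\<bar>) * \<bar>snd w\<bar>"
  have M: "1 \<le> M" by (simp add: M_def)
  have lm_le: "norm (lorentz_refl w y) \<le> M * norm y" for y
  proof -
    have "\<bar>fst w \<bullet> y - snd w * norm y\<bar> \<le> norm (fst w) * norm y + \<bar>snd w\<bar> * norm y"
      using Cauchy_Schwarz_ineq2[of "fst w" y] abs_triangle_ineq4[of "fst w \<bullet> y" "snd w * norm y"]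
      by (simp add: abs_mult)
    then have "\<bar>fst w \<bullet> y - snd w * norm y\<bar> * \<bar>snd w\<bar> \<le> (norm (fst w) + \<bar>snd w\<bar>) * norm y * \<bar>snd w\<bar>"
      by (intro mult_right_mono) (auto simp: distrib_right)
    moreover have "- ((fst w \<bullet> y - snd w * norm y) * snd w) \<le> \<bar>fst w \<bullet> y - snd w * norm y\<bar> * \<bar>snd w\<bar>"
      unfolding abs_mult[symmetric] by (rule abs_ge_minus_self)
    ultimately have "- ((fst w \<bullet> y - snd w * norm y) * snd w) \<le> (norm (fst w) + \<bar>snd w\<bar>) * norm y * \<bar>snd w\<bar>"
      by linarith
    moreover have "M * norm y = norm y + 2 * ((norm (fst w) + \<bar>snd w\<bar>) * norm y * \<bar>snd w\<bar>)"
      by (simp add: M_def algebra_simps)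
    moreover have "norm y - 2 * X * s = norm y + 2 * (- (X * s))" for X s :: real by simp
    ultimately show ?thesis unfolding norm_lorentz_refl[OF w(2)] by (smt (verit))
  qed
  have lm_M: "lm x \<le> M" if "norm x = 1" for x using lm_le[of x] that by (simp add: lm_def)
  have lm_m: "1 \<le> M * lm x" if "norm x = 1" for x
    using lm_le[of "lorentz_refl w x"] that by (simp add: lorentz_refl_involution[OF w(2)] lm_def)
  have lm_0: "0 < lm x" if "norm x = 1" for x
    using lorentz_refl_nonzero[OF w(2), of x] that by (force simp: lm_def)
  have odd: "f (\<phi> x) / lm x = - f x" if "norm x = 1" for x
    using mirror_odd_refl[OF f w(2) that w(3,4,1) Z(3)] by (simp add: n \<phi>_def lm_def)
  have ell\<phi>: "ell p (\<phi> x) = ell p x / lm x" if "norm x = 1" "p \<in> P" for x p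
    unfolding \<phi>_def lm_def
  proof (rule ell_sphere_refl[OF w(2) that(1)])
    have "\<kappa> * (fst w \<bullet> p) = \<kappa> * snd w" using Z(3)[of p] that(2) w(3,4) by (simp add: P_def)
    then show "fst w \<bullet> p = snd w" using w(1) by simp
  qed
  have P: "finite P" "\<And>p. p \<in> P \<Longrightarrow> norm p = 1" "\<And>p. p \<in> P \<Longrightarrow> p \<in> Z" using Z by (auto simp: P_def)
  obtain \<eta>0 B where B: "0 < \<eta>0" "0 \<le> B" and le:
    "\<And>x \<eta>. norm x = 1 \<Longrightarrow> 0 < \<eta> \<Longrightarrow> \<eta> \<le> \<eta>0 \<Longrightarrow> (\<And>z. z \<in> Z \<Longrightarrow> norm z = 1 \<Longrightarrow> \<eta> \<le> ell z x) \<Longrightarrow>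
      \<bar>f x\<bar> \<le> B * \<eta> powr (- 3/4)"
    by (rule bounded_away_from_singularities[OF Z(1,2) bound]; blast)
  \<comment> \<open>Collects the constants of the estimate below:
    \<open>a \<le> M \<epsilon>^2 / 2\<close>, \<open>1 / lm x \<le> M\<close>, and
    \<open>\<bar>1 - lm x\<bar>\<close> at distance at most \<open>sqrt M * \<epsilon>\<close> from
    the ideal point.\<close>
  define K where "K = M * M * sqrt M * (norm (fst w) * \<bar>snd w\<bar>)"
  have K: "0 \<le> K" using M by (simp add: K_def)
  define S where "S \<epsilon> = cut_sphere P \<epsilon>" for \<epsilon>
  have [measurable]: "S \<epsilon> \<in> sets borel" for \<epsilon> by (simp add: S_def)
  have S_iff: "x \<in> S \<epsilon> \<longleftrightarrow> (\<forall>p\<in>P. \<epsilon>\<^sup>2 / 2 \<le> ell p x)" if "norm x = 1" "0 < \<epsilon>" for x \<epsilon>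
  proof -
    have "\<epsilon> \<le> dist x p \<longleftrightarrow> \<epsilon>\<^sup>2 / 2 \<le> ell p x" if "p \<in> P" for p
      using ell_eq_norm_diff[OF \<open>norm x = 1\<close> P(2)[OF that]] \<open>0 < \<epsilon>\<close>
      by (simp add: dist_norm abs_le_square_iff[symmetric])
    then show ?thesis using that by (simp add: S_def cut_sphere_def)
  qed
  define A where "A \<epsilon> p = {x. \<epsilon>\<^sup>2 / 2 - K * \<epsilon> ^ 3 \<le> ell p x \<and> ell p x \<le> \<epsilon>\<^sup>2 / 2 + K * \<epsilon> ^ 3}" for \<epsilon> and p :: "real^'n::_"
  have [measurable]: "A \<epsilon> p \<in> sets borel" for \<epsilon> p unfolding A_def by measurable
  have key: "\<bar>\<integral>x. indicator (S \<epsilon>) x * f x \<partial>sphere_measure\<bar> \<le>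
      (\<Sum>p\<in>P. B * (\<epsilon>\<^sup>2 / (2 * M)) powr (- 3/4) * measure sphere_measure (A \<epsilon> p))"
    if \<epsilon>: "0 < \<epsilon>" "\<epsilon>\<^sup>2 / (2 * M) \<le> \<eta>0" for \<epsilon>
  proof -
    let ?\<eta> = "\<epsilon>\<^sup>2 / 2" and ?L = "B * (\<epsilon>\<^sup>2 / (2 * M)) powr (- 3/4)"
    let ?i = "\<lambda>x. indicator (S \<epsilon>) x :: real"
    have \<eta>: "0 < ?\<eta>" using \<epsilon> by simp
    have point: "\<bar>(?i x - ?i (\<phi> x)) * f x\<bar> \<le> (\<Sum>p\<in>P. ?L * indicator (A \<epsilon> p) x)" if x: "norm x = 1" for x
    proof (cases "x \<in> S \<epsilon> \<longleftrightarrow> \<phi> x \<in> S \<epsilon>")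
      case True
      then have "?i x - ?i (\<phi> x) = 0" by (auto simp: indicator_def)
      then show ?thesis using B by (auto intro!: sum_nonneg)
    next
      case False
      have \<phi>x: "norm (\<phi> x) = 1" unfolding \<phi>_def by (rule norm_sphere_refl[OF w(2) x])
      have \<phi>S: "\<phi> x \<in> S \<epsilon> \<longleftrightarrow> (\<forall>p\<in>P. ?\<eta> \<le> ell p x / lm x)"
        using S_iff[OF \<phi>x \<epsilon>(1)] ell\<phi>[OF x] by simp
      \<comment> \<open>One of \<open>x\<close> and its mirror image survives the cut, so
        \<open>x\<close> is at worst a conformal factor closer to the ideal points than the cut
        allows.\<close>
      have fx: "\<bar>f x\<bar> \<le> ?L"
      proof (rule le[OF x])
        fix z assume z: "z \<in> Z" "norm z = 1"
        then have zP: "z \<in> P" by (simp add: P_def)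
        have 1: "?\<eta> / M \<le> ?\<eta>" using \<eta> M by (simp add: divide_le_eq)
        have "?\<eta> / M \<le> ell z x"
        proof (cases "x \<in> S \<epsilon>")
          case True
          then show ?thesis using S_iff[OF x \<epsilon>(1)] zP 1 by force
        next
          case False
          then have "?\<eta> \<le> ell z x / lm x" using \<open>\<not> (x \<in> S \<epsilon> \<longleftrightarrow> \<phi> x \<in> S \<epsilon>)\<close> \<phi>S zP by blast
          then have "?\<eta> * lm x \<le> ell z x" using lm_0[OF x] by (simp add: pos_le_divide_eq)
          moreover have "?\<eta> / M \<le> ?\<eta> * lm x"
            using lm_m[OF x] M \<eta> mult_left_mono[OF lm_m[OF x], of ?\<eta>] by (simp add: pos_divide_le_eq mult_ac)
          ultimately show ?thesis by linarith
        qed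
        then show "\<epsilon>\<^sup>2 / (2 * M) \<le> ell z x" by simp
      qed (use \<epsilon> M in auto)
      have "\<exists>p\<in>P. x \<in> A \<epsilon> p"
      proof -
        obtain p where p: "p \<in> P" "(ell p x < ?\<eta> \<and> ?\<eta> \<le> ell p x / lm x) \<or> (ell p x / lm x < ?\<eta> \<and> ?\<eta> \<le> ell p x)"
          using False S_iff[OF x \<epsilon>(1)] \<phi>S by (metis not_le)
        define a where "a = ell p x"
        have a0: "0 \<le> a" unfolding a_def ell_eq_norm_diff[OF x P(2)[OF p(1)]] by simp
        have aM: "a \<le> M * ?\<eta>"
        proof -
          have "a < ?\<eta> \<or> a < lm x * ?\<eta>" using p(2) lm_0[OF x] by (auto simp: a_def pos_divide_less_eq mult.commute)
          moreover have "lm x * ?\<eta> \<le> M * ?\<eta>" using lm_M[OF x] \<eta> by (intro mult_right_mono) auto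
          moreover have "1 * ?\<eta> \<le> M * ?\<eta>" using M \<eta> by (intro mult_right_mono) auto
          ultimately show ?thesis by linarith
        qed
        have "norm (x - p) = sqrt (2 * a)"
          unfolding a_def ell_eq_norm_diff[OF x P(2)[OF p(1)]] by simp
        also have "\<dots> \<le> sqrt (M * \<epsilon>\<^sup>2)" using aM by (intro real_sqrt_le_mono) simp
        also have "\<dots> = sqrt M * \<epsilon>" using \<epsilon> by (simp add: real_sqrt_mult)
        finally have xp: "norm (x - p) \<le> sqrt M * \<epsilon>" .
        \<comment> \<open>The conformal factor is 1 on the mirror, hence at \<open>p\<close>, so it
          deviates from 1 by O(\<epsilon>) at \<open>x\<close>. This additional order makes the
          discrepancy of the cuts smaller than the cuts themselves.\<close>
        have "\<bar>1 - lm x\<bar> \<le> 2 * (norm (fst w) * (sqrt M * \<epsilon>)) * \<bar>snd w\<bar>"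
        proof -
          have "\<kappa> * (fst w \<bullet> p) = \<kappa> * snd w" using Z(3)[OF P(3)[OF p(1)]] w(3,4) by simp
          then have "fst w \<bullet> x - snd w = fst w \<bullet> (x - p)" using w(1) by (simp add: inner_diff_right)
          then have "\<bar>fst w \<bullet> x - snd w\<bar> \<le> norm (fst w) * norm (x - p)"
            using Cauchy_Schwarz_ineq2[of "fst w" "x - p"] by simp
          also have "\<dots> \<le> norm (fst w) * (sqrt M * \<epsilon>)" using xp by (intro mult_left_mono) auto
          finally show ?thesis unfolding lm_eq[OF x] by (auto simp: abs_mult intro!: mult_mono)
        qed
        have "\<bar>a - a / lm x\<bar> = a * (1 / lm x) * \<bar>1 - lm x\<bar>"
        proof -
          have "a - a / lm x = a * (1 / lm x) * (lm x - 1)" using lm_0[OF x] by (simp add: field_simps)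
          then show ?thesis using a0 lm_0[OF x] by (simp add: abs_mult abs_minus_commute)
        qed
        also have "\<dots> \<le> M * ?\<eta> * M * (2 * (norm (fst w) * (sqrt M * \<epsilon>)) * \<bar>snd w\<bar>)"
        proof (intro mult_mono aM)
          show "1 / lm x \<le> M" using lm_m[OF x] lm_0[OF x] by (simp add: pos_divide_le_eq)
        qed (use M \<eta> a0 lm_0[OF x] \<open>\<bar>1 - lm x\<bar> \<le> _\<close> \<epsilon> in auto)
        also have "\<dots> = K * \<epsilon> ^ 3" by (simp add: K_def power2_eq_square power3_eq_cube)
        finally have "\<bar>a - a / lm x\<bar> \<le> K * \<epsilon> ^ 3" .
        then have "?\<eta> - K * \<epsilon> ^ 3 \<le> ell p x \<and> ell p x \<le> ?\<eta> + K * \<epsilon> ^ 3"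
          using p(2) unfolding a_def by arith
        then show ?thesis using p(1) by (intro bexI[of _ p]) (simp_all add: A_def)
      qed
      then obtain p where p: "p \<in> P" "x \<in> A \<epsilon> p" by blast
      have "\<bar>(?i x - ?i (\<phi> x)) * f x\<bar> \<le> ?L" using fx by (auto simp: indicator_def abs_mult)
      also have "\<dots> = ?L * indicator (A \<epsilon> p) x" using p by simp
      also have "\<dots> \<le> (\<Sum>p\<in>P. ?L * indicator (A \<epsilon> p) x)"
        using p P(1) B by (intro member_le_sum) auto
      finally show ?thesis .
    qed
    have i1: "integrable sphere_measure (\<lambda>x. ?i x * f x)"
      unfolding S_def by (rule integrable_cut_sphere[OF Z(1,2) fm bound]) (use \<epsilon> in \<open>auto simp: P_def\<close>)
    have ind: "integrable sphere_measure (\<lambda>x. ?L * indicator (A \<epsilon> p) x :: real)" for p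
      by (rule integrable_sphere_bounded[where B = ?L]) (use B in \<open>auto simp: indicator_def\<close>)
    have i2: "integrable sphere_measure (\<lambda>x. \<Sum>p\<in>P. ?L * indicator (A \<epsilon> p) x :: real)"
      using ind by (rule Bochner_Integration.integrable_sum)
    have i3: "integrable sphere_measure (\<lambda>x. (?i x - ?i (\<phi> x)) * f x)"
    proof (rule Bochner_Integration.integrable_bound[OF i2])
      show "AE x in sphere_measure. norm ((?i x - ?i (\<phi> x)) * f x) \<le> norm (\<Sum>p\<in>P. ?L * indicator (A \<epsilon> p) x)"
        using AE_sphere by eventually_elim (unfold real_norm_def, rule order_trans[OF point abs_ge_self])
    qed measurable
    have "(\<integral>x. ?i x * f x \<partial>sphere_measure) = (\<integral>x. ?i (\<phi> x) * f (\<phi> x) / lm x ^ (CARD('n) - 1) \<partial>sphere_measure)"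
      unfolding \<phi>_def lm_def by (rule integral_sphere_refl[OF w(2)]) measurable
    also have "\<dots> = (\<integral>x. - (?i (\<phi> x) * f x) \<partial>sphere_measure)"
    proof (intro integral_cong_AE)
      show "AE x in sphere_measure. ?i (\<phi> x) * f (\<phi> x) / lm x ^ (CARD('n) - 1) = - (?i (\<phi> x) * f x)"
        using AE_sphere
      proof eventually_elim
        fix x :: "real^'n::_" assume "norm x = 1"
        from odd[OF this] show "?i (\<phi> x) * f (\<phi> x) / lm x ^ (CARD('n) - 1) = - (?i (\<phi> x) * f x)"
          by (simp add: n flip: times_divide_eq_right)
      qed
    qed (unfold lm_def, measurable)
    also have "\<dots> = (\<integral>x. (?i x - ?i (\<phi> x)) * f x - ?i x * f x \<partial>sphere_measure)"
      by (simp add: left_diff_distrib)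
    also have "\<dots> = (\<integral>x. (?i x - ?i (\<phi> x)) * f x \<partial>sphere_measure) - (\<integral>x. ?i x * f x \<partial>sphere_measure)"
      by (rule Bochner_Integration.integral_diff[OF i3 i1])
    \<comment> \<open>The reflection returns minus the integral over the reflected cut, so twice the
      integral is the contribution of the difference of the two cuts.\<close>
    finally have "2 * (\<integral>x. ?i x * f x \<partial>sphere_measure) = (\<integral>x. (?i x - ?i (\<phi> x)) * f x \<partial>sphere_measure)" by simp
    then have "\<bar>\<integral>x. ?i x * f x \<partial>sphere_measure\<bar> \<le> \<bar>\<integral>x. (?i x - ?i (\<phi> x)) * f x \<partial>sphere_measure\<bar>" by linarith
    also have "\<dots> \<le> (\<integral>x. \<bar>(?i x - ?i (\<phi> x)) * f x\<bar> \<partial>sphere_measure)"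
      using integral_norm_bound[of sphere_measure "\<lambda>x. (?i x - ?i (\<phi> x)) * f x"] by simp
    also have "\<dots> \<le> (\<integral>x. (\<Sum>p\<in>P. ?L * indicator (A \<epsilon> p) x) \<partial>sphere_measure)"
      by (rule integral_mono_AE) (use i3 i2 AE_sphere point in \<open>auto elim: eventually_mono\<close>)
    also have "\<dots> = (\<Sum>p\<in>P. (\<integral>x. ?L * indicator (A \<epsilon> p) x \<partial>sphere_measure))"
      by (rule Bochner_Integration.integral_sum[OF ind])
    also have "\<dots> = (\<Sum>p\<in>P. ?L * measure sphere_measure (A \<epsilon> p))"
      by simp
    finally show ?thesis .
  qed
  define D where "D = card P * (B * (1 / (2 * M)) powr (- 3/4) * (256 * K))"
  have "\<bar>\<integral>x. indicator (S \<epsilon>) x * f x \<partial>sphere_measure\<bar> \<le> D * \<epsilon> powr (1/2)"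
    if \<epsilon>: "0 < \<epsilon>" "\<epsilon>\<^sup>2 / (2 * M) \<le> \<eta>0" "K * \<epsilon> \<le> 1/2" "\<epsilon>\<^sup>2 / 2 + K * \<epsilon> ^ 3 \<le> 1/2" for \<epsilon>
  proof -
    have me: "measure sphere_measure (A \<epsilon> p) \<le> 256 * K * \<epsilon>\<^sup>2" if p: "p \<in> P" for p
    proof -
      have "K * \<epsilon> * \<epsilon>\<^sup>2 \<le> 1/2 * \<epsilon>\<^sup>2" using \<epsilon> by (intro mult_right_mono) auto
      then have "K * \<epsilon> ^ 3 \<le> \<epsilon>\<^sup>2 / 2" by (simp add: power3_eq_cube power2_eq_square)
      then have "measure sphere_measure (A \<epsilon> p) \<le> 128 * (\<epsilon>\<^sup>2 / 2 + K * \<epsilon> ^ 3 - (\<epsilon>\<^sup>2 / 2 - K * \<epsilon> ^ 3)) / \<epsilon>"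
        unfolding A_def using \<epsilon> K P(2)[OF p] by (intro measure_sphere_arc_le[OF n]) auto
      also have "\<dots> = 256 * K * \<epsilon>\<^sup>2" using \<epsilon> by (simp add: power3_eq_cube power2_eq_square)
      finally show ?thesis .
    qed
    have "\<bar>\<integral>x. indicator (S \<epsilon>) x * f x \<partial>sphere_measure\<bar> \<le>
        (\<Sum>p\<in>P. B * (\<epsilon>\<^sup>2 / (2 * M)) powr (- 3/4) * (256 * K * \<epsilon>\<^sup>2))"
      using key[OF \<epsilon>(1,2)] sum_mono[of P, OF mult_left_mono[OF me]] B by (meson order_trans mult_nonneg_nonneg powr_ge_zero)
    also have "\<dots> = card P * (B * ((1 / (2 * M)) powr (- 3/4) * \<epsilon>\<^sup>2 powr (- 3/4)) * (256 * K * \<epsilon>\<^sup>2))"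
    proof -
      have "(\<epsilon>\<^sup>2 / (2 * M)) powr (- 3/4) = (1 / (2 * M) * \<epsilon>\<^sup>2) powr (- 3/4)" by simp
      also have "\<dots> = (1 / (2 * M)) powr (- 3/4) * \<epsilon>\<^sup>2 powr (- 3/4)" by (rule powr_mult)
      finally show ?thesis by simp
    qed
    also have "\<dots> = D * (\<epsilon>\<^sup>2 powr (- 3/4) * \<epsilon>\<^sup>2)" by (simp add: D_def mult_ac)
    also have "\<epsilon>\<^sup>2 powr (- 3/4) * \<epsilon>\<^sup>2 = \<epsilon> powr (1/2)"
    proof -
      have e2: "\<epsilon>\<^sup>2 = \<epsilon> powr 2" using \<epsilon> by simp
      have "\<epsilon>\<^sup>2 powr (- 3/4) * \<epsilon>\<^sup>2 = \<epsilon> powr (2 * (- 3/4) + 2)"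
        unfolding e2 powr_powr powr_add ..
      then show ?thesis by simp
    qed
    finally show ?thesis .
  qed
  moreover have "\<forall>\<^sub>F \<epsilon> in at_right 0. 0 < \<epsilon> \<and> \<epsilon>\<^sup>2 / (2 * M) \<le> \<eta>0 \<and> K * \<epsilon> \<le> 1/2 \<and> \<epsilon>\<^sup>2 / 2 + K * \<epsilon> ^ 3 \<le> 1/2"
  proof (intro eventually_conj)
    show "\<forall>\<^sub>F \<epsilon> in at_right 0. 0 < (\<epsilon>::real)" by (simp add: eventually_at_right_less)
    have "((\<lambda>\<epsilon>. \<epsilon>\<^sup>2 / (2 * M)) \<longlongrightarrow> 0\<^sup>2 / (2 * M)) (at_right 0)" using M by (intro tendsto_intros) auto
    then show "\<forall>\<^sub>F \<epsilon> in at_right 0. \<epsilon>\<^sup>2 / (2 * M) \<le> \<eta>0"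
      using B(1) by (auto dest!: order_tendstoD(2)[of _ _ _ \<eta>0] elim!: eventually_mono)
    have "((\<lambda>\<epsilon>. K * \<epsilon>) \<longlongrightarrow> K * 0) (at_right 0)" by (intro tendsto_intros)
    then show "\<forall>\<^sub>F \<epsilon> in at_right 0. K * \<epsilon> \<le> 1/2"
      by (auto dest!: order_tendstoD(2)[of _ _ _ "1/2"] elim!: eventually_mono)
    have "((\<lambda>\<epsilon>. \<epsilon>\<^sup>2 / 2 + K * \<epsilon> ^ 3) \<longlongrightarrow> 0\<^sup>2 / 2 + K * 0 ^ 3) (at_right 0)" by (intro tendsto_intros) auto
    then show "\<forall>\<^sub>F \<epsilon> in at_right 0. \<epsilon>\<^sup>2 / 2 + K * \<epsilon> ^ 3 \<le> 1/2"
      by (auto dest!: order_tendstoD(2)[of _ _ _ "1/2"] elim!: eventually_mono)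
  qed
  ultimately have "\<forall>\<^sub>F \<epsilon> in at_right 0. norm (\<integral>x. indicator (S \<epsilon>) x * f x \<partial>sphere_measure) \<le> D * \<epsilon> powr (1/2)"
    by (auto elim!: eventually_mono)
  moreover have "((\<lambda>\<epsilon>. D * \<epsilon> powr (1/2)) \<longlongrightarrow> D * 0) (at_right 0)"
  proof (intro tendsto_mult tendsto_const)
    have "\<forall>\<^sub>F \<epsilon> in at_right 0. 0 \<le> (\<epsilon>::real)"
      using eventually_at_right_less[of "0::real"] by eventually_elim simp
    then show "((\<lambda>\<epsilon>::real. \<epsilon> powr (1/2)) \<longlongrightarrow> 0) (at_right 0)"
      by (intro tendsto_zero_powrI[OF tendsto_ident_at tendsto_const]) simp_all
  qed
  ultimately show ?thesis
    unfolding S_def mult_zero_right by (rule Lim_null_comparison)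
qed

text \<open>The cut prescribed by the whole form also removes arcs around points of \<open>P\<close>
  where this particular \<open>f\<close> is regular, and the reflection need not match those arcs.
  There \<open>f\<close> is bounded and the arcs have length O(\<epsilon>), so the limit is
  unaffected.\<close>

lemma principal_value_mirror_odd:
  fixes f :: "real^'n::{finite,wellorder} \<Rightarrow> real"
  assumes n: "CARD('n) = 2"
    and f: "mirror_odd c d Z f" and fm[measurable]: "f \<in> borel_measurable borel"
    and z0: "norm z0 < 1" "c \<bullet> z0 = d" and Z: "finite Z" "\<And>z. z \<in> Z \<Longrightarrow> norm z \<le> 1" "\<And>z. z \<in> Z \<Longrightarrow> c \<bullet> z = d"
    and bound: "\<And>x. norm x = 1 \<Longrightarrow> (\<And>z. z \<in> Z \<Longrightarrow> 0 < ell z x) \<Longrightarrow>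
      \<bar>f x\<bar> \<le> C * (\<Sum>z\<in>Z. ell z x powr (- 3/4))"
    and P: "finite P" "P \<subseteq> sphere 0 1" "{z \<in> Z. norm z = 1} \<subseteq> P"
  shows "((\<lambda>\<epsilon>. \<integral>x. indicator (cut_sphere P \<epsilon>) x * f x \<partial>sphere_measure) \<longlongrightarrow> 0) (at_right 0)"
proof -
  define R where "R = {z \<in> Z. norm z = 1}"
  define X where "X = P - R"
  have X: "finite X" using P by (simp add: X_def)
  have R: "finite R" using Z by (simp add: R_def)
  have lim: "((\<lambda>\<epsilon>. \<integral>x. indicator (cut_sphere R \<epsilon>) x * f x \<partial>sphere_measure) \<longlongrightarrow> 0) (at_right 0)"
    unfolding R_def by (rule principal_value_mirror_odd_exact[OF n f fm z0 Z bound])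
  \<comment> \<open>The least distance between an additional point and a singular one, capped at 1:
    for \<epsilon> up to \<open>\<rho> / 2\<close> an additional arc keeps distance
    \<open>\<rho> / 2\<close> from the singularities.\<close>
  define \<rho> where "\<rho> = Min (insert 1 ((\<lambda>(p, z). dist p z) ` (X \<times> R)))"
  have \<rho>: "0 < \<rho>" "\<rho> \<le> 1" using X R by (auto simp: \<rho>_def X_def intro: Min_le)
  have \<rho>_le: "\<rho> \<le> dist p z" if "p \<in> X" "z \<in> R" for p z
    unfolding \<rho>_def using X R that by (intro Min_le) force+
  have "0 < \<rho> / 2" using \<rho> by simp
  from cut_sphere_bound[OF Z(1,2) bound this]
  obtain B where B: "\<And>x. norm x = 1 \<Longrightarrow> (\<forall>z\<in>Z. norm z = 1 \<longrightarrow> \<rho> / 2 \<le> dist x z) \<Longrightarrow> \<bar>f x\<bar> \<le> B"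
    by blast
  define D where "D = \<bar>B\<bar> * (64 * card X)"
  have diff: "\<bar>(\<integral>x. indicator (cut_sphere R \<epsilon>) x * f x \<partial>sphere_measure) -
      (\<integral>x. indicator (cut_sphere P \<epsilon>) x * f x \<partial>sphere_measure)\<bar> \<le> D * \<epsilon>"
    if \<epsilon>: "0 < \<epsilon>" "\<epsilon> \<le> \<rho> / 2" for \<epsilon>
  proof -
    let ?r = "\<lambda>x. indicator (cut_sphere R \<epsilon>) x * f x" and ?p = "\<lambda>x. indicator (cut_sphere P \<epsilon>) x * f x"
    define A where "A p = {x. 0 \<le> ell p x \<and> ell p x \<le> \<epsilon>\<^sup>2 / 2}" for p :: "real^'n::_"
    have [measurable]: "A p \<in> sets borel" for p unfolding A_def by measurable
    have i: "integrable sphere_measure ?r" "integrable sphere_measure ?p"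
      by (rule integrable_cut_sphere[OF Z(1,2) fm bound]; use P \<epsilon> in \<open>auto simp: R_def\<close>)+
    have ind: "integrable sphere_measure (\<lambda>x. \<bar>B\<bar> * indicator (A p) x :: real)" for p
      by (rule integrable_sphere_bounded[where B = "\<bar>B\<bar>"]) (auto simp: indicator_def)
    have point: "\<bar>?r x - ?p x\<bar> \<le> (\<Sum>p\<in>X. \<bar>B\<bar> * indicator (A p) x)" if x: "norm x = 1" for x
    proof (cases "x \<in> cut_sphere R \<epsilon> \<and> x \<notin> cut_sphere P \<epsilon>")
      case True
      then obtain p where p: "p \<in> X" "dist x p < \<epsilon>"
        using x by (force simp: cut_sphere_def X_def not_le)
      have p1: "norm p = 1" using p P by (auto simp: X_def)
      have "\<bar>f x\<bar> \<le> B"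
      proof (rule B[OF x], intro ballI impI)
        fix z assume z: "z \<in> Z" "norm z = 1"
        have "\<rho> \<le> dist p x + dist x z" using \<rho>_le[OF p(1), of z] z dist_triangle[of p z x] by (auto simp: R_def)
        then show "\<rho> / 2 \<le> dist x z" using p \<epsilon> by (simp add: dist_commute)
      qed
      moreover have "x \<in> A p"
      proof -
        have "(dist x p)\<^sup>2 \<le> \<epsilon>\<^sup>2" using p by (intro power_mono) auto
        then show ?thesis unfolding A_def mem_Collect_eq ell_eq_norm_diff[OF x p1] by (simp add: dist_norm)
      qed
      ultimately have "\<bar>?r x - ?p x\<bar> \<le> \<bar>B\<bar> * indicator (A p) x" using True by simp
      also have "\<dots> \<le> (\<Sum>p\<in>X. \<bar>B\<bar> * indicator (A p) x)"
        using p X by (intro member_le_sum) auto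
      finally show ?thesis .
    next
      case False
      moreover have "x \<in> cut_sphere R \<epsilon>" if "x \<in> cut_sphere P \<epsilon>" using that P(3) by (auto simp: cut_sphere_def R_def)
      ultimately have "?r x - ?p x = 0" by (auto simp: indicator_def)
      then show ?thesis by (auto intro!: sum_nonneg)
    qed
    have "\<bar>(\<integral>x. ?r x \<partial>sphere_measure) - (\<integral>x. ?p x \<partial>sphere_measure)\<bar> = \<bar>\<integral>x. ?r x - ?p x \<partial>sphere_measure\<bar>"
      using i by simp
    also have "\<dots> \<le> (\<integral>x. \<bar>?r x - ?p x\<bar> \<partial>sphere_measure)"
      using integral_norm_bound[of sphere_measure "\<lambda>x. ?r x - ?p x"] by simp
    also have "\<dots> \<le> (\<integral>x. (\<Sum>p\<in>X. \<bar>B\<bar> * indicator (A p) x) \<partial>sphere_measure)"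
    proof (rule integral_mono_AE)
      show "AE x in sphere_measure. \<bar>?r x - ?p x\<bar> \<le> (\<Sum>p\<in>X. \<bar>B\<bar> * indicator (A p) x)"
        using AE_sphere by eventually_elim (rule point)
    qed (use i ind in \<open>auto intro!: Bochner_Integration.integrable_sum\<close>)
    also have "\<dots> = (\<Sum>p\<in>X. (\<integral>x. \<bar>B\<bar> * indicator (A p) x \<partial>sphere_measure))"
      by (rule Bochner_Integration.integral_sum[OF ind])
    also have "\<dots> = (\<Sum>p\<in>X. \<bar>B\<bar> * measure sphere_measure (A p))" by simp
    also have "\<dots> \<le> (\<Sum>p\<in>X. \<bar>B\<bar> * (64 * \<epsilon>))"
    proof (intro sum_mono mult_left_mono)
      fix p assume "p \<in> X"
      then have p1: "norm p = 1" using P by (auto simp: X_def)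
      have "\<epsilon> \<le> 1" using \<epsilon> \<rho> by simp
      then have "measure sphere_measure (A p) \<le> 128 * (\<epsilon>\<^sup>2 / 2 - 0) / \<epsilon>"
        unfolding A_def using \<epsilon> by (intro measure_sphere_arc_le[OF n p1]) (auto simp: power_le_one)
      also have "\<dots> = 64 * \<epsilon>" using \<epsilon> by (simp add: power2_eq_square)
      finally show "measure sphere_measure (A p) \<le> 64 * \<epsilon>" .
    qed simp
    also have "\<dots> = D * \<epsilon>" by (simp add: D_def)
    finally show ?thesis .
  qed
  have "((\<lambda>\<epsilon>. (\<integral>x. indicator (cut_sphere R \<epsilon>) x * f x \<partial>sphere_measure) -
      (\<integral>x. indicator (cut_sphere P \<epsilon>) x * f x \<partial>sphere_measure)) \<longlongrightarrow> 0) (at_right 0)"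
  proof (rule Lim_null_comparison)
    have "\<forall>\<^sub>F \<epsilon> in at_right 0. 0 < \<epsilon> \<and> \<epsilon> < \<rho> / 2"
      using \<rho> by (auto simp: eventually_at_right_field intro!: exI[of _ "\<rho> / 2"])
    then show "\<forall>\<^sub>F \<epsilon> in at_right 0. norm ((\<integral>x. indicator (cut_sphere R \<epsilon>) x * f x \<partial>sphere_measure) -
      (\<integral>x. indicator (cut_sphere P \<epsilon>) x * f x \<partial>sphere_measure)) \<le> D * \<epsilon>"
      by eventually_elim (use diff in auto)
    have "((\<lambda>\<epsilon>. D * \<epsilon>) \<longlongrightarrow> D * 0) (at_right 0)" by (intro tendsto_intros)
    then show "((\<lambda>\<epsilon>. D * \<epsilon>) \<longlongrightarrow> 0) (at_right 0)" by simp
  qed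
  from tendsto_diff[OF lim this] show ?thesis by simp
qed

section \<open>Functions with vanishing integral over the absolute\<close>

text \<open>Vanishing in the sense of \<open>has_absolute_integral\<close>, stated for functions on
  the sphere. A common \<open>P\<close> for all terms makes the property stable under linear
  combinations also for principal values.\<close>

definition null_form :: "(real^'n) set \<Rightarrow> (real^'n \<Rightarrow> real) \<Rightarrow> bool" where
  "null_form P f \<longleftrightarrow> f \<in> borel_measurable borel \<and>
    (if CARD('n) = 2 then
       (\<forall>\<epsilon>>0. integrable sphere_measure (\<lambda>x. indicator (cut_sphere P \<epsilon>) x * f x)) \<and>
       ((\<lambda>\<epsilon>. \<integral>x. indicator (cut_sphere P \<epsilon>) x * f x \<partial>sphere_measure) \<longlongrightarrow> 0) (at_right 0)
     else integrable sphere_measure f \<and> (\<integral>x. f x \<partial>sphere_measure) = 0)"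

lemma null_form_add:
  assumes "null_form P f" "null_form P g"
  shows "null_form P (\<lambda>x. f x + g x)"
proof -
  have [measurable]: "f \<in> borel_measurable borel" "g \<in> borel_measurable borel"
    using assms by (auto simp: null_form_def)
  show ?thesis
  proof (cases "CARD('a) = 2")
    case True
    then have i: "integrable sphere_measure (\<lambda>x. indicator (cut_sphere P \<epsilon>) x * f x)"
      "integrable sphere_measure (\<lambda>x. indicator (cut_sphere P \<epsilon>) x * g x)" if "0 < \<epsilon>" for \<epsilon>
      using assms that by (auto simp: null_form_def)
    have l: "((\<lambda>\<epsilon>. \<integral>x. indicator (cut_sphere P \<epsilon>) x * f x \<partial>sphere_measure) \<longlongrightarrow> 0) (at_right 0)"
      "((\<lambda>\<epsilon>. \<integral>x. indicator (cut_sphere P \<epsilon>) x * g x \<partial>sphere_measure) \<longlongrightarrow> 0) (at_right 0)"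
      using assms True by (auto simp: null_form_def)
    have "((\<lambda>\<epsilon>. \<integral>x. indicator (cut_sphere P \<epsilon>) x * (f x + g x) \<partial>sphere_measure) \<longlongrightarrow> 0) (at_right 0)"
    proof (rule Lim_transform_eventually)
      show "((\<lambda>\<epsilon>. (\<integral>x. indicator (cut_sphere P \<epsilon>) x * f x \<partial>sphere_measure) +
          (\<integral>x. indicator (cut_sphere P \<epsilon>) x * g x \<partial>sphere_measure)) \<longlongrightarrow> 0) (at_right 0)"
        using tendsto_add[OF l] by simp
      show "\<forall>\<^sub>F \<epsilon> in at_right 0. (\<integral>x. indicator (cut_sphere P \<epsilon>) x * f x \<partial>sphere_measure) +
          (\<integral>x. indicator (cut_sphere P \<epsilon>) x * g x \<partial>sphere_measure) =
          (\<integral>x. indicator (cut_sphere P \<epsilon>) x * (f x + g x) \<partial>sphere_measure)"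
        using eventually_at_right_less[of "0::real"]
        by eventually_elim (simp add: i distrib_left)
    qed
    then show ?thesis using True i by (simp add: null_form_def distrib_left)
  next
    case False
    then show ?thesis using assms by (simp add: null_form_def)
  qed
qed

lemma null_form_cmult:
  assumes "null_form P f"
  shows "null_form P (\<lambda>x. a * f x)"
proof -
  have e: "indicator (cut_sphere P \<epsilon>) x * (a * f x) = a * (indicator (cut_sphere P \<epsilon>) x * f x)" for \<epsilon> x by simp
  have [measurable]: "f \<in> borel_measurable borel" using assms by (auto simp: null_form_def)
  show ?thesis
    using assms unfolding null_form_def e
    by (auto simp: tendsto_mult_right_zero split: if_splits)
qed

lemma null_form_sum:
  assumes "finite I" "\<And>i. i \<in> I \<Longrightarrow> null_form P (f i)"
  shows "null_form P (\<lambda>x. \<Sum>i\<in>I. f i x)"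
  using assms
proof (induction I rule: finite_induct)
  case empty
  then show ?case by (simp add: null_form_def)
qed (simp add: null_form_add)

text \<open>For \<open>n \<ge> 3\<close> the power -3/4 of \<open>ell z\<close> is integrable, since
  3/2 is less than n - 1, and oddness alone gives the value 0. On the circle it is not covered, and
  the principal value takes over.\<close>

lemma null_form_mirror_odd:
  fixes f :: "real^'n::{finite,wellorder} \<Rightarrow> real"
  assumes n: "2 \<le> CARD('n)"
    and f: "mirror_odd c d Z f" and fm[measurable]: "f \<in> borel_measurable borel"
    and z0: "norm z0 < 1" "c \<bullet> z0 = d" and Z: "finite Z" "\<And>z. z \<in> Z \<Longrightarrow> norm z \<le> 1" "\<And>z. z \<in> Z \<Longrightarrow> c \<bullet> z = d"
    and bound: "\<And>x. norm x = 1 \<Longrightarrow> (\<And>z. z \<in> Z \<Longrightarrow> 0 < ell z x) \<Longrightarrow>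
      \<bar>f x\<bar> \<le> C * (\<Sum>z\<in>Z. ell z x powr (- 3/4))"
    and P: "finite P" "P \<subseteq> sphere 0 1" "{z \<in> Z. norm z = 1} \<subseteq> P"
  shows "null_form P f"
proof (cases "CARD('n) = 2")
  case True
  have "((\<lambda>\<epsilon>. \<integral>x. indicator (cut_sphere P \<epsilon>) x * f x \<partial>sphere_measure) \<longlongrightarrow> 0) (at_right 0)"
    by (rule principal_value_mirror_odd[OF True f fm z0 Z bound P])
  moreover have "\<forall>\<epsilon>>0. integrable sphere_measure (\<lambda>x. indicator (cut_sphere P \<epsilon>) x * f x)"
    by (intro allI impI) (rule integrable_cut_sphere[OF Z(1,2) fm bound P(3)])
  ultimately show ?thesis using True fm unfolding null_form_def by presburger
next
  case False
  have "integrable sphere_measure (\<lambda>x. \<bar>C\<bar> * (\<Sum>z\<in>Z. ell z x powr (- 3/4)))"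
  proof (intro integrable_mult_right Bochner_Integration.integrable_sum)
    fix z assume "z \<in> Z"
    then have "(\<integral>\<^sup>+x. ennreal (ell z x powr - (3/4)) \<partial>sphere_measure) < \<infinity>"
      using Z n False by (intro nn_integral_ell_powr) auto
    then show "integrable sphere_measure (\<lambda>x. ell z x powr (- 3/4))"
      by (intro integrableI_nonneg) auto
  qed
  then have "integrable sphere_measure f"
  proof (rule Bochner_Integration.integrable_bound)
    have "AE x in sphere_measure. \<forall>z\<in>Z. 0 < ell z x"
      using Z AE_ell_pos[OF n] by (subst AE_finite_all) auto
    then show "AE x in sphere_measure. norm (f x) \<le> norm (\<bar>C\<bar> * (\<Sum>z\<in>Z. ell z x powr (- 3/4)))"
      using AE_sphere
    proof eventually_elim
      fix x :: "real^'n::_" assume "\<forall>z\<in>Z. 0 < ell z x" "norm x = 1"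
      then have "\<bar>f x\<bar> \<le> C * (\<Sum>z\<in>Z. ell z x powr (- 3/4))" by (intro bound) auto
      also have "\<dots> \<le> \<bar>C\<bar> * (\<Sum>z\<in>Z. ell z x powr (- 3/4))"
        by (intro mult_right_mono) (auto intro!: sum_nonneg)
      finally show "norm (f x) \<le> norm (\<bar>C\<bar> * (\<Sum>z\<in>Z. ell z x powr (- 3/4)))" by simp
    qed
  qed simp
  moreover have "(\<integral>x. f x \<partial>sphere_measure) = 0" by (rule integral_mirror_odd[OF f fm z0 Z(3)])
  ultimately show ?thesis using False by (simp add: null_form_def)
qed

text \<open>\<open>|z - z'|^2\<close> is at most \<open>4 ell z' x + 4 ell z x\<close>, hence at
  most 8 times the larger of the two. So at every \<open>x\<close> all but the smallest of the
  \<open>ell z x\<close> are bounded below; the 8 reappears in \<open>D\<close>.\<close>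

lemma ell_separation:
  fixes Z :: "(real^'n) set"
  assumes Z: "finite Z" "\<And>z. z \<in> Z \<Longrightarrow> norm z \<le> 1"
  obtains \<delta> where "0 < \<delta>" "\<delta> \<le> 1"
    "\<And>x z z'. norm x = 1 \<Longrightarrow> z \<in> Z \<Longrightarrow> z' \<in> Z \<Longrightarrow> z \<noteq> z' \<Longrightarrow> ell z x \<le> ell z' x \<Longrightarrow> \<delta> \<le> ell z' x"
proof -
  define D where "D = (\<lambda>(z, z'). (norm (z - z'))\<^sup>2 / 8) ` {(z, z'). (z, z') \<in> Z \<times> Z \<and> z \<noteq> z'}"
  have "finite {(z, z'). (z, z') \<in> Z \<times> Z \<and> z \<noteq> z'}"
    by (rule finite_subset[of _ "Z \<times> Z"]) (use Z in auto)
  then have D: "finite D" by (simp add: D_def)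
  define \<delta> where "\<delta> = Min (insert 1 D)"
  show ?thesis
  proof (rule that[of \<delta>])
    show "0 < \<delta>" using D by (auto simp: \<delta>_def D_def)
    show "\<delta> \<le> 1" using D by (simp add: \<delta>_def)
    fix x z z' assume x: "norm (x :: real^'n) = 1" and z: "z \<in> Z" "z' \<in> Z" "z \<noteq> z'" and le: "ell z x \<le> ell z' x"
    have "\<delta> \<le> (norm (z - z'))\<^sup>2 / 8"
      unfolding \<delta>_def using D z by (intro Min_le) (auto simp: D_def)
    also have "(norm (z - z'))\<^sup>2 \<le> (norm (x - z') + norm (x - z))\<^sup>2"
      using norm_triangle_ineq4[of "x - z'" "x - z"] by (intro power_mono) auto
    also have "\<dots> \<le> 2 * (norm (x - z'))\<^sup>2 + 2 * (norm (x - z))\<^sup>2"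
      using sum_squares_bound[of "norm (x - z')" "norm (x - z)"] by (simp add: power2_sum)
    also have "\<dots> \<le> 4 * ell z' x + 4 * ell z x"
      using ell_ge_norm_diff[OF x Z(2)[OF z(1)]] ell_ge_norm_diff[OF x Z(2)[OF z(2)]] by simp
    finally show "\<delta> \<le> ell z' x" using le by simp
  qed
qed

lemma ell_minimum:
  fixes Z :: "(real^'n) set"
  assumes "finite Z" "Z \<noteq> {}"
  obtains z0 where "z0 \<in> Z" "\<And>z. z \<in> Z \<Longrightarrow> ell z0 x \<le> ell z x"
  using arg_min_if_finite(1)[OF assms, of "\<lambda>z. ell z x"] arg_min_least[OF assms, of _ "\<lambda>z. ell z x"] by blast

text \<open>Let \<open>a\<close> be the smallest \<open>ell z x\<close>. The affine factor vanishes
  at that point of the mirror and is O(a^(1/2)), the product contributes a^(-1) and the sum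
  a^(-1/4); altogether this is the power -3/4.\<close>

lemma mirror_bound:
  fixes Z :: "(real^'n) set"
  assumes Z: "finite Z" "\<And>z. z \<in> Z \<Longrightarrow> norm z \<le> 1" "\<And>z. z \<in> Z \<Longrightarrow> c \<bullet> z = d"
  shows "\<exists>C\<ge>0. \<forall>x. norm x = 1 \<longrightarrow> (\<forall>z\<in>Z. 0 < ell z x) \<longrightarrow>
    \<bar>c \<bullet> x - d\<bar> * (\<Prod>z\<in>Z. 1 / ell z x) * (\<Sum>z\<in>Z. ell z x powr (- 1/4)) \<le> C * (\<Sum>z\<in>Z. ell z x powr (- 3/4))"
proof (cases "Z = {}")
  case False
  obtain \<delta> where \<delta>: "0 < \<delta>" "\<delta> \<le> 1"
    and sep: "\<And>x z z'. norm x = 1 \<Longrightarrow> z \<in> Z \<Longrightarrow> z' \<in> Z \<Longrightarrow> z \<noteq> z' \<Longrightarrow> ell z x \<le> ell z' x \<Longrightarrow> \<delta> \<le> ell z' x"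
    using ell_separation[OF Z(1,2)] by blast
  define C where "C = norm c * sqrt 2 * (1 / \<delta>) ^ (card Z - 1) * card Z"
  have "\<bar>c \<bullet> x - d\<bar> * (\<Prod>z\<in>Z. 1 / ell z x) * (\<Sum>z\<in>Z. ell z x powr (- 1/4)) \<le> C * (\<Sum>z\<in>Z. ell z x powr (- 3/4))"
    if x: "norm x = 1" and pos: "\<forall>z\<in>Z. 0 < ell z x" for x
  proof -
    obtain z0 where z0: "z0 \<in> Z" "\<And>z. z \<in> Z \<Longrightarrow> ell z0 x \<le> ell z x"
      using ell_minimum[OF Z(1) False, of x] by blast
    define a where "a = ell z0 x"
    have a: "0 < a" using pos z0 by (simp add: a_def)
    have "c \<bullet> x - d = c \<bullet> (x - z0)" using Z(3)[OF z0(1)] by (simp add: inner_diff_right)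
    then have "\<bar>c \<bullet> x - d\<bar> \<le> norm c * norm (x - z0)" using Cauchy_Schwarz_ineq2[of c "x - z0"] by simp
    also have "norm (x - z0) \<le> sqrt (2 * a)"
      using ell_ge_norm_diff[OF x Z(2)[OF z0(1)]] by (intro real_le_rsqrt) (simp add: a_def)
    also have "sqrt (2 * a) = sqrt 2 * a powr (1/2)" using a by (simp add: real_sqrt_mult powr_half_sqrt)
    finally have 1: "\<bar>c \<bullet> x - d\<bar> \<le> norm c * (sqrt 2 * a powr (1/2))" by (simp add: mult_left_mono)
    have "(\<Prod>z\<in>Z. 1 / ell z x) = 1 / a * (\<Prod>z\<in>Z - {z0}. 1 / ell z x)"
      using Z z0 by (simp add: prod.remove a_def)
    also have "(\<Prod>z\<in>Z - {z0}. 1 / ell z x) \<le> (\<Prod>z\<in>Z - {z0}. 1 / \<delta>)"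
    proof (rule prod_mono)
      fix z assume z: "z \<in> Z - {z0}"
      have "\<delta> \<le> ell z x" using sep[OF x z0(1), of z] z z0(2) by auto
      then show "0 \<le> 1 / ell z x \<and> 1 / ell z x \<le> 1 / \<delta>" using \<delta> by (auto intro!: divide_left_mono)
    qed
    also have "\<dots> = (1 / \<delta>) ^ (card Z - 1)" using Z z0 by (simp add: card_Diff_singleton)
    finally have 2: "(\<Prod>z\<in>Z. 1 / ell z x) \<le> 1 / a * (1 / \<delta>) ^ (card Z - 1)" using a by (simp add: mult_left_mono divide_right_mono)
    have 3: "(\<Sum>z\<in>Z. ell z x powr (- 1/4)) \<le> card Z * a powr (- 1/4)"
    proof (rule sum_bounded_above)
      show "ell z x powr (- 1/4) \<le> a powr (- 1/4)" if "z \<in> Z" for z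
        unfolding a_def using z0(2)[OF that] a by (intro powr_mono2') (auto simp: a_def)
    qed
    have "0 \<le> (\<Prod>z\<in>Z. 1 / ell z x)" using pos by (intro prod_nonneg) (auto simp: less_imp_le)
    then have "\<bar>c \<bullet> x - d\<bar> * (\<Prod>z\<in>Z. 1 / ell z x) * (\<Sum>z\<in>Z. ell z x powr (- 1/4)) \<le>
        norm c * (sqrt 2 * a powr (1/2)) * (1 / a * (1 / \<delta>) ^ (card Z - 1)) * (card Z * a powr (- 1/4))"
      using 1 2 3 a \<delta> by (intro mult_mono) (auto intro!: sum_nonneg mult_nonneg_nonneg)
    also have "\<dots> = C * (a powr (1/2) * a powr (- 1) * a powr (- 1/4))"
      using a by (simp add: C_def powr_minus_divide mult_ac)
    also have "a powr (1/2) * a powr (- 1) * a powr (- 1/4) = a powr (1/2 + - 1 + - 1/4)"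
      by (simp only: powr_add)
    also have "1/2 + - 1 + - 1/4 = (- 3/4 :: real)" by simp
    also have "C * a powr (- 3/4) \<le> C * (\<Sum>z\<in>Z. ell z x powr (- 3/4))"
    proof (intro mult_left_mono)
      show "a powr (- 3/4) \<le> (\<Sum>z\<in>Z. ell z x powr (- 3/4))"
        unfolding a_def using Z z0 by (intro member_le_sum[of z0]) auto
    qed (use \<delta> in \<open>simp add: C_def\<close>)
    finally show ?thesis .
  qed
  moreover have "0 \<le> C" using \<delta> by (simp add: C_def)
  ultimately show ?thesis by blast
qed auto

section \<open>The kernel of a simplex\<close>

text \<open>Parallelogram law. It provides a point of the mirror inside the ball even if all
  vertices on the mirror are ideal.\<close>

lemma norm_midpoint_less:
  fixes a b :: "'a::real_inner"
  assumes "norm a \<le> 1" "norm b \<le> 1" "a \<noteq> b"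
  shows "norm ((1/2) *\<^sub>R (a + b)) < 1"
proof -
  have "(norm (a + b))\<^sup>2 + (norm (a - b))\<^sup>2 = 2 * (norm a)\<^sup>2 + 2 * (norm b)\<^sup>2"
    by (simp add: power2_norm_eq_inner inner_add_left inner_add_right inner_diff_left inner_diff_right inner_commute)
  moreover have "(norm a)\<^sup>2 \<le> 1" "(norm b)\<^sup>2 \<le> 1" using assms by (auto simp: power_le_one)
  moreover have "0 < (norm (a - b))\<^sup>2" using assms by simp
  ultimately have "(norm (a + b))\<^sup>2 < 4" by linarith
  then have "norm (a + b) < 2" using power2_less_imp_less[of "norm (a + b)" 2] by simp
  then show ?thesis by simp
qed

lemma sum_atMost_coord_pos:
  "(\<Sum>k\<le>CARD('n::{finite,wellorder}). f k) = f 0 + (\<Sum>i\<in>UNIV. f (coord_pos (i :: 'n)) :: 'a::comm_monoid_add)"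
proof -
  have "inj (coord_pos :: 'n \<Rightarrow> nat)" "0 \<notin> range (coord_pos :: 'n \<Rightarrow> nat)"
    using coord_pos_bij[where 'n='n] by (auto simp: bij_betw_def)
  then show ?thesis
    unfolding atMost_eq_insert_coord_pos by (simp add: sum.reindex)
qed

text \<open>For \<open>k \<ge> 1\<close> these are the coordinates of \<open>x - y 0\<close> in the
  basis of the rows of \<open>M\<close>, read off with the inverse \<open>B\<close>; the one with
  index 0 completes the sum to 1. The last claim is Cramer's rule for row 1. The form
  \<open>c k \<bullet> x - d k\<close> displays each facet as a hyperplane, ready to serve as a
  mirror.\<close>

lemma barycentric_coordinates:
  fixes y :: "nat \<Rightarrow> real^'n::{finite,wellorder}"
  assumes \<Delta>: "det_rows (\<lambda>i. y i - y 0) \<noteq> 0"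
  obtains c d where
    "\<And>x. (\<Sum>k\<le>CARD('n). c k \<bullet> x - d k) = 1"
    "\<And>x. (\<Sum>k\<le>CARD('n). (c k \<bullet> x - d k) *\<^sub>R y k) = x"
    "\<And>j k. j \<le> CARD('n) \<Longrightarrow> k \<le> CARD('n) \<Longrightarrow> c j \<bullet> y k - d j = (if j = k then 1 else 0)"
    "\<And>x. det_rows ((\<lambda>i. y i - y 0)(1 := x - y 0)) = det_rows (\<lambda>i. y i - y 0) * (c 1 \<bullet> x - d 1)"
proof -
  let ?c = "coord_pos :: 'n \<Rightarrow> nat"
  have inj: "inj ?c" and rng: "range ?c = {1..CARD('n)}"
    using coord_pos_bij[where 'n='n] by (auto simp: bij_betw_def)
  have c0: "?c i \<noteq> 0" for i using rng by (metis atLeastAtMost_iff not_one_le_zero rangeI)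
  have ic: "inv ?c (?c i) = i" for i by (rule inv_f_f[OF inj])
  define M where "M = ((\<chi> i. y (?c i) - y 0) :: real^'n::_^'n::_)"
  have Mi: "M $ i = y (?c i) - y 0" for i by (simp add: M_def)
  have dM: "det M = det_rows (\<lambda>i. y i - y 0)" by (simp add: det_rows_def M_def)
  then have "invertible M" using \<Delta> by (simp add: invertible_det_nz)
  then obtain B where B: "M ** B = mat 1" "B ** M = mat 1" by (auto simp: invertible_def)
  define C where "C k = (if k = 0 then - (\<Sum>i\<in>UNIV. column i B) else column (inv ?c k) B)" for k
  define D where "D k = C k \<bullet> y 0 - (if k = 0 then 1 else 0)" for k
  define g where "g v = v v* B" for v
  have g: "column i B \<bullet> v = g v $ i" for i v
    by (simp add: g_def vector_matrix_mult_def column_def inner_vec_def mult.commute)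
  have b: "C (?c i) \<bullet> x - D (?c i) = g (x - y 0) $ i" for i x
    using c0[of i] by (simp add: C_def D_def ic inner_diff_right flip: g)
  have b0: "C 0 \<bullet> x - D 0 = 1 - (\<Sum>i\<in>UNIV. g (x - y 0) $ i)" for x
    by (simp add: C_def D_def inner_sum_left inner_diff_right sum_subtractf flip: g)
  have gM: "(\<Sum>i\<in>UNIV. g v $ i *\<^sub>R M $ i) = v" for v
  proof -
    have "(\<Sum>i\<in>UNIV. g v $ i *\<^sub>R M $ i) = g v v* M"
      by (simp add: vec_eq_iff vector_matrix_mult_def mult.commute)
    also have "\<dots> = v v* (B ** M)" by (simp add: g_def vector_matrix_mul_assoc)
    finally show ?thesis by (simp add: B)
  qed
  have gMi: "g (M $ l) $ i = (if l = i then 1 else 0)" for l i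
  proof -
    have "g (M $ l) $ i = (M ** B) $ l $ i"
      by (simp add: g_def vector_matrix_mult_def matrix_matrix_mult_def mult.commute)
    then show ?thesis by (simp add: B mat_def)
  qed
  have g0: "g 0 $ i = 0" for i by (simp add: g_def vector_matrix_mult_def)
  show ?thesis
  proof (rule that[of C D])
    show "(\<Sum>k\<le>CARD('n). C k \<bullet> x - D k) = 1" for x
      by (simp add: sum_atMost_coord_pos b b0)
    show "(\<Sum>k\<le>CARD('n). (C k \<bullet> x - D k) *\<^sub>R y k) = x" for x
    proof -
      have "(\<Sum>k\<le>CARD('n). (C k \<bullet> x - D k) *\<^sub>R y k) =
          y 0 + (\<Sum>i\<in>UNIV. g (x - y 0) $ i *\<^sub>R M $ i)"
        by (simp only: sum_atMost_coord_pos b b0 Mi)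
          (simp add: scaleR_left_diff_distrib scaleR_diff_right sum_subtractf scaleR_sum_left)
      then show ?thesis by (simp add: gM)
    qed
    show "C j \<bullet> y k - D j = (if j = k then 1 else 0)" if jk: "j \<le> CARD('n)" "k \<le> CARD('n)" for j k
    proof -
      have k: "k = 0 \<or> (\<exists>l. k = ?c l)" and j: "j = 0 \<or> (\<exists>i. j = ?c i)"
        using jk atMost_eq_insert_coord_pos[where 'n='n] by blast+
      show ?thesis
        using k
      proof
        assume "k = 0"
        moreover have "C (?c i) \<bullet> y 0 = D (?c i)" for i using b[of i "y 0"] g0 by simp
        ultimately show ?thesis using j c0 by (auto simp: b0 g0)
      next
        assume "\<exists>l. k = ?c l"
        then obtain l where l: "k = ?c l" by blast
        have "g (y k - y 0) $ i = (if l = i then 1 else 0)" for i using gMi[of l i] by (simp add: l Mi)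
        then have bi: "C (?c i) \<bullet> y k - D (?c i) = (if l = i then 1 else 0)" for i by (simp only: b)
        have bz: "C 0 \<bullet> y k - D 0 = 0" using \<open>\<And>i. g (y k - y 0) $ i = _\<close> by (simp only: b0) simp
        from j show ?thesis
        proof
          assume "j = 0"
          then show ?thesis using bz c0[of l] l by simp
        next
          assume "\<exists>i. j = ?c i"
          then obtain i where i: "j = ?c i" by blast
          have "j = k \<longleftrightarrow> l = i" unfolding i l using inj by (auto dest: injD)
          then show ?thesis using bi[of i] by (simp only: i)
        qed
      qed
    qed
    show "det_rows ((\<lambda>i. y i - y 0)(1 := x - y 0)) = det_rows (\<lambda>i. y i - y 0) * (C 1 \<bullet> x - D 1)" for x
    proof -
      have "1 \<in> range ?c" using rng by (simp add: Suc_le_eq)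
      then obtain k where k: "?c k = 1" by force
      have ck: "?c i = 1 \<longleftrightarrow> i = k" for i using k inj by (metis injD)
      have "(\<Sum>i\<in>UNIV. g (x - y 0) $ i *s row i M) = x - y 0"
        using gM[of "x - y 0"] by (simp add: row_def scalar_mult_eq_scaleR vec_lambda_eta)
      then have "(\<chi> i. ((\<lambda>i. y i - y 0)(1 := x - y 0)) (?c i)) =
          (\<chi> i. if i = k then \<Sum>i\<in>UNIV. g (x - y 0) $ i *s row i M else row i M)"
        by (simp add: vec_eq_iff ck row_def M_def del: One_nat_def)
      then have "det_rows ((\<lambda>i. y i - y 0)(1 := x - y 0)) = g (x - y 0) $ k * det M"
        unfolding det_rows_def by (simp only: cramer_lemma_transpose)
      then show ?thesis using b[of k x] k dM by simp
    qed
  qed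
qed

text \<open>Linearity of the determinant in row 1. It replaces the barycentric coordinate of index 1
  when the simplex is degenerate.\<close>

lemma det_rows_affine:
  fixes y :: "nat \<Rightarrow> real^'n::{finite,wellorder}"
  obtains c where "\<And>x. det_rows ((\<lambda>i. y i - y 0)(1 := x - y 0)) = c \<bullet> x - c \<bullet> y 0"
proof -
  let ?c = "coord_pos :: 'n \<Rightarrow> nat"
  have inj: "inj ?c" and rng: "range ?c = {1..CARD('n)}"
    using coord_pos_bij[where 'n='n] by (auto simp: bij_betw_def)
  have "1 \<in> range ?c" using rng by (simp add: Suc_le_eq)
  then obtain k where k: "?c k = 1" by force
  have ck: "?c i = 1 \<longleftrightarrow> i = k" for i using k inj by (metis injD)
  define F where "F v = det (\<chi> i. if i = k then v else y (?c i) - y 0)" for v :: "real^'n::_"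
  have dF: "det_rows ((\<lambda>i. y i - y 0)(1 := v)) = F v" for v
    unfolding det_rows_def F_def
    by (rule arg_cong[of _ _ det]) (simp add: vec_eq_iff ck del: One_nat_def)
  have "linear F"
  proof (rule linearI)
    show "F (u + v) = F u + F v" for u v by (simp add: F_def det_row_add)
    show "F (r *\<^sub>R v) = r *\<^sub>R F v" for r v
      unfolding F_def real_scaleR_def scalar_mult_eq_scaleR[symmetric] by (rule det_row_mul)
  qed
  define C where "C = (\<chi> j. F (axis j 1))"
  have FC: "F v = C \<bullet> v" for v
  proof -
    have "F v = F (\<Sum>j\<in>UNIV. v $ j *s axis j 1)" by (simp only: basis_expansion)
    also have "\<dots> = (\<Sum>j\<in>UNIV. v $ j * F (axis j 1))"
      using \<open>linear F\<close> by (simp add: linear_sum linear_scale scalar_mult_eq_scaleR)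
    finally show ?thesis by (simp add: C_def inner_vec_def mult.commute)
  qed
  show ?thesis by (rule that[of C]) (simp only: dF FC inner_diff_right)
qed

lemma det_rows_eq_rows:
  fixes v :: "nat \<Rightarrow> real^'n::{finite,wellorder}"
  assumes "i \<in> {1..CARD('n)}" "j \<in> {1..CARD('n)}" "i \<noteq> j" "v i = v j"
  shows "det_rows v = 0"
proof -
  have "i \<in> range (coord_pos :: 'n \<Rightarrow> nat)" "j \<in> range (coord_pos :: 'n \<Rightarrow> nat)"
    using assms coord_pos_bij[where 'n='n] by (auto simp: bij_betw_def)
  then obtain a b :: 'n where "i = coord_pos a" "j = coord_pos b" by blast
  then show ?thesis
    using assms unfolding det_rows_def
    by (intro det_identical_rows[of a b]) (auto simp: row_def vec_lambda_eta)
qed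

lemma det_rows_zero_row:
  fixes v :: "nat \<Rightarrow> real^'n::{finite,wellorder}"
  assumes "i \<in> {1..CARD('n)}" "v i = 0"
  shows "det_rows v = 0"
proof -
  have "i \<in> range (coord_pos :: 'n \<Rightarrow> nat)"
    using assms coord_pos_bij[where 'n='n] by (auto simp: bij_betw_def)
  then obtain a :: 'n where "i = coord_pos a" by blast
  then show ?thesis
    using assms unfolding det_rows_def by (intro det_zero_row[of a]) (simp add: row_def vec_eq_iff)
qed

lemma Reg_cong: "r \<in> I \<Longrightarrow> (\<And>k. k \<in> I \<Longrightarrow> a k = b k) \<Longrightarrow> Reg I r a = Reg I r b"
  unfolding Reg_def reg_def by (simp cong: prod.cong)

lemma borel_measurable_Reg_ell [measurable]:
  fixes y :: "nat \<Rightarrow> real^'n"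
  shows "(\<lambda>x. Reg I r (\<lambda>k. ell (y k) x)) \<in> borel_measurable borel"
  unfolding Reg_def set_lebesgue_integral_def reg_def
  by (rule lborel.borel_measurable_lebesgue_integral) measurable

lemma ell_eq_0_iff:
  assumes "norm x = 1" "norm z \<le> 1" "ell z x \<le> 0"
  shows "x = z"
  using ell_pos[OF assms(1,2)] assms(3) by force

text \<open>The reflection multiplies the affine factor by \<open>- 1 / t\<close> and each of the
  \<open>n\<close> denominators by \<open>1 / t\<close> and leaves \<open>g\<close> unchanged, so
  the quotient acquires the weight \<open>t ^ (n - 1)\<close> demanded by \<open>mirror_odd\<close>.
  \<open>Z\<close> may contain one point \<open>p\<close> besides the vertices in the denominator:
  in the degenerate case \<open>g\<close> involves the logarithm at one more vertex.\<close>

lemma null_form_quotient: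
  fixes y :: "nat \<Rightarrow> real^'n::{finite,wellorder}"
  assumes n: "2 \<le> CARD('n)" and Z: "finite Z" "\<And>z. z \<in> Z \<Longrightarrow> norm z \<le> 1" "\<And>z. z \<in> Z \<Longrightarrow> c \<bullet> z = d"
    and I: "finite I" "card I = CARD('n)" "inj_on y I" "y ` I \<subseteq> Z" "Z \<subseteq> insert p (y ` I)"
    and g[measurable]: "g \<in> borel_measurable borel"
    and g_inv: "\<And>x x' t. norm x = 1 \<Longrightarrow> norm x' = 1 \<Longrightarrow> 0 < t \<Longrightarrow> (\<And>z. z \<in> Z \<Longrightarrow> 0 < ell z x) \<Longrightarrow>
      (\<And>z. z \<in> Z \<Longrightarrow> ell z x' = ell z x / t) \<Longrightarrow> g x' = g x"
    and g_bound: "\<And>x. norm x = 1 \<Longrightarrow> (\<And>z. z \<in> Z \<Longrightarrow> 0 < ell z x) \<Longrightarrow>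
      \<bar>g x\<bar> \<le> K * (\<Sum>z\<in>Z. ell z x powr (- 1/4))"
    and P: "finite P" "P \<subseteq> sphere 0 1" "{z \<in> Z. norm z = 1} \<subseteq> P"
  shows "null_form P (\<lambda>x. (c \<bullet> x - d) * g x / (\<Prod>k\<in>I. ell (y k) x))"
proof -
  let ?f = "\<lambda>x. (c \<bullet> x - d) * g x / (\<Prod>k\<in>I. ell (y k) x)"
  obtain C where C: "0 \<le> C" "\<And>x. norm x = 1 \<Longrightarrow> (\<forall>z\<in>Z. 0 < ell z x) \<Longrightarrow>
    \<bar>c \<bullet> x - d\<bar> * (\<Prod>z\<in>Z. 1 / ell z x) * (\<Sum>z\<in>Z. ell z x powr (- 1/4)) \<le> C * (\<Sum>z\<in>Z. ell z x powr (- 3/4))"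
    using mirror_bound[OF Z] by blast
  have "2 \<le> card I" using I n by simp
  then obtain k l where kl: "k \<in> I" "l \<in> I" "k \<noteq> l"
    by (metis card_le_Suc0_iff_eq I(1) not_less_eq_eq numeral_2_eq_2)
  then have ykl: "y k \<noteq> y l" "y k \<in> Z" "y l \<in> Z" using I by (auto dest: inj_onD)
  show ?thesis
  proof (rule null_form_mirror_odd[OF n _ _ _ _ Z _ P])
    show "norm ((1/2) *\<^sub>R (y k + y l)) < 1" using ykl Z(2) by (intro norm_midpoint_less) auto
    show "c \<bullet> ((1/2) *\<^sub>R (y k + y l)) = d" using Z(3)[OF ykl(2)] Z(3)[OF ykl(3)] by (simp add: inner_add_right)
    show "?f \<in> borel_measurable borel" by measurable
    show "mirror_odd c d Z ?f"
      unfolding mirror_odd_def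
    proof (intro allI impI)
      fix x x' :: "real^'n::_" and t
      assume x: "norm x = 1" "norm x' = 1" "0 < t" and b: "c \<bullet> x' - d = - (c \<bullet> x - d) / t"
        and e: "\<forall>z\<in>Z. ell z x' = ell z x / t"
      show "?f x' = - (t ^ (CARD('n) - 1)) * ?f x"
      proof (cases "\<forall>z\<in>Z. 0 < ell z x")
        case True
        then have "g x' = g x" using g_inv[OF x] e by blast
        moreover have "(\<Prod>k\<in>I. ell (y k) x') = (\<Prod>k\<in>I. ell (y k) x) / t ^ CARD('n)"
        proof -
          have "(\<Prod>k\<in>I. ell (y k) x') = (\<Prod>k\<in>I. ell (y k) x / t)" using e I by (intro prod.cong) auto
          then show ?thesis by (simp add: prod_dividef I)
        qed
        moreover have "t ^ CARD('n) = t * t ^ (CARD('n) - 1)"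
          using n by (metis One_nat_def Suc_pred power_Suc zero_less_card_finite)
        moreover have "(- b / t) * G / (Q / (t * T)) = - T * (b * G / Q)" for b G Q T :: real
          using x(3) by (cases "Q = 0") (simp_all add: field_simps)
        ultimately show ?thesis unfolding b by (simp only:)
      next
        \<comment> \<open>Here \<open>x\<close> is itself one of the points of the mirror, so the
          affine factor vanishes on both sides.\<close>
        case False
        then obtain z where "z \<in> Z" "x = z" using ell_eq_0_iff[OF x(1) Z(2)] by (meson not_le)
        then have "c \<bullet> x - d = 0" using Z(3) by simp
        then show ?thesis unfolding b by simp
      qed
    qed
    fix x :: "real^'n::_" assume x: "norm x = 1" and pos: "\<And>z. z \<in> Z \<Longrightarrow> 0 < ell z x"
    have "(\<Prod>k\<in>I. 1 / ell (y k) x) = (\<Prod>z\<in>y ` I. 1 / ell z x)"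
      using I by (simp add: prod.reindex)
    also have "\<dots> \<le> 2 * (\<Prod>z\<in>Z. 1 / ell z x)"
    proof (cases "Z = y ` I")
      case True
      have "0 \<le> (\<Prod>z\<in>Z. 1 / ell z x)" using pos by (intro prod_nonneg) (auto simp: less_imp_le)
      then show ?thesis using True by simp
    next
      case False
      then have Zp: "Z = insert p (y ` I)" "p \<notin> y ` I" using I by auto
      \<comment> \<open>As \<open>ell p x \<le> 2\<close>, including the additional factor
        \<open>1 / ell p x\<close> costs at most a factor 2.\<close>
      have "1 \<le> 2 * (1 / ell p x)"
        using pos[of p] ell_le_2[OF x Z(2)[of p]] Zp by (simp add: field_simps)
      moreover have "0 \<le> (\<Prod>z\<in>y ` I. 1 / ell z x)" using pos Zp by (intro prod_nonneg) (auto simp: less_imp_le)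
      ultimately have "1 * (\<Prod>z\<in>y ` I. 1 / ell z x) \<le> 2 * (1 / ell p x) * (\<Prod>z\<in>y ` I. 1 / ell z x)"
        by (rule mult_right_mono)
      then show ?thesis unfolding Zp(1) using I Zp by (simp add: mult.assoc)
    qed
    finally have 1: "(\<Prod>k\<in>I. 1 / ell (y k) x) \<le> 2 * (\<Prod>z\<in>Z. 1 / ell z x)" .
    have p0: "0 \<le> (\<Prod>k\<in>I. 1 / ell (y k) x)" using pos I by (intro prod_nonneg) (auto simp: less_imp_le image_subset_iff)
    have "\<bar>?f x\<bar> = \<bar>c \<bullet> x - d\<bar> * (\<Prod>k\<in>I. 1 / ell (y k) x) * \<bar>g x\<bar>"
      using p0 by (simp add: abs_mult prod_dividef)
    also have "\<dots> \<le> \<bar>c \<bullet> x - d\<bar> * (2 * (\<Prod>z\<in>Z. 1 / ell z x)) * (K * (\<Sum>z\<in>Z. ell z x powr (- 1/4)))"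
      using 1 g_bound[OF x pos] p0 by (intro mult_mono) (auto intro: order_trans)
    also have "\<dots> \<le> \<bar>c \<bullet> x - d\<bar> * (2 * (\<Prod>z\<in>Z. 1 / ell z x)) * (\<bar>K\<bar> * (\<Sum>z\<in>Z. ell z x powr (- 1/4)))"
      using 1 p0 by (intro mult_left_mono mult_right_mono) (auto intro!: sum_nonneg order_trans[OF p0 1] mult_nonneg_nonneg)
    also have "\<dots> = 2 * \<bar>K\<bar> * (\<bar>c \<bullet> x - d\<bar> * (\<Prod>z\<in>Z. 1 / ell z x) * (\<Sum>z\<in>Z. ell z x powr (- 1/4)))"
      by simp
    also have "\<dots> \<le> 2 * \<bar>K\<bar> * (C * (\<Sum>z\<in>Z. ell z x powr (- 3/4)))"
      using C(2)[OF x] pos by (intro mult_left_mono) auto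
    finally show "\<bar>?f x\<bar> \<le> 2 * \<bar>K\<bar> * C * (\<Sum>z\<in>Z. ell z x powr (- 3/4))" by (simp add: mult.assoc)
  qed
qed

lemma one_le_powr_quarter:
  fixes a :: real
  assumes "0 < a" "a \<le> 2"
  shows "1 \<le> 2 * a powr (- 1/4)"
proof -
  have "(1/2 :: real) = 2 powr (- 1)" by (simp add: powr_minus_divide)
  also have "\<dots> \<le> 2 powr (- 1/4)" by (intro powr_mono) auto
  also have "\<dots> \<le> a powr (- 1/4)" using assms by (intro powr_mono2') auto
  finally show ?thesis by simp
qed

text \<open>The inequality ln s \<le> s - 1 at s = \<open>a\<close> for large \<open>a\<close>, and
  at s = \<open>a powr (- 1/4)\<close> for small \<open>a\<close>.\<close>

lemma abs_ln_le_powr_quarter: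
  fixes a :: real
  assumes "0 < a" "a \<le> 2"
  shows "\<bar>ln a\<bar> \<le> 4 * a powr (- 1/4)"
proof (cases "1 \<le> a")
  case True
  have "ln a \<le> a - 1" using assms by (intro ln_le_minus_one)
  then show ?thesis using one_le_powr_quarter[OF assms] assms True by simp
next
  case False
  have "ln (a powr (- 1/4)) \<le> a powr (- 1/4) - 1" using assms by (intro ln_le_minus_one) auto
  moreover have "ln (a powr (- 1/4)) = - 1/4 * ln a" using assms by (simp add: ln_powr)
  moreover have "ln a \<le> 0" using False assms by simp
  ultimately show ?thesis by simp
qed

lemma hyp_density_nonneg: "0 \<le> hyp_density y"
  by (simp add: hyp_density_def)

lemma borel_measurable_hyp_density [measurable]: "hyp_density \<in> borel_measurable borel"
  unfolding hyp_density_def[abs_def] lorentz_Q_eq lorentz_def by measurable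

lemma geodesic_simplex_borel [measurable]: "geodesic_simplex y \<in> sets borel"
proof -
  have "compact (geodesic_simplex y)"
    unfolding geodesic_simplex_def by (intro compact_convex_hull finite_imp_compact) simp
  then show ?thesis by (simp add: compact_imp_closed)
qed

lemma geodesic_simplex_subset_cball:
  fixes y :: "nat \<Rightarrow> real^'n"
  assumes "\<And>k. k \<le> CARD('n) \<Longrightarrow> norm (y k) \<le> 1"
  shows "geodesic_simplex y \<subseteq> cball 0 1"
  unfolding geodesic_simplex_def by (rule hull_minimal) (use assms in auto)

section \<open>The kernel, its integral over the sphere, and the volume\<close>

definition simplex_kernel :: "(nat \<Rightarrow> real^'n) \<Rightarrow> real^'n \<Rightarrow> real" where
  "simplex_kernel y x = (LINT u:{0<..}|lborel. 1 / (\<Prod>k\<le>CARD('n). ell (y k) x + u))"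

lemma borel_measurable_simplex_kernel [measurable]: "simplex_kernel y \<in> borel_measurable borel"
  unfolding simplex_kernel_def[abs_def] set_lebesgue_integral_def
  by (rule lborel.borel_measurable_lebesgue_integral) measurable

lemma barycentric_inj:
  fixes y :: "nat \<Rightarrow> real^'n::{finite,wellorder}"
  assumes "det_rows (\<lambda>i. y i - y 0) \<noteq> 0"
  shows "inj_on y {..CARD('n)}"
proof -
  obtain c d where cd: "\<And>j k. j \<le> CARD('n) \<Longrightarrow> k \<le> CARD('n) \<Longrightarrow> c j \<bullet> y k - d j = (if j = k then 1 else 0 :: real)"
    using barycentric_coordinates[OF assms] by metis
  show ?thesis
  proof (rule inj_onI)
    fix j k assume jk: "j \<in> {..CARD('n)}" "k \<in> {..CARD('n)}" "y j = y k"
    then have "c j \<bullet> y j - d j = c j \<bullet> y k - d j" by simp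
    then show "j = k" using cd[of j j] cd[of j k] jk by (simp split: if_splits)
  qed
qed

text \<open>By \<open>ell_separation\<close> at most one factor is small at any given
  \<open>x\<close>, and a second vertex \<open>l\<close> is available for the decay in
  \<open>u\<close>, so \<open>inverse_prod_bound\<close> applies at the vertex with the smallest
  \<open>ell\<close>.\<close>

lemma simplex_kernel_bound:
  fixes y :: "nat \<Rightarrow> real^'n::{finite,wellorder}"
  assumes y: "\<And>k. k \<le> CARD('n) \<Longrightarrow> norm (y k) \<le> 1" and inj: "inj_on y {..CARD('n)}"
  shows "\<exists>C. \<forall>x. norm x = 1 \<longrightarrow> (\<forall>k\<le>CARD('n). 0 < ell (y k) x) \<longrightarrow>
    set_integrable lborel {0<..} (\<lambda>u. 1 / (\<Prod>k\<le>CARD('n). ell (y k) x + u)) \<and>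
    \<bar>simplex_kernel y x\<bar> \<le> C * (\<Sum>k\<le>CARD('n). ell (y k) x powr - (1/4))"
proof -
  let ?I = "{..CARD('n)}" and ?Z = "y ` {..CARD('n)}"
  obtain \<delta> where \<delta>: "0 < \<delta>" "\<delta> \<le> 1"
    and sep: "\<And>x z z'. norm x = 1 \<Longrightarrow> z \<in> ?Z \<Longrightarrow> z' \<in> ?Z \<Longrightarrow> z \<noteq> z' \<Longrightarrow> ell z x \<le> ell z' x \<Longrightarrow> \<delta> \<le> ell z' x"
    by (rule ell_separation[of ?Z]) (use y in auto)
  define C where "C = (1 / \<delta>) ^ (card ?I - 1) * reg_const"
  have "set_integrable lborel {0<..} (\<lambda>u. 1 / (\<Prod>k\<le>CARD('n). ell (y k) x + u)) \<and>
      \<bar>simplex_kernel y x\<bar> \<le> C * (\<Sum>k\<le>CARD('n). ell (y k) x powr - (1/4))"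
    if x: "norm x = 1" and pos: "\<forall>k\<le>CARD('n). 0 < ell (y k) x" for x
  proof -
    obtain z0 where "z0 \<in> ?Z" "\<And>z. z \<in> ?Z \<Longrightarrow> ell z0 x \<le> ell z x"
      by (rule ell_minimum[of ?Z x]) auto
    then obtain k0 where k0: "k0 \<in> ?I" "\<And>k. k \<in> ?I \<Longrightarrow> ell (y k0) x \<le> ell (y k) x" by auto
    obtain l where l: "l \<in> ?I" "l \<noteq> k0"
    proof (cases "k0 = 0")
      case True
      then show ?thesis using that[of 1] by (simp add: Suc_le_eq)
    qed (use that[of 0] in simp)
    define a where "a k = ell (y k) x" for k
    have b: "\<bar>1 / (\<Prod>k\<in>?I. a k + u)\<bar> \<le> (1 / \<delta>) ^ (card ?I - 1) * a k0 powr (- 1/4) * reg_kernel u" if u: "0 < u" for u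
    proof -
      have "0 < (\<Prod>k\<in>?I. a k + u)" using pos u by (intro prod_pos) (auto simp: a_def intro: add_pos_pos)
      moreover have "1 / (\<Prod>k\<in>?I. a k + u) \<le> (1 / \<delta>) ^ (card ?I - 1) * a k0 powr (- 1/4) * reg_kernel u"
      proof (rule inverse_prod_bound[OF _ k0(1) l])
        fix k assume "k \<in> ?I - {k0}"
        then show "\<delta> \<le> a k"
          unfolding a_def using sep[OF x, of "y k0" "y k"] k0 inj by (auto dest: inj_onD)
      qed (use pos k0 \<delta> u in \<open>auto simp: a_def\<close>)
      ultimately show ?thesis by simp
    qed
    have m: "(\<lambda>u. 1 / (\<Prod>k\<in>?I. a k + u)) \<in> borel_measurable borel" by measurable
    have s: "set_integrable lborel {0<..} (\<lambda>u. 1 / (\<Prod>k\<le>CARD('n). a k + u))"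
      by (rule set_integrable_reg_kernel_bound(1)[OF m b])
    have "\<bar>simplex_kernel y x\<bar> \<le> (1 / \<delta>) ^ (card ?I - 1) * a k0 powr (- 1/4) * reg_const"
      unfolding simplex_kernel_def a_def[symmetric] by (rule set_integrable_reg_kernel_bound(2)[OF m b])
    also have "\<dots> = C * a k0 powr - (1/4)" by (simp add: C_def mult_ac)
    also have "\<dots> \<le> C * (\<Sum>k\<in>?I. a k powr - (1/4))"
      using k0 \<delta> reg_const_nonneg by (intro mult_left_mono member_le_sum) (auto simp: C_def)
    finally show ?thesis using s by (simp add: a_def)
  qed
  then show ?thesis by blast
qed

text \<open>Fubini is applied to nonnegative integrals, before the volume is known to be finite.
  Finiteness for ideal vertices is then a consequence of the integrability of the kernel over the
  sphere.\<close>

lemma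
  fixes y :: "nat \<Rightarrow> real^'n::{finite,wellorder}"
  assumes n: "2 \<le> CARD('n)" and y: "\<And>k. k \<le> CARD('n) \<Longrightarrow> norm (y k) \<le> 1"
    and \<Delta>: "det_rows (\<lambda>i. y i - y 0) \<noteq> 0"
  shows integrable_simplex_kernel: "integrable sphere_measure (simplex_kernel y)"
    and integral_simplex_kernel: "\<bar>det_rows (\<lambda>i. y i - y 0)\<bar> * (\<integral>x. simplex_kernel y x \<partial>sphere_measure) =
      fact (CARD('n) - 1) * (CARD('n) * unit_ball_vol CARD('n)) *
        set_lebesgue_integral lborel (geodesic_simplex y) hyp_density"
proof -
  let ?n = "CARD('n)" and ?\<Delta> = "det_rows (\<lambda>i. y i - y 0)" and ?T = "geodesic_simplex y"
    and ?v = "CARD('n) * unit_ball_vol CARD('n)" and ?G = "simplex_kernel y"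
  have inj: "inj_on y {..?n}" by (rule barycentric_inj[OF \<Delta>])
  obtain C where C: "\<And>x. norm x = 1 \<Longrightarrow> (\<forall>k\<le>?n. 0 < ell (y k) x) \<Longrightarrow>
      set_integrable lborel {0<..} (\<lambda>u. 1 / (\<Prod>k\<le>?n. ell (y k) x + u)) \<and>
      \<bar>?G x\<bar> \<le> C * (\<Sum>k\<le>?n. ell (y k) x powr - (1/4))"
    using simplex_kernel_bound[OF y inj] by blast
  have AEpos: "AE x in sphere_measure. \<forall>k\<le>?n. 0 < ell (y k) x"
  proof -
    have "AE x in sphere_measure. \<forall>k\<in>{..?n}. 0 < ell (y k) x"
      using y AE_ell_pos[OF n] by (subst AE_finite_all) auto
    then show ?thesis by eventually_elim auto
  qed
  show int: "integrable sphere_measure ?G"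
  proof (rule Bochner_Integration.integrable_bound)
    show "integrable sphere_measure (\<lambda>x. \<bar>C\<bar> * (\<Sum>k\<le>?n. ell (y k) x powr - (1/4)))"
    proof (intro integrable_mult_right Bochner_Integration.integrable_sum)
      fix k assume "k \<in> {..?n}"
      then have "(\<integral>\<^sup>+x. ennreal (ell (y k) x powr - (1/4)) \<partial>sphere_measure) < \<infinity>"
        using y n by (intro nn_integral_ell_powr) auto
      then show "integrable sphere_measure (\<lambda>x. ell (y k) x powr - (1/4))"
        by (intro integrableI_nonneg) auto
    qed
    show "AE x in sphere_measure. norm (?G x) \<le> norm (\<bar>C\<bar> * (\<Sum>k\<le>?n. ell (y k) x powr - (1/4)))"
      using AEpos AE_sphere
    proof eventually_elim
      fix x :: "real^'n::_" assume x: "\<forall>k\<le>?n. 0 < ell (y k) x" "norm x = 1"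
      have "\<bar>?G x\<bar> \<le> C * (\<Sum>k\<le>?n. ell (y k) x powr - (1/4))" using C x by blast
      also have "\<dots> \<le> \<bar>C\<bar> * (\<Sum>k\<le>?n. ell (y k) x powr - (1/4))"
        by (intro mult_right_mono sum_nonneg) auto
      finally show "norm (?G x) \<le> norm (\<bar>C\<bar> * (\<Sum>k\<le>?n. ell (y k) x powr - (1/4)))" by simp
    qed
  qed measurable
  have Gnn: "0 \<le> ?G x" if "\<forall>k\<le>?n. 0 < ell (y k) x" for x
    unfolding simplex_kernel_def set_lebesgue_integral_def
    by (intro integral_nonneg_AE AE_I2) (use that in \<open>auto simp: indicator_def intro!: prod_nonneg prod_pos add_nonneg_nonneg add_pos_pos less_imp_le\<close>)
  have nnG: "(\<integral>\<^sup>+u. ennreal (1 / (\<Prod>k\<le>?n. ell (y k) x + u)) * indicator {0<..} u \<partial>lborel) = ennreal (?G x)"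
    if x: "norm x = 1" "\<forall>k\<le>?n. 0 < ell (y k) x" for x
  proof -
    have "(\<integral>\<^sup>+u. ennreal (1 / (\<Prod>k\<le>?n. ell (y k) x + u)) * indicator {0<..} u \<partial>lborel) =
        (\<integral>\<^sup>+u. ennreal (indicator {0<..} u *\<^sub>R (1 / (\<Prod>k\<le>?n. ell (y k) x + u))) \<partial>lborel)"
      by (intro nn_integral_cong) (auto simp: indicator_def)
    also have "\<dots> = ennreal (?G x)"
      unfolding simplex_kernel_def set_lebesgue_integral_def
      by (intro nn_integral_eq_integral)
        (use C[OF x] x in \<open>auto simp: set_integrable_def indicator_def intro!: prod_nonneg prod_pos add_nonneg_nonneg add_pos_pos less_imp_le\<close>)
    finally show ?thesis .
  qed
  interpret S: finite_measure "sphere_measure :: (real^'n::_) measure" by (rule finite_measure_sphere)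
  interpret pair_sigma_finite lborel "sphere_measure :: (real^'n::_) measure"
    by standard
  \<comment> \<open>The formula for the density concerns interior points; ideal points of the
    simplex lie on the sphere, a null set.\<close>
  have AET: "AE z in lborel. z \<in> ?T \<longrightarrow> norm z < 1"
  proof -
    have "negligible (sphere (0::real^'n::_) 1)" by (rule negligible_sphere)
    then have "AE z in lebesgue. (z::real^'n::_) \<notin> sphere 0 1"
      by (intro AE_not_in) (simp add: negligible_iff_null_sets)
    then have "AE z in lborel. (z::real^'n::_) \<notin> sphere 0 1" by (simp add: AE_completion_iff)
    then show ?thesis
      by eventually_elim (use geodesic_simplex_subset_cball[of y, OF y] in force)
  qed
  have "ennreal ?v * (\<integral>\<^sup>+z. indicator ?T z * ennreal (hyp_density z) \<partial>lborel) =
      (\<integral>\<^sup>+z. \<integral>\<^sup>+x. indicator ?T z * ennreal (1 / ell z x ^ ?n) \<partial>sphere_measure \<partial>lborel)"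
    unfolding nn_integral_cmult[symmetric, of _ lborel "ennreal ?v"]
  proof (subst nn_integral_cmult[symmetric], measurable, rule nn_integral_cong_AE, use AET in eventually_elim)
    fix z assume z: "z \<in> ?T \<longrightarrow> norm z < 1"
    show "ennreal ?v * (indicator ?T z * ennreal (hyp_density z)) =
        (\<integral>\<^sup>+x. indicator ?T z * ennreal (1 / ell z x ^ ?n) \<partial>sphere_measure)"
    proof (cases "z \<in> ?T")
      case True
      then show ?thesis using nn_integral_ell_power_card[of z] z by simp
    qed simp
  qed
  also have "\<dots> = (\<integral>\<^sup>+x. \<integral>\<^sup>+z. indicator ?T z * ennreal (1 / ell z x ^ ?n) \<partial>lborel \<partial>sphere_measure)"
    unfolding ell_def by (rule Fubini'[symmetric]) measurable
  finally have fin: "ennreal ?v * (\<integral>\<^sup>+z. indicator ?T z * ennreal (hyp_density z) \<partial>lborel) =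
      (\<integral>\<^sup>+x. \<integral>\<^sup>+z. indicator ?T z * ennreal (1 / ell z x ^ ?n) \<partial>lborel \<partial>sphere_measure)" .
  have "ennreal (fact (?n - 1)) * (ennreal ?v * (\<integral>\<^sup>+z. indicator ?T z * ennreal (hyp_density z) \<partial>lborel)) =
      (\<integral>\<^sup>+x. ennreal (fact (?n - 1)) * (\<integral>\<^sup>+z. indicator ?T z * ennreal (1 / ell z x ^ ?n) \<partial>lborel) \<partial>sphere_measure)"
  proof -
    have "(\<lambda>x. \<integral>\<^sup>+z. indicator ?T z * ennreal (1 / ell z x ^ ?n) \<partial>lborel) \<in> borel_measurable sphere_measure"
      unfolding ell_def by (rule lborel.borel_measurable_nn_integral) measurable
    then show ?thesis using fin by (simp add: nn_integral_cmult)
  qed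
  also have "\<dots> = (\<integral>\<^sup>+x. ennreal (\<bar>?\<Delta>\<bar> * ?G x) \<partial>sphere_measure)"
  proof (rule nn_integral_cong_AE, use AEpos AE_sphere in eventually_elim)
    fix x :: "real^'n::_" assume x: "\<forall>k\<le>?n. 0 < ell (y k) x" "norm x = 1"
    have "ennreal (fact (?n - 1)) * (\<integral>\<^sup>+z. indicator ?T z * ennreal (1 / ell z x ^ ?n) \<partial>lborel) =
        ennreal \<bar>?\<Delta>\<bar> * (\<integral>\<^sup>+u. ennreal (1 / (\<Prod>k\<le>?n. ell (y k) x + u)) * indicator {0<..} u \<partial>lborel)"
      unfolding ell_def by (rule nn_integral_geodesic_simplex) (use x \<Delta> in \<open>auto simp: ell_def\<close>)
    then show "ennreal (fact (?n - 1)) * (\<integral>\<^sup>+z. indicator ?T z * ennreal (1 / ell z x ^ ?n) \<partial>lborel) = ennreal (\<bar>?\<Delta>\<bar> * ?G x)"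
      by (simp add: nnG[OF x(2,1)] ennreal_mult')
  qed
  also have "\<dots> = ennreal (\<bar>?\<Delta>\<bar> * (\<integral>x. ?G x \<partial>sphere_measure))"
  proof -
    have "AE x in sphere_measure. 0 \<le> \<bar>?\<Delta>\<bar> * ?G x"
      using AEpos by eventually_elim (use Gnn in \<open>auto intro: mult_nonneg_nonneg\<close>)
    then have "(\<integral>\<^sup>+x. ennreal (\<bar>?\<Delta>\<bar> * ?G x) \<partial>sphere_measure) = ennreal (\<integral>x. \<bar>?\<Delta>\<bar> * ?G x \<partial>sphere_measure)"
      using int by (intro nn_integral_eq_integral) auto
    then show ?thesis by simp
  qed
  finally have eq: "ennreal (fact (?n - 1)) * (ennreal ?v * (\<integral>\<^sup>+z. indicator ?T z * ennreal (hyp_density z) \<partial>lborel)) =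
      ennreal (\<bar>?\<Delta>\<bar> * (\<integral>x. ?G x \<partial>sphere_measure))" .
  define A where "A = (\<integral>\<^sup>+z. indicator ?T z * ennreal (hyp_density z) \<partial>lborel)"
  have v: "0 < ?v" by simp
  have "A < \<infinity>"
  proof (rule ccontr)
    assume "\<not> A < \<infinity>"
    then have "A = \<infinity>" by (simp add: not_less top_unique)
    moreover have "unit_ball_vol (real ?n) \<noteq> 0" using unit_ball_vol_pos[of "real ?n"] by linarith
    ultimately show False using eq by (simp add: A_def[symmetric] ennreal_mult_top ennreal_mult_eq_top_iff)
  qed
  then have A: "A = ennreal (enn2real A)" by simp
  have "set_lebesgue_integral lborel ?T hyp_density = enn2real A"
    unfolding set_lebesgue_integral_def A_def
    by (subst integral_eq_nn_integral)
      (auto simp: hyp_density_nonneg indicator_def intro!: arg_cong[of _ _ enn2real] nn_integral_cong)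
  moreover have "fact (?n - 1) * (?v * enn2real A) = \<bar>?\<Delta>\<bar> * (\<integral>x. ?G x \<partial>sphere_measure)"
  proof -
    have "ennreal (fact (?n - 1) * (?v * enn2real A)) = ennreal (\<bar>?\<Delta>\<bar> * (\<integral>x. ?G x \<partial>sphere_measure))"
      unfolding eq[symmetric] A_def[symmetric] by (subst (2) A) (simp add: ennreal_mult)
    moreover have "0 \<le> (\<integral>x. ?G x \<partial>sphere_measure)"
      by (rule integral_nonneg_AE) (use AEpos Gnn in \<open>auto elim: eventually_mono\<close>)
    ultimately show ?thesis by (subst (asm) ennreal_inj) auto
  qed
  ultimately show "\<bar>?\<Delta>\<bar> * (\<integral>x. ?G x \<partial>sphere_measure) =
      fact (?n - 1) * ?v * set_lebesgue_integral lborel ?T hyp_density"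
    by (simp add: mult.assoc)
qed

section \<open>The logarithmic form on the absolute\<close>

text \<open>By the last claim a lift enters the pairing only through the factor
  \<open>snd y\<close>: its sign disappears in absolute values and its size contributes an additive
  constant to the logarithms.\<close>

lemma cone_facts:
  fixes y :: "(real^'n) \<times> real"
  assumes "y \<in> hyperbolic_cone \<union> absolute_cone"
  shows "snd y \<noteq> 0" "norm (ball_point y) \<le> 1" "norm (ball_point y) = 1 \<longleftrightarrow> y \<in> absolute_cone"
    "lorentz (x, 1) y = - snd y * ell (ball_point y) x"
proof -
  have Q: "lorentz_Q y = fst y \<bullet> fst y - (snd y)\<^sup>2"
    by (simp add: lorentz_Q_eq lorentz_def power2_eq_square)
  show s: "snd y \<noteq> 0"
  proof
    assume s: "snd y = 0"
    then have "fst y \<bullet> fst y \<le> 0" using assms Q by (auto simp: hyperbolic_cone_def absolute_cone_def)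
    then have "fst y \<bullet> fst y = 0" using inner_ge_zero[of "fst y"] by linarith
    then have "y = 0" using s by (simp add: prod_eq_iff)
    then show False using assms Q by (auto simp: hyperbolic_cone_def absolute_cone_def)
  qed
  have nb: "(norm (ball_point y))\<^sup>2 = fst y \<bullet> fst y / (snd y)\<^sup>2"
    by (simp add: ball_point_def power2_norm_eq_inner[symmetric] power_mult_distrib divide_inverse power_inverse mult.commute)
  have "lorentz_Q y \<le> 0" using assms by (auto simp: hyperbolic_cone_def absolute_cone_def)
  then have "(norm (ball_point y))\<^sup>2 \<le> 1\<^sup>2" using s by (simp add: nb Q divide_le_eq)
  then show "norm (ball_point y) \<le> 1" by (rule power2_le_imp_le) simp
  have "norm (ball_point y) = 1 \<longleftrightarrow> (norm (ball_point y))\<^sup>2 = 1"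
    using norm_ge_zero[of "ball_point y"] unfolding power2_eq_1_iff by linarith
  also have "\<dots> \<longleftrightarrow> lorentz_Q y = 0" using s by (auto simp: nb Q divide_eq_eq)
  also have "\<dots> \<longleftrightarrow> y \<in> absolute_cone" using s by (auto simp: absolute_cone_def)
  finally show "norm (ball_point y) = 1 \<longleftrightarrow> y \<in> absolute_cone" .
  show "lorentz (x, 1) y = - snd y * ell (ball_point y) x"
    using s by (simp add: lorentz_def ell_def ball_point_def right_diff_distrib)
qed

text \<open>The explicit formula for \<open>mu_ratio\<close> is available on the unit sphere only,
  and the derivative within the sphere sees nothing else.\<close>

lemma sphere_d_cong:
  assumes "\<And>x. norm x = 1 \<Longrightarrow> f x = g x" "norm x = 1"
  shows "sphere_d f x = sphere_d g x"
proof -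
  have "(f has_derivative f') (at x within sphere 0 1) \<longleftrightarrow> (g has_derivative f') (at x within sphere 0 1)" for f'
    using assms by (auto intro: has_derivative_transform[rotated 2])
  then show ?thesis by (simp add: sphere_d_def frechet_derivative_def)
qed

lemma has_derivative_ln_ell:
  assumes "0 < ell z x"
  shows "((\<lambda>x. ln (ell z x)) has_derivative (\<lambda>v. - (v \<bullet> z) / ell z x)) (at x)"
  using assms unfolding ell_def by (auto intro!: derivative_eq_intros simp: divide_inverse)

lemma ln_abs_mu_ratio:
  fixes x :: "real^'n::{finite,wellorder}"
  assumes n: "2 \<le> CARD('n)" and y: "y \<in> hyperbolic_cone \<union> absolute_cone" "z \<in> hyperbolic_cone \<union> absolute_cone"
    and pos: "0 < ell (ball_point y) x" "0 < ell (ball_point z) x"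
  shows "ln \<bar>lorentz (x, 1) z ^ (CARD('n) - 1) / lorentz (x, 1) y ^ (CARD('n) - 1)\<bar> =
    (real CARD('n) - 1) * (ln \<bar>snd z\<bar> - ln \<bar>snd y\<bar> + ln (ell (ball_point z) x) - ln (ell (ball_point y) x))"
proof -
  have s: "snd y \<noteq> 0" "snd z \<noteq> 0" using cone_facts(1)[OF y(1)] cone_facts(1)[OF y(2)] by simp_all
  have "\<bar>lorentz (x, 1) z ^ (CARD('n) - 1) / lorentz (x, 1) y ^ (CARD('n) - 1)\<bar> =
      ((\<bar>snd z\<bar> * ell (ball_point z) x) / (\<bar>snd y\<bar> * ell (ball_point y) x)) ^ (CARD('n) - 1)"
    using pos by (simp add: cone_facts(4)[OF y(1)] cone_facts(4)[OF y(2)] abs_mult power_abs power_divide power_mult_distrib)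
  also have "ln \<dots> = real (CARD('n) - 1) * ln ((\<bar>snd z\<bar> * ell (ball_point z) x) / (\<bar>snd y\<bar> * ell (ball_point y) x))"
    by (rule ln_realpow)
  also have "ln ((\<bar>snd z\<bar> * ell (ball_point z) x) / (\<bar>snd y\<bar> * ell (ball_point y) x)) =
      ln \<bar>snd z\<bar> - ln \<bar>snd y\<bar> + ln (ell (ball_point z) x) - ln (ell (ball_point y) x)"
    using s pos by (simp add: ln_div ln_mult)
  finally show ?thesis using n by (simp add: of_nat_diff)
qed

text \<open>One factor \<open>n - 1\<close> comes from the logarithm and \<open>n - 1\<close> more
  from the differentials, which explains the power \<open>n\<close>. The choice of lifts survives
  only as a constant beside the undifferentiated logarithm.\<close>

lemma absolute_form_value:
  fixes y :: "nat \<Rightarrow> (real^'n::{finite,wellorder}) \<times> real"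
  assumes n: "2 \<le> CARD('n)" and y: "\<And>k. k \<le> CARD('n) \<Longrightarrow> y k \<in> hyperbolic_cone \<union> absolute_cone"
    and x: "norm x = 1" and pos: "\<And>k. k \<le> CARD('n) \<Longrightarrow> 0 < ell (ball_point (y k)) x"
  defines "b \<equiv> \<lambda>k. ball_point (y k)"
  shows "ln \<bar>mu_ratio (y 1) (y 0) x\<bar> *
      wedge {2..CARD('n)} (\<lambda>i. sphere_d (\<lambda>x. ln \<bar>mu_ratio (y i) (y 0) x\<bar>)) x (frame x) =
    (real CARD('n) - 1) ^ CARD('n) * (ln \<bar>snd (y 0)\<bar> - ln \<bar>snd (y 1)\<bar> + ln (ell (b 0) x) - ln (ell (b 1) x)) *
      det_rows ((\<lambda>i. b i - b 0)(1 := x - b 0)) / (\<Prod>k\<in>{..CARD('n)} - {1}. ell (b k) x)"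
proof -
  let ?n = "CARD('n)" and ?m = "real CARD('n) - 1"
  \<comment> \<open>The gradient of the logarithm of the ratio for \<open>y i\<close>.\<close>
  define A where "A i = ?m *\<^sub>R (b i /\<^sub>R (1 - x \<bullet> b i) - b 0 /\<^sub>R (1 - x \<bullet> b 0))" for i
  have fr: "sphere_frame x (frame x)" by (rule sphere_frame_frame[OF n x])
  have d: "sphere_d (\<lambda>x. ln \<bar>mu_ratio (y i) (y 0) x\<bar>) x (frame x j) = A i \<bullet> frame x j"
    if i: "i \<in> {2..?n}" and j: "j \<in> {2..?n}" for i j
  proof -
    let ?h = "\<lambda>x. ln \<bar>lorentz (x, 1) (y 0) ^ (?n - 1) / lorentz (x, 1) (y i) ^ (?n - 1)\<bar>"
    let ?S = "{x. 0 < ell (b i) x} \<inter> {x. 0 < ell (b 0) x}"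
    have yi: "y i \<in> hyperbolic_cone \<union> absolute_cone" "y 0 \<in> hyperbolic_cone \<union> absolute_cone" using y i by auto
    have bi: "0 < ell (b i) x" "0 < ell (b 0) x" using pos i by (auto simp: b_def)
    have "((\<lambda>x. ?m * (ln \<bar>snd (y 0)\<bar> - ln \<bar>snd (y i)\<bar> + ln (ell (b 0) x) - ln (ell (b i) x))) has_derivative
        (\<lambda>v. ?m * (0 - 0 + (- (v \<bullet> b 0) / ell (b 0) x) - (- (v \<bullet> b i) / ell (b i) x)))) (at x)"
      by (intro has_derivative_mult_right has_derivative_add has_derivative_diff has_derivative_const
          has_derivative_ln_ell bi)
    also have "(\<lambda>v. ?m * (0 - 0 + (- (v \<bullet> b 0) / ell (b 0) x) - (- (v \<bullet> b i) / ell (b i) x))) = (\<lambda>v. A i \<bullet> v)"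
      by (simp add: A_def ell_def inner_diff_left inner_commute divide_inverse algebra_simps)
    finally have "(?h has_derivative (\<lambda>v. A i \<bullet> v)) (at x)"
    proof (rule has_derivative_transform_within_open)
      show "open ?S"
        unfolding ell_def by (intro open_Int open_Collect_less continuous_intros)
      show "x \<in> ?S" using bi by simp
      fix z assume "z \<in> ?S"
      then show "?m * (ln \<bar>snd (y 0)\<bar> - ln \<bar>snd (y i)\<bar> + ln (ell (b 0) z) - ln (ell (b i) z)) = ?h z"
        using ln_abs_mu_ratio[OF n yi, of z] by (simp add: b_def)
    qed
    then have "sphere_d ?h x (frame x j) = A i \<bullet> frame x j"
    proof (rule sphere_d_tangent[OF _ x])
      have on: "frame x i \<bullet> frame x j = (if i = j then 1 else 0)" if "i \<in> {1..?n}" "j \<in> {1..?n}" for i j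
        using fr that unfolding sphere_frame_def by blast
      have "frame x j \<bullet> frame x j = 1" "frame x 1 \<bullet> frame x j = 0"
        using on[of j j] on[of 1 j] j n by (simp_all del: One_nat_def)
      moreover have "frame x 1 = x" using fr by (simp add: sphere_frame_def)
      ultimately show "norm (frame x j) = 1" "x \<bullet> frame x j = 0" by (auto simp: norm_eq_sqrt_inner)
    qed
    moreover have "sphere_d (\<lambda>x. ln \<bar>mu_ratio (y i) (y 0) x\<bar>) x = sphere_d ?h x"
      by (rule sphere_d_cong[OF _ x]) (simp add: mu_ratio_eq[OF n])
    ultimately show ?thesis by simp
  qed
  have "wedge {2..?n} (\<lambda>i. sphere_d (\<lambda>x. ln \<bar>mu_ratio (y i) (y 0) x\<bar>)) x (frame x) = det_rows (A(1 := x))"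
    by (rule wedge_frame[OF n fr]) (rule d)
  also have "\<dots> = ?m ^ (?n - 1) * det_rows ((\<lambda>i. b i - b 0)(1 := x - b 0)) / (\<Prod>k\<in>{..?n} - {1}. 1 - x \<bullet> b k)"
    unfolding A_def by (rule det_rows_log_differentials[OF n x]) (use pos in \<open>force simp: b_def ell_def\<close>)
  finally have w: "wedge {2..?n} (\<lambda>i. sphere_d (\<lambda>x. ln \<bar>mu_ratio (y i) (y 0) x\<bar>)) x (frame x) =
    ?m ^ (?n - 1) * det_rows ((\<lambda>i. b i - b 0)(1 := x - b 0)) / (\<Prod>k\<in>{..?n} - {1}. ell (b k) x)"
    by (simp add: ell_def)
  have l: "ln \<bar>mu_ratio (y 1) (y 0) x\<bar> = ?m * (ln \<bar>snd (y 0)\<bar> - ln \<bar>snd (y 1)\<bar> + ln (ell (b 0) x) - ln (ell (b 1) x))"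
    unfolding mu_ratio_eq[OF n x] b_def using n by (intro ln_abs_mu_ratio[OF n] y pos) auto
  have p: "?m * ?m ^ (?n - 1) = ?m ^ ?n" by (metis power_eq_if zero_less_card_finite less_numeral_extra(3))
  show ?thesis unfolding w l p[symmetric] by (simp add: mult_ac)
qed

lemma tendsto_integral_cut_sphere:
  fixes G :: "real^'n \<Rightarrow> real"
  assumes n: "2 \<le> CARD('n)" and P: "finite P" and G: "integrable sphere_measure G"
  shows "((\<lambda>\<epsilon>. \<integral>x. indicator (cut_sphere P \<epsilon>) x * G x \<partial>sphere_measure) \<longlongrightarrow> (\<integral>x. G x \<partial>sphere_measure)) (at_right 0)"
proof (rule tendsto_at_right_sequentially[of 0 1])
  fix S :: "nat \<Rightarrow> real" assume S: "S \<longlonglongrightarrow> 0"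
  have [measurable]: "G \<in> borel_measurable borel" using borel_measurable_integrable[OF G] by simp
  show "(\<lambda>i. \<integral>x. indicator (cut_sphere P (S i)) x * G x \<partial>sphere_measure) \<longlonglongrightarrow> (\<integral>x. G x \<partial>sphere_measure)"
  proof (rule integral_dominated_convergence[where w = "\<lambda>x. \<bar>G x\<bar>"])
    have "AE x in sphere_measure. \<forall>p\<in>P. x \<noteq> p"
      using P AE_sphere_neq[OF n] by (subst AE_finite_all) auto
    then show "AE x in sphere_measure. (\<lambda>i. indicator (cut_sphere P (S i)) x * G x) \<longlonglongrightarrow> G x"
      using AE_sphere
    proof eventually_elim
      fix x :: "real^'n" assume x: "\<forall>p\<in>P. x \<noteq> p" "norm x = 1"
      have "\<forall>\<^sub>F i in sequentially. \<forall>p\<in>P. S i < dist x p"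
        using P x S by (intro eventually_ball_finite ballI order_tendstoD(2)[of S 0]) auto
      then have "\<forall>\<^sub>F i in sequentially. indicator (cut_sphere P (S i)) x * G x = G x"
        by eventually_elim (use x in \<open>auto simp: cut_sphere_def less_imp_le\<close>)
      then show "(\<lambda>i. indicator (cut_sphere P (S i)) x * G x) \<longlonglongrightarrow> G x"
        by (rule tendsto_eventually)
    qed
    show "AE x in sphere_measure. norm (indicator (cut_sphere P (S i)) x * G x) \<le> \<bar>G x\<bar>" for i
      by (intro AE_I2) (auto simp: indicator_def)
  qed (use G in auto)
qed simp

text \<open>Separates an integrable part from a null part. On the circle the former contributes its
  Lebesgue integral as the limit over shrinking cuts, and the principal value of the latter is
  0.\<close>

lemma has_absolute_integralI:
  fixes \<omega> :: "'n::{finite,wellorder} form"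
  assumes n: "2 \<le> CARD('n)" and P: "finite P" and f: "null_form P f" and G: "integrable sphere_measure G"
    and \<omega>: "\<And>x. norm x = 1 \<Longrightarrow> x \<notin> P \<Longrightarrow> \<omega> x (frame x) = G x + f x"
  shows "has_absolute_integral P \<omega> (\<integral>x. G x \<partial>sphere_measure)"
proof (cases "CARD('n) = 2")
  case True
  have [measurable]: "G \<in> borel_measurable borel" using borel_measurable_integrable[OF G] by simp
  have cut: "{x \<in> sphere 0 1. \<forall>p\<in>P. \<epsilon> \<le> dist x p} = cut_sphere P \<epsilon>" for \<epsilon> by (simp add: cut_sphere_def)
  have e: "indicator (cut_sphere P \<epsilon>) x *\<^sub>R \<omega> x (frame x) =
      indicator (cut_sphere P \<epsilon>) x * G x + indicator (cut_sphere P \<epsilon>) x * f x" if "0 < \<epsilon>" for \<epsilon> x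
  proof (cases "x \<in> cut_sphere P \<epsilon>")
    case True
    then have "norm x = 1" "x \<notin> P" using that by (auto simp: cut_sphere_def)
    then show ?thesis using True \<omega> by simp
  qed simp
  have iG: "integrable sphere_measure (\<lambda>x. indicator (cut_sphere P \<epsilon>) x * G x)" for \<epsilon>
    using integrable_mult_indicator[of "cut_sphere P \<epsilon>", OF _ G] by simp
  have if': "integrable sphere_measure (\<lambda>x. indicator (cut_sphere P \<epsilon>) x * f x)" if "0 < \<epsilon>" for \<epsilon>
    using f True that by (auto simp: null_form_def)
  have lim: "((\<lambda>\<epsilon>. \<integral>x. indicator (cut_sphere P \<epsilon>) x * f x \<partial>sphere_measure) \<longlongrightarrow> 0) (at_right 0)"
    using f True by (auto simp: null_form_def)
  have "((\<lambda>\<epsilon>. form_integral (cut_sphere P \<epsilon>) \<omega>) \<longlongrightarrow> (\<integral>x. G x \<partial>sphere_measure)) (at_right 0)"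
  proof (rule Lim_transform_eventually)
    show "((\<lambda>\<epsilon>. (\<integral>x. indicator (cut_sphere P \<epsilon>) x * G x \<partial>sphere_measure) +
        (\<integral>x. indicator (cut_sphere P \<epsilon>) x * f x \<partial>sphere_measure)) \<longlongrightarrow> (\<integral>x. G x \<partial>sphere_measure)) (at_right 0)"
      using tendsto_add[OF tendsto_integral_cut_sphere[OF n P G] lim] by simp
    show "\<forall>\<^sub>F \<epsilon> in at_right 0. (\<integral>x. indicator (cut_sphere P \<epsilon>) x * G x \<partial>sphere_measure) +
        (\<integral>x. indicator (cut_sphere P \<epsilon>) x * f x \<partial>sphere_measure) = form_integral (cut_sphere P \<epsilon>) \<omega>"
      using eventually_at_right_less[of "0::real"]
      by eventually_elim (simp only: form_integral_def set_lebesgue_integral_def e Bochner_Integration.integral_add[OF iG if'])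
  qed
  moreover have "form_integrable (cut_sphere P \<epsilon>) \<omega>" if "0 < \<epsilon>" for \<epsilon>
    unfolding form_integrable_def set_integrable_def e[OF that] using iG if'[OF that] by (rule Bochner_Integration.integrable_add)
  ultimately show ?thesis using True unfolding has_absolute_integral_def cut by simp
next
  case False
  have if': "integrable sphere_measure f" "(\<integral>x. f x \<partial>sphere_measure) = 0"
    using f False by (auto simp: null_form_def)
  have i: "integrable sphere_measure (\<lambda>x. G x + f x)" using G if' by simp
  have m: "(\<lambda>x. G x + f x) \<in> borel_measurable sphere_measure" using borel_measurable_integrable[OF i] .
  let ?w = "\<lambda>x. indicator (sphere 0 1) x *\<^sub>R \<omega> x (frame x)"
  \<comment> \<open>\<open>frame\<close> is an arbitrary choice; measurability of the form is
    inherited from \<open>G x + f x\<close>, with which it agrees on the sphere outside the finite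
    set \<open>P\<close>.\<close>
  have wm: "?w \<in> borel_measurable sphere_measure"
  proof (rule measurable_discrete_difference)
    show "(\<lambda>x. indicator (sphere 0 1) x *\<^sub>R (G x + f x)) \<in> borel_measurable sphere_measure"
      using m by (intro borel_measurable_scaleR borel_measurable_indicator) auto
    show "countable P" using P by (rule countable_finite)
    show "indicator (sphere 0 1) x *\<^sub>R (G x + f x) = ?w x" if "x \<in> space sphere_measure" "x \<notin> P" for x
      using that \<omega> by (auto simp: indicator_def)
  qed auto
  have "AE x in sphere_measure. \<forall>p\<in>P. x \<noteq> p"
    using P AE_sphere_neq[OF n] by (subst AE_finite_all) auto
  then have ae: "AE x in sphere_measure. ?w x = G x + f x"
    using AE_sphere by eventually_elim (use \<omega> in auto)
  have "integrable sphere_measure ?w"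
    using integrable_cong_AE[OF wm m ae] i by simp
  moreover have "(\<integral>x. ?w x \<partial>sphere_measure) = (\<integral>x. G x \<partial>sphere_measure)"
    using integral_cong_AE[OF wm m ae] G if' by simp
  ultimately show ?thesis
    using False by (simp add: has_absolute_integral_def form_integrable_def form_integral_def set_integrable_def set_lebesgue_integral_def)
qed

text \<open>The mirror is the facet opposite to \<open>b j\<close>. Multiplying and dividing by the
  product of the \<open>n\<close> remaining \<open>ell (b k) x\<close> gives the first function the
  shape of \<open>null_form_quotient\<close>: \<open>Reg\<close> scales by \<open>t ^ n\<close>, so
  its product with them is invariant.\<close>

lemma null_form_regular_part:
  fixes b :: "nat \<Rightarrow> real^'n::{finite,wellorder}"
  assumes n: "2 \<le> CARD('n)" and b: "\<And>k. k \<le> CARD('n) \<Longrightarrow> norm (b k) \<le> 1" and inj: "inj_on b {..CARD('n)}"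
    and j: "j \<le> CARD('n)" "r \<in> {..CARD('n)} - {j}" and c: "\<And>k. k \<in> {..CARD('n)} - {j} \<Longrightarrow> c \<bullet> b k = d"
    and P: "finite P" "P \<subseteq> sphere 0 1" "{z \<in> b ` {..CARD('n)}. norm z = 1} \<subseteq> P"
  shows "null_form P (\<lambda>x. (c \<bullet> x - d) * (Reg ({..CARD('n)} - {j}) r (\<lambda>k. ell (b k) x) *
      (\<Prod>k\<in>{..CARD('n)} - {j}. ell (b k) x)) / (\<Prod>k\<in>{..CARD('n)} - {j}. ell (b k) x))"
    and "null_form P (\<lambda>x. (c \<bullet> x - d) * \<gamma> / (\<Prod>k\<in>{..CARD('n)} - {j}. ell (b k) x))"
proof -
  let ?I = "{..CARD('n)} - {j}" and ?Z = "b ` ({..CARD('n)} - {j})"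
  have I: "finite ?I" "card ?I = CARD('n)" using j by auto
  have inj': "inj_on b ?I" using inj by (rule inj_on_subset) auto
  have P': "{z \<in> ?Z. norm z = 1} \<subseteq> P" using P(3) by auto
  have sumZ: "(\<Sum>z\<in>?Z. ell z x powr (- 1/4)) = (\<Sum>k\<in>?I. ell (b k) x powr (- 1/4))" for x
    using inj' by (simp add: sum.reindex)
  show "null_form P (\<lambda>x. (c \<bullet> x - d) * (Reg ?I r (\<lambda>k. ell (b k) x) * (\<Prod>k\<in>?I. ell (b k) x)) / (\<Prod>k\<in>?I. ell (b k) x))"
  \<comment> \<open>\<open>Z\<close> consists exactly of the vertices in the denominator, and
    \<open>p = 0\<close> is a placeholder.\<close>
  proof (rule null_form_quotient[OF n _ _ _ I inj' _ _ _ _ _ P(1,2) P', where p = 0 and K = reg_const])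
    fix x x' :: "real^'n::_" and t assume t: "0 < t" and e: "\<And>z. z \<in> ?Z \<Longrightarrow> ell z x' = ell z x / t"
    have "Reg ?I r (\<lambda>k. ell (b k) x') = Reg ?I r (\<lambda>k. ell (b k) x / t)"
      by (rule Reg_cong[OF j(2)]) (use e in auto)
    also have "\<dots> = t ^ CARD('n) * Reg ?I r (\<lambda>k. ell (b k) x)" by (simp only: Reg_scale[OF t] I)
    finally have 1: "Reg ?I r (\<lambda>k. ell (b k) x') = t ^ CARD('n) * Reg ?I r (\<lambda>k. ell (b k) x)" .
    have "(\<Prod>k\<in>?I. ell (b k) x') = (\<Prod>k\<in>?I. ell (b k) x / t)" using e by (intro prod.cong) auto
    then have 2: "(\<Prod>k\<in>?I. ell (b k) x') = (\<Prod>k\<in>?I. ell (b k) x) / t ^ CARD('n)"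
      by (simp only: prod_dividef prod_constant I)
    show "Reg ?I r (\<lambda>k. ell (b k) x') * (\<Prod>k\<in>?I. ell (b k) x') = Reg ?I r (\<lambda>k. ell (b k) x) * (\<Prod>k\<in>?I. ell (b k) x)"
      unfolding 1 2 using t by simp
  next
    fix x :: "real^'n::_" assume x: "norm x = 1" and pos: "\<And>z. z \<in> ?Z \<Longrightarrow> 0 < ell z x"
    have a: "0 < ell (b k) x \<and> ell (b k) x \<le> 2" if "k \<in> ?I" for k
      using pos that ell_le_2[OF x b[of k]] by auto
    have p: "0 < (\<Prod>k\<in>?I. ell (b k) x)" using a by (intro prod_pos) auto
    have "\<bar>Reg ?I r (\<lambda>k. ell (b k) x)\<bar> \<le> (\<Prod>k\<in>?I. 1 / ell (b k) x) * (\<Sum>k\<in>?I. ell (b k) x powr (- 1/4)) * reg_const"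
      by (rule Reg_bound[OF I(1) j(2) a])
    then have "\<bar>Reg ?I r (\<lambda>k. ell (b k) x)\<bar> * (\<Prod>k\<in>?I. ell (b k) x) \<le>
        (\<Prod>k\<in>?I. 1 / ell (b k) x) * (\<Sum>k\<in>?I. ell (b k) x powr (- 1/4)) * reg_const * (\<Prod>k\<in>?I. ell (b k) x)"
      using p by (intro mult_right_mono) auto
    also have "\<dots> = reg_const * (\<Sum>k\<in>?I. ell (b k) x powr (- 1/4))"
      using less_imp_neq[OF p] by (simp add: prod_dividef del: prod_zero_iff)
    finally show "\<bar>Reg ?I r (\<lambda>k. ell (b k) x) * (\<Prod>k\<in>?I. ell (b k) x)\<bar> \<le> reg_const * (\<Sum>z\<in>?Z. ell z x powr (- 1/4))"
      unfolding sumZ using p by (simp add: abs_mult)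
  qed (use b c in auto)
  show "null_form P (\<lambda>x. (c \<bullet> x - d) * \<gamma> / (\<Prod>k\<in>?I. ell (b k) x))"
  proof (rule null_form_quotient[OF n _ _ _ I inj' _ _ _ _ _ P(1,2) P', where p = 0 and K = "2 * \<bar>\<gamma>\<bar>" and g = "\<lambda>_. \<gamma>"])
    fix x :: "real^'n::_" assume x: "norm x = 1" and pos: "\<And>z. z \<in> ?Z \<Longrightarrow> 0 < ell z x"
    have r: "b r \<in> ?Z" "norm (b r) \<le> 1" using j b[of r] by auto
    have "1 \<le> 2 * ell (b r) x powr (- 1/4)"
      by (rule one_le_powr_quarter[OF pos[OF r(1)] ell_le_2[OF x r(2)]])
    also have "ell (b r) x powr (- 1/4) \<le> (\<Sum>z\<in>?Z. ell z x powr (- 1/4))"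
      using r by (intro member_le_sum) auto
    finally have "1 \<le> 2 * (\<Sum>z\<in>?Z. ell z x powr (- 1/4))" by simp
    then have "\<bar>\<gamma>\<bar> * 1 \<le> \<bar>\<gamma>\<bar> * (2 * (\<Sum>z\<in>?Z. ell z x powr (- 1/4)))" by (rule mult_left_mono) simp
    then show "\<bar>\<gamma>\<bar> \<le> 2 * \<bar>\<gamma>\<bar> * (\<Sum>z\<in>?Z. ell z x powr (- 1/4))" by simp
  qed (use b c in auto)
qed

text \<open>All vertices lie on the mirror, so every \<open>ell (b k)\<close> is divided by the same
  \<open>t\<close>, the difference of the logarithms is invariant and the whole expression is odd.
  Injectivity excludes index 1, since \<open>b 1\<close> may coincide with another vertex and does
  not occur in the product.\<close>

lemma null_form_degenerate:
  fixes b :: "nat \<Rightarrow> real^'n::{finite,wellorder}"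
  assumes n: "2 \<le> CARD('n)" and b: "\<And>k. k \<le> CARD('n) \<Longrightarrow> norm (b k) \<le> 1" and inj: "inj_on b ({..CARD('n)} - {1})"
    and c: "\<And>k. k \<le> CARD('n) \<Longrightarrow> c \<bullet> b k = d"
    and P: "finite P" "P \<subseteq> sphere 0 1" "{z \<in> b ` {..CARD('n)}. norm z = 1} \<subseteq> P"
  shows "null_form P (\<lambda>x. (c \<bullet> x - d) * (\<gamma> + ln (ell (b 0) x) - ln (ell (b 1) x)) / (\<Prod>k\<in>{..CARD('n)} - {1}. ell (b k) x))"
proof -
  let ?I = "{..CARD('n)} - {1}" and ?Z = "b ` {..CARD('n)}"
  have I: "finite ?I" "card ?I = CARD('n)" using n by auto
  have b01: "b 0 \<in> ?Z" "b 1 \<in> ?Z" "norm (b 0) \<le> 1" "norm (b 1) \<le> 1" using n b by auto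
  show ?thesis
  proof (rule null_form_quotient[OF n _ _ _ I inj _ _ _ _ _ P, where p = "b 1" and K = "2 * \<bar>\<gamma>\<bar> + 8"])
    fix x x' :: "real^'n::_" and t assume t: "0 < t" and pos: "\<And>z. z \<in> ?Z \<Longrightarrow> 0 < ell z x"
      and e: "\<And>z. z \<in> ?Z \<Longrightarrow> ell z x' = ell z x / t"
    have "ln (ell (b 0) x') = ln (ell (b 0) x) - ln t" "ln (ell (b 1) x') = ln (ell (b 1) x) - ln t"
      using e[OF b01(1)] e[OF b01(2)] pos[OF b01(1)] pos[OF b01(2)] t by (simp_all add: ln_div)
    then show "\<gamma> + ln (ell (b 0) x') - ln (ell (b 1) x') = \<gamma> + ln (ell (b 0) x) - ln (ell (b 1) x)" by simp
  next
    fix x :: "real^'n::_" assume x: "norm x = 1" and pos: "\<And>z. z \<in> ?Z \<Longrightarrow> 0 < ell z x"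
    define S where "S = (\<Sum>z\<in>?Z. ell z x powr (- 1/4))"
    have S: "ell (b 0) x powr (- 1/4) \<le> S" "ell (b 1) x powr (- 1/4) \<le> S"
      unfolding S_def using b01 by (auto intro!: member_le_sum)
    have "\<bar>ln (ell (b 0) x)\<bar> \<le> 4 * S" "\<bar>ln (ell (b 1) x)\<bar> \<le> 4 * S"
      using abs_ln_le_powr_quarter[OF pos[OF b01(1)] ell_le_2[OF x b01(3)]]
        abs_ln_le_powr_quarter[OF pos[OF b01(2)] ell_le_2[OF x b01(4)]] S by auto
    moreover have "\<bar>\<gamma>\<bar> * 1 \<le> \<bar>\<gamma>\<bar> * (2 * S)"
      using one_le_powr_quarter[OF pos[OF b01(1)] ell_le_2[OF x b01(3)]] S by (intro mult_left_mono) auto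
    moreover have "(2 * \<bar>\<gamma>\<bar> + 8) * S = \<bar>\<gamma>\<bar> * (2 * S) + 4 * S + 4 * S" by (simp add: algebra_simps)
    ultimately show "\<bar>\<gamma> + ln (ell (b 0) x) - ln (ell (b 1) x)\<bar> \<le> (2 * \<bar>\<gamma>\<bar> + 8) * (\<Sum>z\<in>?Z. ell z x powr (- 1/4))"
      unfolding S_def[symmetric] by linarith
  qed (use b c n in auto)
qed

theorem theorem7p1:
  fixes y :: "nat \<Rightarrow> (real^'n::{finite,wellorder}) \<times> real"
  assumes "CARD('n) \<ge> 2"
    and "\<forall>i\<le>CARD('n). y i \<in> hyperbolic_cone \<union> absolute_cone"
  shows "has_absolute_integral
    (ball_point ` {y i |i. i \<le> CARD('n) \<and> y i \<in> absolute_cone})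
    (\<lambda>x v. ln \<bar>mu_ratio (y 1) (y 0) x\<bar> *
       wedge {2..CARD('n)} (\<lambda>i. sphere_d (\<lambda>x. ln \<bar>mu_ratio (y i) (y 0) x\<bar>)) x v)
    ((real CARD('n) - 1) ^ CARD('n) * measure (sphere_measure :: (real^'n::{finite,wellorder}) measure) (sphere 0 1)
       / real CARD('n) * (fact CARD('n) * hyp_vol (\<lambda>i. ball_point (y i))))"
proof -
  let ?n = "CARD('n)" and ?P = "ball_point ` {y i |i. i \<le> CARD('n) \<and> y i \<in> absolute_cone}"
  let ?\<omega> = "\<lambda>x v. ln \<bar>mu_ratio (y 1) (y 0) x\<bar> *
       wedge {2..CARD('n)} (\<lambda>i. sphere_d (\<lambda>x. ln \<bar>mu_ratio (y i) (y 0) x\<bar>)) x v"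
  define b where "b k = ball_point (y k)" for k
  define \<Delta> where "\<Delta> = det_rows (\<lambda>i. b i - b 0)"
  define M where "M = (real ?n - 1) ^ ?n"
  define \<gamma> where "\<gamma> = ln \<bar>snd (y 0)\<bar> - ln \<bar>snd (y 1)\<bar>"
  define I where "I j = {..?n} - {j}" for j
  note n = assms(1)
  have y: "y k \<in> hyperbolic_cone \<union> absolute_cone" if "k \<le> ?n" for k using assms(2) that by blast
  have b: "norm (b k) \<le> 1" if "k \<le> ?n" for k unfolding b_def using cone_facts(2)[OF y[OF that]] .
  have babs: "norm (b k) = 1 \<longleftrightarrow> y k \<in> absolute_cone" if "k \<le> ?n" for k
    unfolding b_def using cone_facts(3)[OF y[OF that]] .
  have Pb: "?P = b ` {k. k \<le> ?n \<and> y k \<in> absolute_cone}" by (auto simp: b_def)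
  have P: "finite ?P" "?P \<subseteq> sphere 0 1" "{z \<in> b ` {..?n}. norm z = 1} \<subseteq> ?P"
    unfolding Pb using babs by auto
  have pos: "0 < ell (b k) x" if "norm x = 1" "x \<notin> ?P" "k \<le> ?n" for x k
    using that P(3) ell_pos[OF that(1) b[OF that(3)]] ell_ge_interior[OF that(1), of "b k"] b[OF that(3)]
    by (cases "norm (b k) = 1") force+
  have \<omega>: "?\<omega> x (frame x) = M * (\<gamma> + ln (ell (b 0) x) - ln (ell (b 1) x)) *
      det_rows ((\<lambda>i. b i - b 0)(1 := x - b 0)) / (\<Prod>k\<in>I 1. ell (b k) x)"
    if x: "norm x = 1" "x \<notin> ?P" for x
    unfolding M_def \<gamma>_def I_def b_def
    by (rule absolute_form_value[OF n y x(1)]) (use pos[OF x] in \<open>simp_all add: b_def\<close>)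
  show ?thesis
  proof (cases "\<Delta> = 0")
    case False
    then have \<Delta>': "det_rows (\<lambda>i. b i - b 0) \<noteq> 0" by (simp add: \<Delta>_def)
    have inj: "inj_on b {..?n}" by (rule barycentric_inj[OF \<Delta>'])
    obtain c d where cd: "\<And>x. (\<Sum>k\<le>?n. c k \<bullet> x - d k) = 1" "\<And>x. (\<Sum>k\<le>?n. (c k \<bullet> x - d k) *\<^sub>R b k) = x"
      "\<And>j k. j \<le> ?n \<Longrightarrow> k \<le> ?n \<Longrightarrow> c j \<bullet> b k - d j = (if j = k then 1 else 0)"
      "\<And>x. det_rows ((\<lambda>i. b i - b 0)(1 := x - b 0)) = det_rows (\<lambda>i. b i - b 0) * (c 1 \<bullet> x - d 1)"
      by (rule barycentric_coordinates[OF \<Delta>']) (rule that)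
    define r where "r j = (if j = 1 then 0 else 1 :: nat)" for j :: nat
    define R where "R j x = (c j \<bullet> x - d j) * (Reg (I j) (r j) (\<lambda>k. ell (b k) x) * (\<Prod>k\<in>I j. ell (b k) x)) /
      (\<Prod>k\<in>I j. ell (b k) x)" for j x
    define L where "L x = (c 1 \<bullet> x - d 1) * \<gamma> / (\<Prod>k\<in>I 1. ell (b k) x)" for x
    have c0: "c j \<bullet> b k = d j" if "j \<le> ?n" "k \<in> {..?n} - {j}" for j k using cd(3)[of j k] that by (auto split: if_splits)
    have nR: "null_form ?P (R j)" if j: "j \<in> {..?n}" for j
      unfolding R_def I_def
      by (rule null_form_regular_part(1)[OF n b inj _ _ c0 P]) (use j n in \<open>auto simp: r_def\<close>)
    have nL: "null_form ?P L"
      unfolding L_def I_def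
      by (rule null_form_regular_part(2)[OF n b inj _ _ c0 P, where r = 0]) (use n in auto)
    \<comment> \<open>What the form contains besides
      \<open>M * \<Delta> * simplex_kernel b x\<close>: the constant \<gamma> of the lifts and the
      regularized summands, each odd under the reflection in a facet.\<close>
    have nf: "null_form ?P (\<lambda>x. (M * \<Delta>) * L x + (- (M * \<Delta>)) * (\<Sum>j\<le>?n. R j x))"
      by (intro null_form_add null_form_cmult null_form_sum nL nR) auto
    have eq: "?\<omega> x (frame x) = M * \<Delta> * simplex_kernel b x + ((M * \<Delta>) * L x + (- (M * \<Delta>)) * (\<Sum>j\<le>?n. R j x))"
      if x: "norm x = 1" "x \<notin> ?P" for x
    proof -
      define a where "a k = ell (b k) x" for k
      have a: "0 < a k \<and> a k \<le> 2" if "k \<le> ?n" for k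
        using pos[OF x that] ell_le_2[OF x(1) b[OF that]] by (simp add: a_def)
      have s0: "(\<Sum>k\<le>?n. (c k \<bullet> x - d k) * a k) = 0"
      proof -
        have "(\<Sum>k\<le>?n. (c k \<bullet> x - d k) * a k) = (\<Sum>k\<le>?n. c k \<bullet> x - d k) - x \<bullet> (\<Sum>k\<le>?n. (c k \<bullet> x - d k) *\<^sub>R b k)"
          by (simp add: a_def ell_def right_diff_distrib sum_subtractf inner_sum_right)
        also have "\<dots> = 1 - x \<bullet> x" by (simp only: cd(1,2))
        finally show ?thesis using x by (simp add: norm_eq_sqrt_inner)
      qed
      have R: "R j x = (c j \<bullet> x - d j) * Reg ({..?n} - {j}) (if j = 1 then 0 else 1) a" if "j \<le> ?n" for j
      proof -
        have "0 < (\<Prod>k\<in>I j. ell (b k) x)" by (rule prod_pos) (use a in \<open>auto simp: I_def a_def\<close>)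
        then show ?thesis
          by (simp add: R_def I_def r_def a_def[abs_def] less_imp_neq[symmetric] del: prod_zero_iff)
      qed
      have K: "simplex_kernel b x = (\<Sum>j\<le>?n. R j x) + (c 1 \<bullet> x - d 1) / (\<Prod>k\<in>I 1. a k) * (ln (a 0) - ln (a 1))"
        unfolding simplex_kernel_def a_def[symmetric]
        using integral_inverse_prod[OF a _ cd(1)[of x] s0] n by (simp add: R I_def)
      show ?thesis
        unfolding \<omega>[OF x] cd(4)[folded \<Delta>_def] L_def a_def[symmetric] by (simp add: K algebra_simps add_divide_distrib diff_divide_distrib)
    qed
    have int: "integrable sphere_measure (\<lambda>x. M * \<Delta> * simplex_kernel b x)"
      using integrable_simplex_kernel[OF n b \<Delta>'] by simp
    have "has_absolute_integral ?P ?\<omega> (\<integral>x. M * \<Delta> * simplex_kernel b x \<partial>sphere_measure)"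
      by (rule has_absolute_integralI[OF n P(1) nf int]) (rule eq)
    moreover have "(\<integral>x. M * \<Delta> * simplex_kernel b x \<partial>sphere_measure) =
        M * measure (sphere_measure :: (real^'n::_) measure) (sphere 0 1) / real ?n * (fact ?n * hyp_vol b)"
    proof -
      define V where "V = set_lebesgue_integral lborel (geodesic_simplex b) hyp_density"
      have "(\<integral>x. M * \<Delta> * simplex_kernel b x \<partial>sphere_measure) = M * (sgn \<Delta> * (\<bar>\<Delta>\<bar> * (\<integral>x. simplex_kernel b x \<partial>sphere_measure)))"
        by (simp add: sgn_mult_abs mult.assoc[symmetric])
      \<comment> \<open>Multiplying this (n - 1)! by n gives the factorial in the claim, compensated
        by the division of the volume of the sphere by n.\<close>
      also have "\<bar>\<Delta>\<bar> * (\<integral>x. simplex_kernel b x \<partial>sphere_measure) = fact (?n - 1) * (?n * unit_ball_vol ?n) * V"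
        unfolding \<Delta>_def V_def by (rule integral_simplex_kernel[OF n b \<Delta>'])
      also have "fact (?n - 1) * (?n * unit_ball_vol ?n) * V = (?n * unit_ball_vol ?n) / real ?n * (fact ?n * V)"
        by (subst (2) fact_reduce) auto
      finally show ?thesis by (simp add: measure_unit_sphere hyp_vol_def \<Delta>_def V_def mult.left_commute)
    qed
    ultimately show ?thesis by (simp add: M_def b_def[abs_def])
  next
    case True
    \<comment> \<open>The simplex is degenerate and has volume 0, but the form need not vanish
      pointwise.\<close>
    obtain c where c: "\<And>x. det_rows ((\<lambda>i. b i - b 0)(1 := x - b 0)) = c \<bullet> x - c \<bullet> b 0"
      using det_rows_affine by metis
    define f where "f x = (c \<bullet> x - c \<bullet> b 0) * (\<gamma> + ln (ell (b 0) x) - ln (ell (b 1) x)) / (\<Prod>k\<in>I 1. ell (b k) x)" for x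
    have "null_form ?P f"
    proof (cases "inj_on b (I 1)")
      case inj: True
      \<comment> \<open>Putting \<open>b k - b 0\<close> into row 1 gives a zero row, the original
        vanishing determinant or a repeated row, so every vertex lies on the hyperplane.\<close>
      have cb: "c \<bullet> b k = c \<bullet> b 0" if k: "k \<le> ?n" for k
      proof -
        consider "k = 0" | "k = 1" | "k \<in> {2..?n}" using k by force
        then have "det_rows ((\<lambda>i. b i - b 0)(1 := b k - b 0)) = 0"
        proof cases
          case 1
          then show ?thesis using n by (intro det_rows_zero_row[of 1]) auto
        next
          case 2
          then have "(\<lambda>i. b i - b 0)(1 := b k - b 0) = (\<lambda>i. b i - b 0)" by auto
          then show ?thesis using True by (simp add: \<Delta>_def)
        next
          case 3
          then show ?thesis using n by (intro det_rows_eq_rows[of 1 k]) auto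
        qed
        then show ?thesis using c[of "b k"] by simp
      qed
      show ?thesis
        unfolding f_def I_def by (rule null_form_degenerate[OF n b inj[unfolded I_def] cb P])
    next
      case False
      \<comment> \<open>Coinciding vertices with indices other than 1 give a zero row or two equal
        rows for every \<open>x\<close>, so the form vanishes identically.\<close>
      then obtain k l where kl: "k \<in> I 1" "l \<in> I 1" "k < l" "b k = b l"
        unfolding inj_on_def by (metis linorder_neqE_nat)
      have "det_rows ((\<lambda>i. b i - b 0)(1 := x - b 0)) = 0" for x
      proof (cases "k = 0")
        case True
        then show ?thesis using kl n by (intro det_rows_zero_row[of l]) (auto simp: I_def)
      next
        case False
        then show ?thesis using kl n by (intro det_rows_eq_rows[of k l]) (auto simp: I_def)
      qed
      then have "f = (\<lambda>x. 0)" using c by (simp add: f_def fun_eq_iff)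
      then show ?thesis by (simp add: null_form_def)
    qed
    then have nf: "null_form ?P (\<lambda>x. M * f x)" by (rule null_form_cmult)
    have "has_absolute_integral ?P ?\<omega> (\<integral>x. 0 \<partial>(sphere_measure :: (real^'n::_) measure))"
    proof (rule has_absolute_integralI[OF n P(1) nf])
      show "?\<omega> x (frame x) = 0 + M * f x" if "norm x = 1" "x \<notin> ?P" for x
        unfolding \<omega>[OF that] c f_def by simp
    qed simp
    moreover have "hyp_vol (\<lambda>i. ball_point (y i)) = 0"
      using True by (simp add: hyp_vol_def \<Delta>_def b_def)
    ultimately show ?thesis by simp
  qed
qed

end
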